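(* Let $T=(T_1,\dots,T_k)$ be a completely non-coisometric $k$-tuple in the $\Lambda$-polyball $\mathbf B_\Lambda(\mathcal H)$ which admits a characteristic function, and let $\mathbf S=(\mathbf S_1,\dots,\mathbf S_k)$ be the universal model. Set $$\mathcal D:=\overline{\Delta_T(I)(\mathcal H)},\qquad\mathcal D_*:=\overline{\Delta_{M_T}(I)(\mathcal M_T)},$$ and $D_{\Theta_T}:=(I-\Theta_T^*\Theta_T)^{1/2}$, where $\Theta_T:\ell^2(\mathbf F)\otimes\mathcal D_*\to\ell^2(\mathbf F)\otimes\mathcal D$ is the characteristic function of $T$. Let $$\mathbb K_T:=\big(\ell^2(\mathbf F)\otimes\mathcal D\big)\oplus\overline{D_{\Theta_T}(\ell^2(\mathbf F)\otimes\mathcal D_* )},$$ $$\mathbb H_T:=\mathbb K_T\ominus\{\Theta_T\varphi\oplus D_{\Theta_T}\varphi:\ \varphi\in\ell^2(\mathbf F)\otimes\mathcal D_*\},$$ and let $\mathbf P^{\mathbb K_T}_{\ell^2(\mathbf F)\otimes\mathcal D}$ be the orthogonal projection of $\mathbb K_T$ onto $\ell^2(\mathbf F)\otimes\mathcal D$. Then $\mathbf P^{\mathbb K_T}_{\ell^2(\mathbf F)\otimes\mathcal D}|_{\mathbb H_T}$ is a one-to-one operator, and $T$ is unitarily equivalent to $\mathbb G=(\mathbb G_1,\dots,\mathbb G_k)\in\mathbf B_\Lambda(\mathbb H_T)$, where $\mathbb G_i=(\mathbb G_{i,1},\dots,\mathbb G_{i,n_i})$ and, for each $i\in\{1,\dots,k\}$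 and $s\in\{1,\dots,n_i\}$, $\mathbb G_{i,s}$ is the bounded operator on $\mathbb H_T$ uniquely defined by the relation $$\Big(\mathbf P^{\mathbb K_T}_{\ell^2(\mathbf F)\otimes\mathcal D}|_{\mathbb H_T}\Big)\mathbb G_{i,s}^*f=(S_{i,s}^*\otimes I_{\mathcal D})\Big(\mathbf P^{\mathbb K_T}_{\ell^2(\mathbf F)\otimes\mathcal D}|_{\mathbb H_T}\Big)f,\qquad f\in\mathbb H_T.$$
   Context: Let $k,n_1,\dots,n_k$ be positive integers. For $i,j\in\{1,\dots,k\}$, $i\ne j$, let $\Lambda_{ij}=[\lambda_{i,j}(s,t)]$ be an $n_i\times n_j$ matrix with entries in $\mathbb T=\{z\in\mathbb C:|z|=1\}$, with $\Lambda_{ji}=\Lambda_{ij}^*$, i.e. $\lambda_{j,i}(t,s)=\overline{\lambda_{i,j}(s,t)}$. Words: $\mathbb F_{n_i}^+$ is the unital free semigroup with generators $g^i_1,\dots,g^i_{n_i}$ and neutral element $g^i_0$. If $X_{i,1},\dots,X_{i,n_i}$ are operators and $\alpha=g^i_{p_1}\cdots g^i_{p_m}$, put $X_{i,\alpha}=X_{i,p_1}\cdots X_{i,p_m}$, and $X_{i,g^i_0}=I$. Set $\mathbf F=\mathbb F_{n_1}^+\times\cdots\times\mathbb F_{n_k}^+$. Universal model $\mathbf S=(\mathbf S_1,\dots,\mathbf S_k)$, $\mathbf S_i=[S_{i,1}\cdots S_{i,n_i}]$: on $\ell^2(\mathbf F)$ with orthonormal basis $\{\chi_{(\alpha_1,\dots,\alpha_k)}\}$,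 $$S_{i,s}\chi_{(\alpha_1,\dots,\alpha_k)}=\boldsymbol\lambda_{i,1}(s,\alpha_1)\cdots\boldsymbol\lambda_{i,i-1}(s,\alpha_{i-1})\,\chi_{(\alpha_1,\dots,\alpha_{i-1},g^i_s\alpha_i,\alpha_{i+1},\dots,\alpha_k)}$$ (no scalar factor if $i=1$), where $\boldsymbol\lambda_{i,j}(s,\beta)=\prod_{b=1}^q\lambda_{i,j}(s,j_b)$ for $\beta=g^j_{j_1}\cdots g^j_{j_q}$ and $\boldsymbol\lambda_{i,j}(s,g^j_0)=1$. Regular $\Lambda$-polyball: $\mathbf B_\Lambda(\mathcal H)$ is the set of $k$-tuples $T=(T_1,\dots,T_k)$ of row contractions $T_i=[T_{i,1}\cdots T_{i,n_i}]$, $T_{i,s}\in B(\mathcal H)$, $\sum_sT_{i,s}T_{i,s}^*\le I$, such that $T_{i,s}T_{j,t}=\lambda_{i,j}(s,t)T_{j,t}T_{i,s}$ for all $i\ne j$ and all $s,t$, and $\Delta_{rT}(I)\ge0$ for all $r\in[0,1)$, where $\Phi_{T_i}(X)=\sum_sT_{i,s}XT_{i,s}^*$, $\Delta_T(I)=(\mathrm{id}-\Phi_{T_k})\circ\cdots\circ(\mathrm{id}-\Phi_{T_1})(I)$ and $rT$ has entries $rT_{i,s}$; then also $\Delta_T(I)\ge0$. $T$ is completely non-coisometric if there is no $h\in\mathcal H$, $h\ne0$, with $\langle(\mathrm{id}-\Phi_{T_k}^{p_k})\circ\cdots\circ(\mathrm{id}-\Phi_{T_1}^{p_1})(I)h,h\rangle=0$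 for all $(p_1,\dots,p_k)\in\mathbb N^k$. Tuples $T$ on $\mathcal H$ and $T'$ on $\mathcal H'$ are unitarily equivalent if there is a unitary $W:\mathcal H\to\mathcal H'$ with $T_{i,s}=W^*T'_{i,s}W$ for all $i,s$. Berezin kernel: $K_T:\mathcal H\to\ell^2(\mathbf F)\otimes\overline{\Delta_T(I)\mathcal H}$, $K_Th=\sum_{(\beta_1,\dots,\beta_k)\in\mathbf F}\chi_{(\beta_1,\dots,\beta_k)}\otimes\Delta_T(I)^{1/2}T_{k,\beta_k}^*\cdots T_{1,\beta_1}^*h$; it is a contraction. A bounded operator $A:\ell^2(\mathbf F)\otimes\mathcal E\to\ell^2(\mathbf F)\otimes\mathcal K$ is multi-analytic if $A(S_{i,s}\otimes I_{\mathcal E})=(S_{i,s}\otimes I_{\mathcal K})A$ for all $i,s$. $T\in\mathbf B_\Lambda(\mathcal H)$ admits a characteristic function if there are a Hilbert space $\mathcal E$ and a multi-analytic $\Psi:\ell^2(\mathbf F)\otimes\mathcal E\to\ell^2(\mathbf F)\otimes\overline{\Delta_T(I)\mathcal H}$ with $K_TK_T^*+\Psi\Psi^*=I$. In that case the characteristic function $\Theta_T$ is the following multi-analytic operator. Let $Y=I-K_TK_T^*$ and $\mathcal M_T=\overline{\mathrm{range}\,Y}$. Define $A_{i,s}\in B(\mathcal M_T)$ uniquely by $A_{i,s}(Y^{1/2}f)=Y^{1/2}(S_{i,s}^*\otimes I)f$ for $f\in\ell^2(\mathbf F)\otimes\overline{\Delta_T(I)\mathcal H}$, and put $M_{i,s}=A_{i,s}^*$,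 $M_i=(M_{i,1},\dots,M_{i,n_i})$, $M_T=(M_1,\dots,M_k)$. Then $M_T$ is a pure element of $\mathbf B_\Lambda(\mathcal M_T)$ (i.e. $\Phi_{M_i}^p(I)\to0$ for each $i$), with Berezin kernel $K_{M_T}:\mathcal M_T\to\ell^2(\mathbf F)\otimes\overline{\Delta_{M_T}(I)\mathcal M_T}$, and $$\Theta_T:=(I-K_TK_T^* )^{1/2}K_{M_T}^*:\ \ell^2(\mathbf F)\otimes\overline{\Delta_{M_T}(I)\mathcal M_T}\to\ell^2(\mathbf F)\otimes\overline{\Delta_T(I)\mathcal H};$$ it satisfies $K_TK_T^*+\Theta_T\Theta_T^*=I$. *)

theory Defs
  imports "HOL-Analysis.Analysis" "HOL-Library.Nonpos_Ints"
begin

section \<open>Complex Hilbert spaces\<close>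

text \<open>
  The inner product is linear in the first argument.  The underlying real inner product (which
  carries norm, topology and completeness) is its real part.
\<close>

class complex_hilbert = real_inner + complete_space +
  fixes scaleC :: "complex \<Rightarrow> 'a \<Rightarrow> 'a" (infixr "*\<^sub>C" 75)
    and cinner :: "'a \<Rightarrow> 'a \<Rightarrow> complex"
  assumes scaleC_add_right: "a *\<^sub>C (x + y) = a *\<^sub>C x + a *\<^sub>C y"
    and scaleC_add_left: "(a + b) *\<^sub>C x = a *\<^sub>C x + b *\<^sub>C x"
    and scaleC_scaleC: "a *\<^sub>C (b *\<^sub>C x) = (a * b) *\<^sub>C x"
    and scaleR_scaleC: "r *\<^sub>R x = complex_of_real r *\<^sub>C x"
    and cinner_commute: "cinner x y = cnj (cinner y x)"
    and cinner_add_left: "cinner (x + y) z = cinner x z + cinner y z"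
    and cinner_scaleC_left: "cinner (a *\<^sub>C x) y = a * cinner x y"
    and inner_Re_cinner: "inner x y = Re (cinner x y)"

lemma scaleC_one: "1 *\<^sub>C x = x"
  using scaleR_scaleC[of 1 x] by simp

lemma scaleC_zero_left: "0 *\<^sub>C x = 0"
  using scaleR_scaleC[of 0 x] by simp

lemma scaleC_zero_right: "a *\<^sub>C 0 = 0"
  by (metis add_cancel_right_right scaleC_add_right)

lemma cinner_add_right: "cinner x (y + z) = cinner x y + cinner x z"
  by (metis cinner_add_left cinner_commute complex_cnj_add)

lemma cinner_scaleC_right: "cinner x (a *\<^sub>C y) = cnj a * cinner x y"
  by (metis cinner_scaleC_left cinner_commute complex_cnj_mult)

lemma cinner_self: "cinner x x = complex_of_real ((norm x)\<^sup>2)"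
proof -
  have "Im (cinner x x) = 0"
    using arg_cong[where f = Im, OF cinner_commute[of x x]] by simp
  moreover have "Re (cinner x x) = (norm x)\<^sup>2"
    by (simp add: inner_Re_cinner[symmetric] power2_norm_eq_inner)
  ultimately show ?thesis by (simp add: complex_eq_iff)
qed

lemma norm_scaleC: "norm (a *\<^sub>C x) = cmod a * norm x"
proof -
  have "complex_of_real ((norm (a *\<^sub>C x))\<^sup>2) = a * cnj a * cinner x x"
    unfolding cinner_self[symmetric] by (simp add: cinner_scaleC_left cinner_scaleC_right)
  also have "\<dots> = complex_of_real ((cmod a * norm x)\<^sup>2)"
    by (simp only: cinner_self complex_norm_square[symmetric] of_real_mult power_mult_distrib)
  finally have "(norm (a *\<^sub>C x))\<^sup>2 = (cmod a * norm x)\<^sup>2"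
    using of_real_eq_iff by blast
  then show ?thesis by (simp add: power2_eq_iff_nonneg)
qed

lemma Im_cinner: "Im (cinner x y) = inner x (\<i> *\<^sub>C y)"
  by (simp add: inner_Re_cinner cinner_scaleC_right)

lemma norm_cinner_le: "cmod (cinner x y) \<le> norm x * norm y"
proof (cases "cinner x y = 0")
  case False
  define a where "a = cnj (sgn (cinner x y))"
  have "a * cinner x y = complex_of_real (cmod (cinner x y))"
    using False complex_norm_square[of "cinner x y"]
    by (simp add: a_def sgn_eq power2_eq_square field_simps)
  then have "cmod (cinner x y) = inner (a *\<^sub>C x) y"
    by (simp add: inner_Re_cinner cinner_scaleC_left)
  also have "\<dots> \<le> norm (a *\<^sub>C x) * norm y" by (rule norm_cauchy_schwarz)
  also have "\<dots> = norm x * norm y" using False by (simp add: norm_scaleC a_def norm_sgn)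
  finally show ?thesis .
qed simp

instantiation complex :: complex_hilbert
begin
definition scaleC_complex :: "complex \<Rightarrow> complex \<Rightarrow> complex" where
  "scaleC_complex a x = a * x"
definition cinner_complex :: "complex \<Rightarrow> complex \<Rightarrow> complex" where
  "cinner_complex x y = x * cnj y"
instance
  by standard (auto simp: scaleC_complex_def cinner_complex_def algebra_simps scaleR_conv_of_real
      inner_complex_def)
end

instantiation prod :: (complex_hilbert, complex_hilbert) complex_hilbert
begin
definition scaleC_prod :: "complex \<Rightarrow> 'a \<times> 'b \<Rightarrow> 'a \<times> 'b" where
  "scaleC_prod a x = (a *\<^sub>C fst x, a *\<^sub>C snd x)"
definition cinner_prod :: "'a \<times> 'b \<Rightarrow> 'a \<times> 'b \<Rightarrow> complex" where
  "cinner_prod x y = cinner (fst x) (fst y) + cinner (snd x) (snd y)"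
instance
proof
  fix x y :: "'a \<times> 'b"
  show "cinner x y = cnj (cinner y x)"
    using cinner_commute[of "fst x" "fst y"] cinner_commute[of "snd x" "snd y"]
    by (simp add: cinner_prod_def)
qed (auto simp: scaleC_prod_def cinner_prod_def scaleC_add_right scaleC_add_left scaleC_scaleC
      scaleR_prod_def scaleR_scaleC cinner_add_left cinner_scaleC_left inner_prod_def
      inner_Re_cinner algebra_simps)
end


section \<open>Square summable families\<close>

typedef (overloaded) ('i, 'a) ell2 =
  "{f :: 'i \<Rightarrow> 'a::complex_hilbert. (\<lambda>x. (norm (f x))\<^sup>2) summable_on UNIV}"
  morphisms coord ell2_of
  by (rule exI[of _ "\<lambda>_. 0"]) simp

setup_lifting type_definition_ell2

lemma norm_sq_add_le: "(norm (x + y :: 'a::real_normed_vector))\<^sup>2 \<le> 2 * (norm x)\<^sup>2 + 2 * (norm y)\<^sup>2"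
proof -
  have "(norm (x + y))\<^sup>2 \<le> (norm x + norm y)\<^sup>2"
    by (rule power_mono) (auto simp: norm_triangle_ineq)
  also have "\<dots> \<le> 2 * (norm x)\<^sup>2 + 2 * (norm y)\<^sup>2"
    using sum_squares_ge_zero[of "norm x - norm y" 0] by (simp add: power2_eq_square algebra_simps)
  finally show ?thesis .
qed

lemma sq_summable_add:
  fixes f g :: "'i \<Rightarrow> 'a::real_normed_vector"
  assumes "(\<lambda>x. (norm (f x))\<^sup>2) summable_on UNIV" "(\<lambda>x. (norm (g x))\<^sup>2) summable_on UNIV"
  shows "(\<lambda>x. (norm (f x + g x))\<^sup>2) summable_on UNIV"
proof (rule summable_on_comparison_test)
  show "(\<lambda>x. 2 * (norm (f x))\<^sup>2 + 2 * (norm (g x))\<^sup>2) summable_on UNIV"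
    by (intro summable_on_add summable_on_cmult_right assms)
qed (auto simp: norm_sq_add_le)

lemma sq_summable_scaleC:
  fixes f :: "'i \<Rightarrow> 'a::complex_hilbert"
  assumes "(\<lambda>x. (norm (f x))\<^sup>2) summable_on UNIV"
  shows "(\<lambda>x. (norm (a *\<^sub>C f x))\<^sup>2) summable_on UNIV"
  unfolding norm_scaleC power_mult_distrib by (intro summable_on_cmult_right assms)

lemma sq_summable_cinner:
  fixes f g :: "'i \<Rightarrow> 'a::complex_hilbert"
  assumes "(\<lambda>x. (norm (f x))\<^sup>2) summable_on UNIV" "(\<lambda>x. (norm (g x))\<^sup>2) summable_on UNIV"
  shows "(\<lambda>x. cinner (f x) (g x)) summable_on UNIV"
proof -
  have "cmod (cinner (f x) (g x)) \<le> (norm (f x))\<^sup>2 + (norm (g x))\<^sup>2" for x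
  proof -
    have "2 * (norm (f x) * norm (g x)) \<le> (norm (f x))\<^sup>2 + (norm (g x))\<^sup>2"
      using sum_squares_ge_zero[of "norm (f x) - norm (g x)" 0]
      by (simp add: power2_eq_square algebra_simps)
    moreover have "cmod (cinner (f x) (g x)) \<le> norm (f x) * norm (g x)" by (rule norm_cinner_le)
    moreover have "0 \<le> norm (f x) * norm (g x)" by simp
    ultimately show ?thesis by linarith
  qed
  then have "(\<lambda>x. cmod (cinner (f x) (g x))) summable_on UNIV"
    by (intro summable_on_comparison_test[OF summable_on_add[OF assms]]) auto
  then show ?thesis by (rule abs_summable_summable)
qed

lemma coord_sq_summable: "(\<lambda>x. (norm (coord f x))\<^sup>2) summable_on UNIV"
  using coord[of f] by simp

instantiation ell2 :: (type, complex_hilbert) real_inner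
begin

lift_definition zero_ell2 :: "('a, 'b) ell2" is "\<lambda>_. 0" by simp
lift_definition plus_ell2 :: "('a, 'b) ell2 \<Rightarrow> ('a, 'b) ell2 \<Rightarrow> ('a, 'b) ell2"
  is "\<lambda>f g x. f x + g x" by (rule sq_summable_add)
lift_definition uminus_ell2 :: "('a, 'b) ell2 \<Rightarrow> ('a, 'b) ell2"
  is "\<lambda>f x. - f x" by simp
lift_definition minus_ell2 :: "('a, 'b) ell2 \<Rightarrow> ('a, 'b) ell2 \<Rightarrow> ('a, 'b) ell2"
  is "\<lambda>f g x. f x - g x"
  using sq_summable_add[of _ "\<lambda>x. - _ x"] by simp
lift_definition ell2_scaleC :: "complex \<Rightarrow> ('a, 'b) ell2 \<Rightarrow> ('a, 'b) ell2"
  is "\<lambda>a f x. a *\<^sub>C f x" by (rule sq_summable_scaleC)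
definition scaleR_ell2 :: "real \<Rightarrow> ('a, 'b) ell2 \<Rightarrow> ('a, 'b) ell2" where
  "scaleR_ell2 r f = ell2_scaleC (complex_of_real r) f"
definition ell2_cinner :: "('a, 'b) ell2 \<Rightarrow> ('a, 'b) ell2 \<Rightarrow> complex" where
  "ell2_cinner f g = (\<Sum>\<^sub>\<infinity>x. cinner (coord f x) (coord g x))"
definition inner_ell2 :: "('a, 'b) ell2 \<Rightarrow> ('a, 'b) ell2 \<Rightarrow> real" where
  "inner_ell2 f g = Re (ell2_cinner f g)"
definition norm_ell2 :: "('a, 'b) ell2 \<Rightarrow> real" where
  "norm_ell2 f = sqrt (inner f f)"
definition dist_ell2 :: "('a, 'b) ell2 \<Rightarrow> ('a, 'b) ell2 \<Rightarrow> real" where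
  "dist_ell2 f g = norm (f - g)"
definition sgn_ell2 :: "('a, 'b) ell2 \<Rightarrow> ('a, 'b) ell2" where
  "sgn_ell2 f = inverse (norm f) *\<^sub>R f"
definition uniformity_ell2 :: "(('a, 'b) ell2 \<times> ('a, 'b) ell2) filter" where
  "uniformity_ell2 = (INF e\<in>{0<..}. principal {(f, g). dist f g < e})"
definition open_ell2 :: "('a, 'b) ell2 set \<Rightarrow> bool" where
  "open_ell2 U \<longleftrightarrow> (\<forall>x\<in>U. \<forall>\<^sub>F (x', y) in uniformity. x' = x \<longrightarrow> y \<in> U)"

lemma coord_scaleR: "coord (r *\<^sub>R f :: ('a, 'b) ell2) x = r *\<^sub>R coord f x"
  by (simp add: scaleR_ell2_def ell2_scaleC.rep_eq scaleR_scaleC)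

lemma ell2_inner_self:
  "inner (f :: ('a, 'b) ell2) f = (\<Sum>\<^sub>\<infinity>x. (norm (coord f x))\<^sup>2)"
proof -
  have "ell2_cinner f f = complex_of_real (\<Sum>\<^sub>\<infinity>x. (norm (coord f x))\<^sup>2)"
    unfolding ell2_cinner_def cinner_self
    by (rule infsum_bounded_linear_strong[OF _ bounded_linear_of_real])
      (use coord_sq_summable[of f] summable_on_of_real in blast)
  then show ?thesis by (simp add: inner_ell2_def)
qed

lemma ell2_norm_sq: "(norm (f :: ('a, 'b) ell2))\<^sup>2 = (\<Sum>\<^sub>\<infinity>x. (norm (coord f x))\<^sup>2)"
  by (simp add: norm_ell2_def ell2_inner_self infsum_nonneg)

lemma ell2_finite_sum_le:
  assumes "finite A"
  shows "(\<Sum>x\<in>A. (norm (coord (f :: ('a, 'b) ell2) x))\<^sup>2) \<le> (norm f)\<^sup>2"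
  unfolding ell2_norm_sq using assms
  by (intro finite_sum_le_infsum coord_sq_summable) auto

lemma ell2_inner_pre:
  fixes f g h :: "('a, 'b) ell2"
  shows "ell2_cinner f g = cnj (ell2_cinner g f)"
    and "ell2_cinner (f + g) h = ell2_cinner f h + ell2_cinner g h"
    and "ell2_cinner (ell2_scaleC a f) g = a * ell2_cinner f g"
proof -
  show "ell2_cinner f g = cnj (ell2_cinner g f)"
    unfolding ell2_cinner_def infsum_cnj[symmetric]
    by (intro infsum_cong cinner_commute)
  show "ell2_cinner (f + g) h = ell2_cinner f h + ell2_cinner g h"
    unfolding ell2_cinner_def plus_ell2.rep_eq cinner_add_left
    by (intro infsum_add sq_summable_cinner coord_sq_summable)
  show "ell2_cinner (ell2_scaleC a f) g = a * ell2_cinner f g"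
    unfolding ell2_cinner_def ell2_scaleC.rep_eq cinner_scaleC_left
    by (rule infsum_cmult_right')
qed

instance
proof intro_classes
  fix f g h :: "('a, 'b) ell2" and a b :: complex and r s :: real
  show "f + g + h = f + (g + h)" by transfer (simp add: add.assoc)
  show "f + g = g + f" by transfer (simp add: add.commute)
  show "0 + f = f" by transfer simp
  show "- f + f = 0" by transfer simp
  show "f - g = f + - g" by transfer simp
  show "r *\<^sub>R (f + g) = r *\<^sub>R f + r *\<^sub>R g"
    unfolding scaleR_ell2_def by transfer (simp add: scaleC_add_right)
  show "(r + s) *\<^sub>R f = r *\<^sub>R f + s *\<^sub>R f"
    unfolding scaleR_ell2_def by transfer (simp add: scaleC_add_left)
  show "r *\<^sub>R s *\<^sub>R f = (r * s) *\<^sub>R f"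
    unfolding scaleR_ell2_def by transfer (simp add: scaleC_scaleC)
  show "1 *\<^sub>R f = f" unfolding scaleR_ell2_def by transfer (simp add: scaleC_one)
  show "dist f g = norm (f - g)" by (rule dist_ell2_def)
  show "sgn f = inverse (norm f) *\<^sub>R f" by (rule sgn_ell2_def)
  show "uniformity = (INF e\<in>{0<..}. principal {(f, g :: ('a, 'b) ell2). dist f g < e})"
    by (rule uniformity_ell2_def)
  show "open U = (\<forall>x\<in>U. \<forall>\<^sub>F (x', y) in uniformity. x' = x \<longrightarrow> y \<in> U)"
    for U :: "('a, 'b) ell2 set" by (rule open_ell2_def)
  show "inner f g = inner g f"
    unfolding inner_ell2_def using ell2_inner_pre(1)[of f g] by simp
  show "inner (f + g) h = inner f h + inner g h"
    unfolding inner_ell2_def using ell2_inner_pre(2)[of f g h] by simp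
  show "inner (r *\<^sub>R f) g = r * inner f g"
    unfolding inner_ell2_def scaleR_ell2_def ell2_inner_pre(3) by simp
  show "0 \<le> inner f f" by (simp add: ell2_inner_self infsum_nonneg)
  show "inner f f = 0 \<longleftrightarrow> f = 0"
  proof
    assume *: "inner f f = 0"
    have "(norm (coord f x))\<^sup>2 = 0" for x
      by (rule nonneg_infsum_le_0D[OF _ coord_sq_summable]) (use * in \<open>auto simp: ell2_inner_self\<close>)
    then have "coord f = coord 0" by (auto simp: zero_ell2.rep_eq)
    then show "f = 0" by (simp add: coord_inject)
  qed (simp add: ell2_inner_self zero_ell2.rep_eq)
  show "norm f = sqrt (inner f f)" by (rule norm_ell2_def)
qed

end

instantiation ell2 :: (type, complex_hilbert) complex_hilbert
begin

definition scaleC_ell2 :: "complex \<Rightarrow> ('a, 'b) ell2 \<Rightarrow> ('a, 'b) ell2" where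
  "scaleC_ell2 = ell2_scaleC"
definition cinner_ell2 :: "('a, 'b) ell2 \<Rightarrow> ('a, 'b) ell2 \<Rightarrow> complex" where
  "cinner_ell2 = ell2_cinner"

instance
proof intro_classes
  fix f g h :: "('a, 'b) ell2" and a b :: complex and r :: real
  show "a *\<^sub>C (f + g) = a *\<^sub>C f + a *\<^sub>C g"
    unfolding scaleC_ell2_def by transfer (simp add: scaleC_add_right)
  show "(a + b) *\<^sub>C f = a *\<^sub>C f + b *\<^sub>C f"
    unfolding scaleC_ell2_def by transfer (simp add: scaleC_add_left)
  show "a *\<^sub>C b *\<^sub>C f = (a * b) *\<^sub>C f"
    unfolding scaleC_ell2_def by transfer (simp add: scaleC_scaleC)
  show "r *\<^sub>R f = complex_of_real r *\<^sub>C f" by (simp add: scaleR_ell2_def scaleC_ell2_def)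
  show "cinner f g = cnj (cinner g f)" unfolding cinner_ell2_def by (rule ell2_inner_pre)
  show "cinner (f + g) h = cinner f h + cinner g h"
    unfolding cinner_ell2_def by (rule ell2_inner_pre)
  show "cinner (a *\<^sub>C f) g = a * cinner f g"
    unfolding cinner_ell2_def scaleC_ell2_def by (rule ell2_inner_pre)
  show "inner f g = Re (cinner f g)" by (simp add: inner_ell2_def cinner_ell2_def)
next
  fix X :: "nat \<Rightarrow> ('a, 'b) ell2"
  assume X: "Cauchy X"
  have norm_dist: "dist f g = norm (f - g)" for f g :: "('a, 'b) ell2" by (rule dist_ell2_def)
  have coord_le: "norm (coord f x) \<le> norm f" for f :: "('a, 'b) ell2" and x
  proof -
    have "(norm (coord f x))\<^sup>2 \<le> (norm f)\<^sup>2" using ell2_finite_sum_le[of "{x}" f] by simp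
    moreover have "0 \<le> norm f" by (simp add: norm_ell2_def ell2_inner_self infsum_nonneg)
    ultimately show ?thesis by (rule power2_le_imp_le)
  qed
  have "Cauchy (\<lambda>m. coord (X m) x)" for x
  proof (rule metric_CauchyI)
    fix e :: real assume "e > 0"
    with X obtain N where N: "\<And>m n. m \<ge> N \<Longrightarrow> n \<ge> N \<Longrightarrow> dist (X m) (X n) < e"
      by (meson metric_CauchyD)
    show "\<exists>M. \<forall>m\<ge>M. \<forall>n\<ge>M. dist (coord (X m) x) (coord (X n) x) < e"
    proof (intro exI allI impI)
      fix m n assume "m \<ge> N" "n \<ge> N"
      then have "norm (X m - X n) < e" using N by (simp add: norm_dist)
      moreover have "norm (coord (X m) x - coord (X n) x) \<le> norm (X m - X n)"
        using coord_le[of "X m - X n" x] by (simp add: minus_ell2.rep_eq)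
      ultimately show "dist (coord (X m) x) (coord (X n) x) < e" by (simp add: dist_norm)
    qed
  qed
  then have "\<exists>l. \<forall>x. (\<lambda>m. coord (X m) x) \<longlonglongrightarrow> l x"
    unfolding Cauchy_convergent_iff convergent_def by (intro choice) blast
  then obtain l where l: "\<And>x. (\<lambda>m. coord (X m) x) \<longlonglongrightarrow> l x" by blast
  have key: "\<exists>N. \<forall>m\<ge>N. \<forall>A. finite A \<longrightarrow> (\<Sum>x\<in>A. (norm (coord (X m) x - l x))\<^sup>2) \<le> e\<^sup>2"
    if e: "e > 0" for e :: real
  proof -
    obtain N where N: "\<And>m n. m \<ge> N \<Longrightarrow> n \<ge> N \<Longrightarrow> dist (X m) (X n) < e"
      using metric_CauchyD[OF X e] by blast
    have "(\<Sum>x\<in>A. (norm (coord (X m) x - l x))\<^sup>2) \<le> e\<^sup>2" if "m \<ge> N" "finite A" for m A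
    proof (rule LIMSEQ_le_const2)
      show "(\<lambda>n. \<Sum>x\<in>A. (norm (coord (X m) x - coord (X n) x))\<^sup>2)
          \<longlonglongrightarrow> (\<Sum>x\<in>A. (norm (coord (X m) x - l x))\<^sup>2)"
        by (intro tendsto_intros l)
      show "\<exists>N. \<forall>n\<ge>N. (\<Sum>x\<in>A. (norm (coord (X m) x - coord (X n) x))\<^sup>2) \<le> e\<^sup>2"
      proof (intro exI allI impI)
        fix n assume "n \<ge> N"
        have "(\<Sum>x\<in>A. (norm (coord (X m) x - coord (X n) x))\<^sup>2) \<le> (norm (X m - X n))\<^sup>2"
          using ell2_finite_sum_le[OF \<open>finite A\<close>, of "X m - X n"] by (simp add: minus_ell2.rep_eq)
        also have "\<dots> \<le> e\<^sup>2"
          using N[OF \<open>m \<ge> N\<close> \<open>n \<ge> N\<close>] by (intro power_mono)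
            (auto simp: norm_dist norm_ell2_def ell2_inner_self infsum_nonneg)
        finally show "(\<Sum>x\<in>A. (norm (coord (X m) x - coord (X n) x))\<^sup>2) \<le> e\<^sup>2" .
      qed
    qed
    then show ?thesis by blast
  qed
  have diff_sum: "(\<lambda>x. (norm (coord (X m) x - l x))\<^sup>2) summable_on UNIV"
    if "\<And>A. finite A \<Longrightarrow> (\<Sum>x\<in>A. (norm (coord (X m) x - l x))\<^sup>2) \<le> C" for m C
    using that by (intro nonneg_bdd_above_summable_on bdd_aboveI2[where M = C]) auto
  obtain N0 where "\<forall>m\<ge>N0. \<forall>A. finite A \<longrightarrow> (\<Sum>x\<in>A. (norm (coord (X m) x - l x))\<^sup>2) \<le> 1\<^sup>2"
    using key[OF zero_less_one] by (elim exE)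
  then have N0: "finite A \<Longrightarrow> (\<Sum>x\<in>A. (norm (coord (X N0) x - l x))\<^sup>2) \<le> 1\<^sup>2" for A
    by (metis order_refl)
  have "(\<lambda>x. (norm (- (coord (X N0) x - l x)))\<^sup>2) summable_on UNIV"
    unfolding norm_minus_cancel by (rule diff_sum[OF N0])
  from sq_summable_add[OF coord_sq_summable[of "X N0"] this]
  have "(\<lambda>x. (norm (l x))\<^sup>2) summable_on UNIV" by simp
  then have cl: "coord (ell2_of l) = l" by (simp add: ell2_of_inverse)
  have "X \<longlonglongrightarrow> ell2_of l"
  proof (rule metric_LIMSEQ_I)
    fix e :: real assume "e > 0"
    then obtain N where N: "\<And>m A. m \<ge> N \<Longrightarrow> finite A \<Longrightarrow>
        (\<Sum>x\<in>A. (norm (coord (X m) x - l x))\<^sup>2) \<le> (e / 2)\<^sup>2"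
      using key[OF half_gt_zero[OF \<open>e > 0\<close>]] by metis
    show "\<exists>N. \<forall>m\<ge>N. dist (X m) (ell2_of l) < e"
    proof (intro exI allI impI)
      fix m assume m: "m \<ge> N"
      have "(norm (X m - ell2_of l))\<^sup>2 = (\<Sum>\<^sub>\<infinity>x. (norm (coord (X m) x - l x))\<^sup>2)"
        by (simp add: ell2_norm_sq minus_ell2.rep_eq cl)
      also have "\<dots> \<le> (e / 2)\<^sup>2"
        by (rule infsum_le_finite_sums[OF diff_sum[OF N[OF m]]]) (assumption, rule N[OF m])
      finally have "norm (X m - ell2_of l) \<le> e / 2"
        by (rule power2_le_imp_le) (use \<open>e > 0\<close> in simp)
      then show "dist (X m) (ell2_of l) < e" using \<open>e > 0\<close> by (simp add: norm_dist)
    qed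
  qed
  then show "convergent X" by (auto simp: convergent_def)
qed

end


lemma coord_scaleC: "coord (a *\<^sub>C f) x = a *\<^sub>C coord f x"
  unfolding scaleC_ell2_def ell2_scaleC.rep_eq by (rule refl)

lemma cinner_ell2: "cinner f g = (\<Sum>\<^sub>\<infinity>x. cinner (coord f x) (coord g x))"
  unfolding cinner_ell2_def ell2_cinner_def by (rule refl)


section \<open>Operators between closed subspaces\<close>

text \<open>
  Every Hilbert space below is a closed complex subspace of some type of class
  \<^class>\<open>complex_hilbert\<close> (possibly the whole type).  An operator between two such subspaces is
  a function on the ambient types of which only the values on the domain are relevant.
\<close>

definition hilbert :: "'a::complex_hilbert set \<Rightarrow> bool" where
  "hilbert M \<longleftrightarrow> closed M \<and> 0 \<in> M \<and> (\<forall>x\<in>M. \<forall>y\<in>M. x + y \<in> M) \<and> (\<forall>a. \<forall>x\<in>M. a *\<^sub>C x \<in> M)"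

definition bounded_op ::
  "'a::complex_hilbert set \<Rightarrow> 'b::complex_hilbert set \<Rightarrow> ('a \<Rightarrow> 'b) \<Rightarrow> bool" where
  "bounded_op M N A \<longleftrightarrow> A ` M \<subseteq> N \<and>
     (\<forall>x\<in>M. \<forall>y\<in>M. A (x + y) = A x + A y) \<and> (\<forall>a. \<forall>x\<in>M. A (a *\<^sub>C x) = a *\<^sub>C A x) \<and>
     (\<exists>C. \<forall>x\<in>M. norm (A x) \<le> C * norm x)"

text \<open>The adjoint of an operator with domain \<open>M\<close>; it takes values in \<open>M\<close>.\<close>

definition adj :: "'a::complex_hilbert set \<Rightarrow> ('a \<Rightarrow> 'b::complex_hilbert) \<Rightarrow> 'b \<Rightarrow> 'a" where
  "adj M A y = (THE x. x \<in> M \<and> (\<forall>z\<in>M. cinner (A z) y = cinner z x))"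

definition pos_op :: "'a::complex_hilbert set \<Rightarrow> ('a \<Rightarrow> 'a) \<Rightarrow> bool" where
  "pos_op M A \<longleftrightarrow> (\<forall>x\<in>M. cinner (A x) x \<in> \<real>\<^sub>\<ge>\<^sub>0)"

text \<open>The positive square root of a positive operator, uniquely determined on \<open>M\<close>.\<close>

definition sqrt_op :: "'a::complex_hilbert set \<Rightarrow> ('a \<Rightarrow> 'a) \<Rightarrow> 'a \<Rightarrow> 'a" where
  "sqrt_op M A = (SOME B. bounded_op M M B \<and> pos_op M B \<and> (\<forall>x\<in>M. B (B x) = A x))"

definition unitary_op ::
  "'a::complex_hilbert set \<Rightarrow> 'b::complex_hilbert set \<Rightarrow> ('a \<Rightarrow> 'b) \<Rightarrow> bool" where
  "unitary_op M N W \<longleftrightarrow> bounded_op M N W \<and>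
     (\<forall>x\<in>M. adj M W (W x) = x) \<and> (\<forall>y\<in>N. W (adj M W y) = y)"

definition ortho_diff :: "'a::complex_hilbert set \<Rightarrow> 'a set \<Rightarrow> 'a set" where
  "ortho_diff M N = {x \<in> M. \<forall>y\<in>N. cinner x y = 0}"


section \<open>Tensor products with a square summable sequence space\<close>

text \<open>
  The Hilbert tensor product of $\ell^2(F)$ and \<open>E\<close> is realised as the space of square summable
  families \<open>F \<rightarrow> E\<close> (extended by zero outside of \<open>F\<close>), the elementary tensor of \<open>\<phi>\<close> and \<open>h\<close> being
  the family \<open>\<lambda>x. \<phi> x *\<^sub>C h\<close>.  The space $\ell^2(F)$ itself is \<open>ell2_tensor F (UNIV :: complex set)\<close>.
\<close>

definition ell2_tensor :: "'i set \<Rightarrow> 'a::complex_hilbert set \<Rightarrow> ('i, 'a) ell2 set" where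
  "ell2_tensor F E = {f. \<forall>x. coord f x \<in> (if x \<in> F then E else {0})}"

definition chi :: "'i \<Rightarrow> ('i, complex) ell2" where
  "chi x = ell2_of (\<lambda>y. if y = x then 1 else 0)"

definition tensor :: "('i, complex) ell2 \<Rightarrow> 'a::complex_hilbert \<Rightarrow> ('i, 'a) ell2" (infixr "\<otimes>" 70) where
  "\<phi> \<otimes> h = ell2_of (\<lambda>x. coord \<phi> x *\<^sub>C h)"

text \<open>
  The operator $A \otimes I$, for \<open>A\<close> an operator on $\ell^2(F)$, is given by the matrix of \<open>A\<close> with
  respect to the orthonormal basis \<open>chi\<close>.
\<close>

definition tensor_id ::
  "'i set \<Rightarrow> (('i, complex) ell2 \<Rightarrow> ('i, complex) ell2) \<Rightarrow> ('i, 'a::complex_hilbert) ell2 \<Rightarrow> ('i, 'a) ell2"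
  where "tensor_id F A f = ell2_of (\<lambda>y. \<Sum>\<^sub>\<infinity>x\<in>F. coord (A (chi x)) y *\<^sub>C coord f x)"

lemma coord_chi: "coord (chi x) y = (if y = x then 1 else 0)"
proof -
  have "(\<lambda>y. (norm (if y = x then 1 else 0 :: complex))\<^sup>2) summable_on {x}"
    by (rule summable_on_finite) blast
  also have "?this \<longleftrightarrow> (\<lambda>y. (norm (if y = x then 1 else 0 :: complex))\<^sup>2) summable_on UNIV"
    by (rule summable_on_cong_neutral) simp_all
  finally show ?thesis
    unfolding chi_def by (subst ell2_of_inverse) (simp_all only: mem_Collect_eq)
qed

lemma coord_tensor: "coord (\<phi> \<otimes> h) x = coord \<phi> x *\<^sub>C h"
proof -
  have "(\<lambda>x. (norm (coord \<phi> x *\<^sub>C h))\<^sup>2) summable_on UNIV"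
    unfolding norm_scaleC power_mult_distrib
    by (intro summable_on_cmult_left coord_sq_summable)
  then show ?thesis by (simp add: tensor_def ell2_of_inverse)
qed

lemma cinner_tensor: "cinner (\<phi> \<otimes> h) (\<psi> \<otimes> g) = cinner \<phi> \<psi> * cinner h g"
proof -
  have "cinner (\<phi> \<otimes> h) (\<psi> \<otimes> g) = (\<Sum>\<^sub>\<infinity>x. cinner (coord \<phi> x) (coord \<psi> x) * cinner h g)"
    by (simp add: cinner_ell2 coord_tensor cinner_scaleC_left cinner_scaleC_right cinner_complex_def
        mult_ac)
  then show ?thesis by (simp add: infsum_cmult_left' cinner_ell2)
qed

lemma tensor_id_chi:
  assumes "x \<in> F"
  shows "tensor_id F A (chi x \<otimes> h) = A (chi x) \<otimes> h"
proof -
  have "(\<Sum>\<^sub>\<infinity>z\<in>F. coord (A (chi z)) y *\<^sub>C coord (chi x \<otimes> h) z) = coord (A (chi x)) y *\<^sub>C h" for y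
  proof -
    have "(\<Sum>\<^sub>\<infinity>z\<in>F. coord (A (chi z)) y *\<^sub>C coord (chi x \<otimes> h) z) =
        (\<Sum>\<^sub>\<infinity>z\<in>{x}. coord (A (chi z)) y *\<^sub>C coord (chi x \<otimes> h) z)"
      by (rule infsum_cong_neutral)
        (use assms in \<open>auto simp: coord_tensor coord_chi scaleC_zero_left scaleC_zero_right\<close>)
    then show ?thesis by (simp add: coord_tensor coord_chi scaleC_one)
  qed
  then show ?thesis by (simp add: tensor_id_def tensor_def)
qed


section \<open>Words and the universal model\<close>

text \<open>
  A word in the generators $g^i_1, \dots, g^i_{n_i}$ is the list of its indices.  An element of
  $\mathbf F$ is a function assigning to \<open>i \<in> {1..k}\<close> its \<open>i\<close>-th component (and the empty word to all
  other \<open>i\<close>).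
\<close>

definition multiwords :: "nat \<Rightarrow> (nat \<Rightarrow> nat) \<Rightarrow> (nat \<Rightarrow> nat list) set" where
  "multiwords k n = 
     {\<beta>. (\<forall>i\<in>{1..k}. set (\<beta> i) \<subseteq> {1..n i}) \<and> (\<forall>i. i \<notin> {1..k} \<longrightarrow> \<beta> i = [])}"

type_synonym 'a fock = "(nat \<Rightarrow> nat list, 'a) ell2"

definition word_op :: "(nat \<Rightarrow> 'a \<Rightarrow> 'a) \<Rightarrow> nat list \<Rightarrow> 'a \<Rightarrow> 'a" where
  "word_op X \<alpha> = foldr (\<lambda>s A. X s \<circ> A) \<alpha> id"

definition lambda_word :: "(nat \<Rightarrow> nat \<Rightarrow> nat \<Rightarrow> nat \<Rightarrow> complex) \<Rightarrow> nat \<Rightarrow> nat \<Rightarrow> nat \<Rightarrow> nat list \<Rightarrow> complex" where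
  "lambda_word lam i j s \<beta> = prod_list (map (lam i j s) \<beta>)"

definition model_coeff ::
  "(nat \<Rightarrow> nat \<Rightarrow> nat \<Rightarrow> nat \<Rightarrow> complex) \<Rightarrow> nat \<Rightarrow> nat \<Rightarrow> (nat \<Rightarrow> nat list) \<Rightarrow> complex" where
  "model_coeff lam i s \<alpha> = (\<Prod>j\<in>{1..<i}. lambda_word lam i j s (\<alpha> j))"

text \<open>
  The coordinate form of the universal model; its defining action on the orthonormal basis is the
  lemma \<open>model_chi\<close> below.
\<close>

definition model ::
  "nat \<Rightarrow> (nat \<Rightarrow> nat) \<Rightarrow> (nat \<Rightarrow> nat \<Rightarrow> nat \<Rightarrow> nat \<Rightarrow> complex) \<Rightarrow> nat \<Rightarrow> nat \<Rightarrow> complex fock \<Rightarrow> complex fock" where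
  "model k n lam i s f = ell2_of (\<lambda>\<beta>. if \<beta> \<in> multiwords k n \<and> \<beta> i \<noteq> [] \<and> hd (\<beta> i) = s
     then model_coeff lam i s \<beta> * coord f (\<beta>(i := tl (\<beta> i))) else 0)"

lemma model_chi:
  assumes "\<alpha> \<in> multiwords k n" "i \<in> {1..k}" "s \<in> {1..n i}"
  shows "model k n lam i s (chi \<alpha>) = model_coeff lam i s \<alpha> *\<^sub>C chi (\<alpha>(i := s # \<alpha> i))"
proof -
  have *: "\<alpha>(i := s # \<alpha> i) \<in> multiwords k n"
    using assms unfolding multiwords_def by (simp del: One_nat_def)
  have c: "model_coeff lam i s (\<alpha>(i := w)) = model_coeff lam i s \<alpha>" for w
    unfolding model_coeff_def by (rule prod.cong) auto
  have iff: "\<beta> \<in> multiwords k n \<and> \<beta> i \<noteq> [] \<and> hd (\<beta> i) = s \<and> \<beta>(i := tl (\<beta> i)) = \<alpha> \<longleftrightarrow>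
      \<beta> = \<alpha>(i := s # \<alpha> i)" for \<beta>
  proof
    assume \<beta>: "\<beta> \<in> multiwords k n \<and> \<beta> i \<noteq> [] \<and> hd (\<beta> i) = s \<and> \<beta>(i := tl (\<beta> i)) = \<alpha>"
    show "\<beta> = \<alpha>(i := s # \<alpha> i)"
    proof
      fix j
      have "(\<beta>(i := tl (\<beta> i))) j = \<alpha> j" "tl (\<beta> i) = \<alpha> i"
        using \<beta> by (metis, metis fun_upd_same)
      then show "\<beta> j = (\<alpha>(i := s # \<alpha> i)) j"
        using \<beta> list.collapse[of "\<beta> i"] by (cases "j = i") simp_all
    qed
  next
    assume "\<beta> = \<alpha>(i := s # \<alpha> i)"
    with * show "\<beta> \<in> multiwords k n \<and> \<beta> i \<noteq> [] \<and> hd (\<beta> i) = s \<and> \<beta>(i := tl (\<beta> i)) = \<alpha>"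
      by simp
  qed
  have "(if \<beta> \<in> multiwords k n \<and> \<beta> i \<noteq> [] \<and> hd (\<beta> i) = s
      then model_coeff lam i s \<beta> * coord (chi \<alpha>) (\<beta>(i := tl (\<beta> i))) else 0) =
      coord (model_coeff lam i s \<alpha> *\<^sub>C chi (\<alpha>(i := s # \<alpha> i))) \<beta>" (is "?l = ?r") for \<beta>
  proof -
    have "?l = (if \<beta> \<in> multiwords k n \<and> \<beta> i \<noteq> [] \<and> hd (\<beta> i) = s \<and> \<beta>(i := tl (\<beta> i)) = \<alpha>
        then model_coeff lam i s \<beta> else 0)"
      unfolding coord_chi by (simp del: fun_upd_apply)
    also have "\<dots> = (if \<beta> = \<alpha>(i := s # \<alpha> i) then model_coeff lam i s \<beta> else 0)"
      unfolding iff by (rule refl)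
    also have "\<dots> = ?r"
      by (simp add: c coord_scaleC coord_chi scaleC_complex_def del: fun_upd_apply)
    finally show ?thesis .
  qed
  then show ?thesis unfolding model_def by (simp only: coord_inverse)
qed

text \<open>$S_{i,s}^* \otimes I$\<close>

definition model_adj_tensor_id ::
  "nat \<Rightarrow> (nat \<Rightarrow> nat) \<Rightarrow> (nat \<Rightarrow> nat \<Rightarrow> nat \<Rightarrow> nat \<Rightarrow> complex) \<Rightarrow> nat \<Rightarrow> nat \<Rightarrow> 'a::complex_hilbert fock \<Rightarrow> 'a fock"
  where "model_adj_tensor_id k n lam i s =
     tensor_id (multiwords k n) (adj (ell2_tensor (multiwords k n) UNIV) (model k n lam i s))"

definition multi_analytic ::
  "nat \<Rightarrow> (nat \<Rightarrow> nat) \<Rightarrow> (nat \<Rightarrow> nat \<Rightarrow> nat \<Rightarrow> nat \<Rightarrow> complex) \<Rightarrow> 'e::complex_hilbert set \<Rightarrow>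
   'a::complex_hilbert set \<Rightarrow> ('e fock \<Rightarrow> 'a fock) \<Rightarrow> bool" where
  "multi_analytic k n lam E K A \<longleftrightarrow>
     bounded_op (ell2_tensor (multiwords k n) E) (ell2_tensor (multiwords k n) K) A \<and>
     (\<forall>i\<in>{1..k}. \<forall>s\<in>{1..n i}. \<forall>f\<in>ell2_tensor (multiwords k n) E.
        A (tensor_id (multiwords k n) (model k n lam i s) f) =
        tensor_id (multiwords k n) (model k n lam i s) (A f))"


section \<open>Regular polyballs\<close>

text \<open>
  A \<open>k\<close>-tuple of rows of operators on \<open>H\<close> is a function \<open>T\<close> with \<open>T i s\<close> = $T_{i,s}$ for
  \<open>i \<in> {1..k}\<close>, \<open>s \<in> {1..n i}\<close>.
\<close>

definition cp_map ::
  "'a::complex_hilbert set \<Rightarrow> nat \<Rightarrow> (nat \<Rightarrow> 'a \<Rightarrow> 'a) \<Rightarrow> ('a \<Rightarrow> 'a) \<Rightarrow> 'a \<Rightarrow> 'a" where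
  "cp_map H m X A h = (\<Sum>s=1..m. X s (A (adj H (X s) h)))"

text \<open>
  $(\mathrm{id} - \Phi_{T_k}^{p_k}) \circ \cdots \circ (\mathrm{id} - \Phi_{T_1}^{p_1})(I)$; the
  function \<open>fold\<close> applies the map with index \<open>1\<close> first.
\<close>

definition defect_pow ::
  "nat \<Rightarrow> (nat \<Rightarrow> nat) \<Rightarrow> 'a::complex_hilbert set \<Rightarrow> (nat \<Rightarrow> nat \<Rightarrow> 'a \<Rightarrow> 'a) \<Rightarrow> (nat \<Rightarrow> nat) \<Rightarrow> 'a \<Rightarrow> 'a" where
  "defect_pow k n H T p =
     fold (\<lambda>i A h. A h - (cp_map H (n i) (T i) ^^ p i) A h) [1..<Suc k] (\<lambda>h. h)"

definition defect ::
  "nat \<Rightarrow> (nat \<Rightarrow> nat) \<Rightarrow> 'a::complex_hilbert set \<Rightarrow> (nat \<Rightarrow> nat \<Rightarrow> 'a \<Rightarrow> 'a) \<Rightarrow> 'a \<Rightarrow> 'a" where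
  "defect k n H T = fold (\<lambda>i A h. A h - cp_map H (n i) (T i) A h) [1..<Suc k] (\<lambda>h. h)"

definition polyball ::
  "nat \<Rightarrow> (nat \<Rightarrow> nat) \<Rightarrow> (nat \<Rightarrow> nat \<Rightarrow> nat \<Rightarrow> nat \<Rightarrow> complex) \<Rightarrow> 'a::complex_hilbert set \<Rightarrow>
   (nat \<Rightarrow> nat \<Rightarrow> 'a \<Rightarrow> 'a) set" where
  "polyball k n lam H = {T. hilbert H \<and>
     (\<forall>i\<in>{1..k}. \<forall>s\<in>{1..n i}. bounded_op H H (T i s)) \<and>
     (\<forall>i\<in>{1..k}. pos_op H (\<lambda>h. h - cp_map H (n i) (T i) (\<lambda>x. x) h)) \<and>
     (\<forall>i\<in>{1..k}. \<forall>j\<in>{1..k}. i \<noteq> j \<longrightarrow> (\<forall>s\<in>{1..n i}. \<forall>t\<in>{1..n j}. \<forall>h\<in>H.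
        T i s (T j t h) = lam i j s t *\<^sub>C T j t (T i s h))) \<and>
     (\<forall>r. 0 \<le> r \<and> r < 1 \<longrightarrow> pos_op H (defect k n H (\<lambda>i s h. r *\<^sub>R T i s h)))}"

definition completely_non_coisometric ::
  "nat \<Rightarrow> (nat \<Rightarrow> nat) \<Rightarrow> 'a::complex_hilbert set \<Rightarrow> (nat \<Rightarrow> nat \<Rightarrow> 'a \<Rightarrow> 'a) \<Rightarrow> bool" where
  "completely_non_coisometric k n H T \<longleftrightarrow>
     \<not> (\<exists>h\<in>H. h \<noteq> 0 \<and> (\<forall>p. cinner (defect_pow k n H T p h) h = 0))"

definition unitarily_equivalent ::
  "nat \<Rightarrow> (nat \<Rightarrow> nat) \<Rightarrow> 'a::complex_hilbert set \<Rightarrow> (nat \<Rightarrow> nat \<Rightarrow> 'a \<Rightarrow> 'a) \<Rightarrow>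
   'b::complex_hilbert set \<Rightarrow> (nat \<Rightarrow> nat \<Rightarrow> 'b \<Rightarrow> 'b) \<Rightarrow> bool" where
  "unitarily_equivalent k n H T H' T' \<longleftrightarrow> (\<exists>W. unitary_op H H' W \<and>
     (\<forall>i\<in>{1..k}. \<forall>s\<in>{1..n i}. \<forall>h\<in>H. T i s h = adj H W (T' i s (W h))))"


section \<open>Berezin kernels and characteristic functions\<close>

definition defect_space ::
  "nat \<Rightarrow> (nat \<Rightarrow> nat) \<Rightarrow> 'a::complex_hilbert set \<Rightarrow> (nat \<Rightarrow> nat \<Rightarrow> 'a \<Rightarrow> 'a) \<Rightarrow> 'a set" where
  "defect_space k n H T = closure (defect k n H T ` H)"

definition berezin ::
  "nat \<Rightarrow> (nat \<Rightarrow> nat) \<Rightarrow> 'a::complex_hilbert set \<Rightarrow> (nat \<Rightarrow> nat \<Rightarrow> 'a \<Rightarrow> 'a) \<Rightarrow> 'a \<Rightarrow> 'a fock" where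
  "berezin k n H T h = ell2_of (\<lambda>\<beta>. if \<beta> \<in> multiwords k n
     then sqrt_op H (defect k n H T) (fold (\<lambda>i. adj H (word_op (T i) (\<beta> i))) [1..<Suc k] h)
     else 0)"

text \<open>
  The space \<open>E\<close> ranges over the closed subspaces of the type \<open>'e\<close>.  As that type is a parameter, a
  theorem assuming this property for an arbitrary \<open>'e\<close> applies to every Hilbert space.
\<close>

definition admits_characteristic_function ::
  "'e::complex_hilbert itself \<Rightarrow> nat \<Rightarrow> (nat \<Rightarrow> nat) \<Rightarrow> (nat \<Rightarrow> nat \<Rightarrow> nat \<Rightarrow> nat \<Rightarrow> complex) \<Rightarrow>
   'a::complex_hilbert set \<Rightarrow> (nat \<Rightarrow> nat \<Rightarrow> 'a \<Rightarrow> 'a) \<Rightarrow> bool" where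
  "admits_characteristic_function _ k n lam H T \<longleftrightarrow>
     (\<exists>(E :: 'e set) \<Psi>. hilbert E \<and> multi_analytic k n lam E (defect_space k n H T) \<Psi> \<and>
        (\<forall>f\<in>ell2_tensor (multiwords k n) (defect_space k n H T).
           berezin k n H T (adj H (berezin k n H T) f) +
           \<Psi> (adj (ell2_tensor (multiwords k n) E) \<Psi> f) = f))"

text \<open>\<open>char_Y\<close> is $Y = I - K_T K_T^*$ and \<open>char_sqrt\<close> is $Y^{1/2}$.\<close>

definition char_Y ::
  "nat \<Rightarrow> (nat \<Rightarrow> nat) \<Rightarrow> 'a::complex_hilbert set \<Rightarrow> (nat \<Rightarrow> nat \<Rightarrow> 'a \<Rightarrow> 'a) \<Rightarrow> 'a fock \<Rightarrow> 'a fock" where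
  "char_Y k n H T f = f - berezin k n H T (adj H (berezin k n H T) f)"

definition char_sqrt ::
  "nat \<Rightarrow> (nat \<Rightarrow> nat) \<Rightarrow> 'a::complex_hilbert set \<Rightarrow> (nat \<Rightarrow> nat \<Rightarrow> 'a \<Rightarrow> 'a) \<Rightarrow> 'a fock \<Rightarrow> 'a fock" where
  "char_sqrt k n H T = sqrt_op (ell2_tensor (multiwords k n) (defect_space k n H T)) (char_Y k n H T)"

definition char_space ::
  "nat \<Rightarrow> (nat \<Rightarrow> nat) \<Rightarrow> 'a::complex_hilbert set \<Rightarrow> (nat \<Rightarrow> nat \<Rightarrow> 'a \<Rightarrow> 'a) \<Rightarrow> 'a fock set" where
  "char_space k n H T =
     closure (char_Y k n H T ` ell2_tensor (multiwords k n) (defect_space k n H T))"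

text \<open>
  The tuple $M_T$.  If \<open>T\<close> admits a characteristic function, then the operator \<open>A\<close> below exists and
  is uniquely determined on \<open>char_space k n H T\<close>.
\<close>

definition char_tuple ::
  "nat \<Rightarrow> (nat \<Rightarrow> nat) \<Rightarrow> (nat \<Rightarrow> nat \<Rightarrow> nat \<Rightarrow> nat \<Rightarrow> complex) \<Rightarrow> 'a::complex_hilbert set \<Rightarrow>
   (nat \<Rightarrow> nat \<Rightarrow> 'a \<Rightarrow> 'a) \<Rightarrow> nat \<Rightarrow> nat \<Rightarrow> 'a fock \<Rightarrow> 'a fock" where
  "char_tuple k n lam H T i s = adj (char_space k n H T)
     (SOME A. bounded_op (char_space k n H T) (char_space k n H T) A \<and>
        (\<forall>f\<in>ell2_tensor (multiwords k n) (defect_space k n H T).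
           A (char_sqrt k n H T f) = char_sqrt k n H T (model_adj_tensor_id k n lam i s f)))"

definition char_defect_space ::
  "nat \<Rightarrow> (nat \<Rightarrow> nat) \<Rightarrow> (nat \<Rightarrow> nat \<Rightarrow> nat \<Rightarrow> nat \<Rightarrow> complex) \<Rightarrow> 'a::complex_hilbert set \<Rightarrow>
   (nat \<Rightarrow> nat \<Rightarrow> 'a \<Rightarrow> 'a) \<Rightarrow> 'a fock set" where
  "char_defect_space k n lam H T =
     defect_space k n (char_space k n H T) (char_tuple k n lam H T)"

definition char_fun ::
  "nat \<Rightarrow> (nat \<Rightarrow> nat) \<Rightarrow> (nat \<Rightarrow> nat \<Rightarrow> nat \<Rightarrow> nat \<Rightarrow> complex) \<Rightarrow> 'a::complex_hilbert set \<Rightarrow>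
   (nat \<Rightarrow> nat \<Rightarrow> 'a \<Rightarrow> 'a) \<Rightarrow> 'a fock fock \<Rightarrow> 'a fock" where
  "char_fun k n lam H T \<phi> = char_sqrt k n H T
     (adj (char_space k n H T) (berezin k n (char_space k n H T) (char_tuple k n lam H T)) \<phi>)"


section \<open>The functional model\<close>

text \<open>$D_{\Theta_T} = (I - \Theta_T^* \Theta_T)^{1/2}$\<close>

definition char_fun_defect ::
  "nat \<Rightarrow> (nat \<Rightarrow> nat) \<Rightarrow> (nat \<Rightarrow> nat \<Rightarrow> nat \<Rightarrow> nat \<Rightarrow> complex) \<Rightarrow> 'a::complex_hilbert set \<Rightarrow>
   (nat \<Rightarrow> nat \<Rightarrow> 'a \<Rightarrow> 'a) \<Rightarrow> 'a fock fock \<Rightarrow> 'a fock fock" where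
  "char_fun_defect k n lam H T =
     (let L = ell2_tensor (multiwords k n) (char_defect_space k n lam H T);
          \<Theta> = char_fun k n lam H T
      in sqrt_op L (\<lambda>\<phi>. \<phi> - adj L \<Theta> (\<Theta> \<phi>)))"

text \<open>
  The Hilbert direct sum of two spaces is their set-theoretic product, with the inner product of the
  product type; the orthogonal projection onto the first summand is \<open>fst\<close>.
\<close>

definition model_K ::
  "nat \<Rightarrow> (nat \<Rightarrow> nat) \<Rightarrow> (nat \<Rightarrow> nat \<Rightarrow> nat \<Rightarrow> nat \<Rightarrow> complex) \<Rightarrow> 'a::complex_hilbert set \<Rightarrow>
   (nat \<Rightarrow> nat \<Rightarrow> 'a \<Rightarrow> 'a) \<Rightarrow> ('a fock \<times> 'a fock fock) set" where
  "model_K k n lam H T =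
     ell2_tensor (multiwords k n) (defect_space k n H T) \<times>
     closure (char_fun_defect k n lam H T `
       ell2_tensor (multiwords k n) (char_defect_space k n lam H T))"

definition model_H ::
  "nat \<Rightarrow> (nat \<Rightarrow> nat) \<Rightarrow> (nat \<Rightarrow> nat \<Rightarrow> nat \<Rightarrow> nat \<Rightarrow> complex) \<Rightarrow> 'a::complex_hilbert set \<Rightarrow>
   (nat \<Rightarrow> nat \<Rightarrow> 'a \<Rightarrow> 'a) \<Rightarrow> ('a fock \<times> 'a fock fock) set" where
  "model_H k n lam H T = ortho_diff (model_K k n lam H T)
     {(char_fun k n lam H T \<phi>, char_fun_defect k n lam H T \<phi>) | \<phi>.
        \<phi> \<in> ell2_tensor (multiwords k n) (char_defect_space k n lam H T)}"

text \<open>The relation defining the operator $\mathbb G_{i,s}$ on \<open>model_H\<close>.\<close>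

definition model_relation ::
  "nat \<Rightarrow> (nat \<Rightarrow> nat) \<Rightarrow> (nat \<Rightarrow> nat \<Rightarrow> nat \<Rightarrow> nat \<Rightarrow> complex) \<Rightarrow> 'a::complex_hilbert set \<Rightarrow>
   (nat \<Rightarrow> nat \<Rightarrow> 'a \<Rightarrow> 'a) \<Rightarrow> nat \<Rightarrow> nat \<Rightarrow>
   ('a fock \<times> 'a fock fock \<Rightarrow> 'a fock \<times> 'a fock fock) \<Rightarrow> bool" where
  "model_relation k n lam H T i s B \<longleftrightarrow>
     bounded_op (model_H k n lam H T) (model_H k n lam H T) B \<and>
     (\<forall>f\<in>model_H k n lam H T.
        fst (adj (model_H k n lam H T) B f) = model_adj_tensor_id k n lam i s (fst f))"

end

(*
  Write K for the Berezin kernel of T and Theta for the characteristic function.  The map sending h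
  to (K h, y) with D y = - Theta* K h should be the desired unitary; to construct it, compare the
  operators K* and x |-> P(x, 0) on l2(F) (x) D, where P is the projection onto H_T.  Since
  K K* + Theta Theta* = I, one finds P(x, 0) = (K K* x, - D Theta* x), and this vector has the same
  norm as K* x.  The range of K* is dense because T is completely non-coisometric, that of P(x, 0)
  because fst is injective on H_T, so K* x |-> P(x, 0) extends to a unitary W with fst (W h) = K h.
  The intertwining K T* = (S* (x) I) K then identifies W T W* with the model tuple.

  Two facts about positivity are needed.  Contractivity of K follows from evaluating the iterated
  defect of T as the sum of the quadratic forms <Delta T_w* h, T_w* h> over bounded multiwords w.
  The identity Theta Theta* = I - K K* amounts to K_M being isometric, which is read off from a
  factorisation I - K K* = Psi Psi* with Psi multi-analytic: the defect form of M_T at Y^(1/2) f is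
  the squared norm of the vacuum component of Psi* f.
*)

theory Submission
  imports Defs
begin

section \<open>Operators between Hilbert spaces\<close>

text \<open>The sums over multiwords need every partial defect of T, built from the first j rows, to
  be positive, while the polyball condition speaks only of all k rows. The bridge is strict scaling:
  if q is a bounded form with q - Phi(q) >= 0 and Phi shrinks squared norms by r^2 < 1, then q >=
  Phi^m(q) >= - c r^(2m), hence q >= 0. Rows are stripped off one at a time in this way, and then r
  tends to 1. Defects are handled as real quadratic forms in the adjoints. The commutation relations
  change vectors only by unimodular factors, which these forms ignore, so letters of different
  components may be reordered. For M_T the forms are read on the dense range of Y^(1/2), where Psi*
  turns them into statements about coordinates. The formula for P(x, 0) comes from (x, 0) - (K K* x,
  - D Theta* x) = (Theta Theta* x, D Theta* x), a vector of the subspace removed from K_T. Being a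
  projection, it satisfies |P(x, 0)|^2 = <P(x, 0), (x, 0)> = <K K* x, x> = |K* x|^2.\<close>

lemma scaleC_minus_one: "(- 1) *\<^sub>C x = - x"
  using scaleR_scaleC[of "- 1" x] by simp

lemma cinner_zero_left [simp]: "cinner 0 x = 0"
  using cinner_add_left[of 0 0 x] by simp

lemma cinner_zero_right [simp]: "cinner x 0 = 0"
  using cinner_add_right[of x 0 0] by simp

lemma cinner_minus_left: "cinner (- x) y = - cinner x y"
  using cinner_scaleC_left[of "- 1" x y] by (simp add: scaleC_minus_one)

lemma cinner_minus_right: "cinner x (- y) = - cinner x y"
  using cinner_scaleC_right[of x "- 1" y] by (simp add: scaleC_minus_one)

lemma cinner_diff_left: "cinner (x - y) z = cinner x z - cinner y z"
  using cinner_add_left[of x "- y" z] by (simp add: cinner_minus_left)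

lemma cinner_diff_right: "cinner x (y - z) = cinner x y - cinner x z"
  using cinner_add_right[of x y "- z"] by (simp add: cinner_minus_right)

lemma cinner_sum_left: "cinner (\<Sum>i\<in>I. f i) x = (\<Sum>i\<in>I. cinner (f i) x)"
  by (induction I rule: infinite_finite_induct) (auto simp: cinner_add_left)

lemma scaleC_minus_right: "a *\<^sub>C (- x) = - (a *\<^sub>C x)"
  by (metis scaleC_minus_one scaleC_scaleC mult.commute)

lemma scaleC_diff_right: "a *\<^sub>C (x - y) = a *\<^sub>C x - a *\<^sub>C y"
  using scaleC_add_right[of a x "- y"] by (simp add: scaleC_minus_right)

lemma hilbert_closed: "hilbert M \<Longrightarrow> closed M"
  and hilbert_zero: "hilbert M \<Longrightarrow> 0 \<in> M"
  and hilbert_add: "hilbert M \<Longrightarrow> x \<in> M \<Longrightarrow> y \<in> M \<Longrightarrow> x + y \<in> M"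
  and hilbert_scaleC: "hilbert M \<Longrightarrow> x \<in> M \<Longrightarrow> a *\<^sub>C x \<in> M"
  by (auto simp: hilbert_def)

lemma hilbert_scaleR: "hilbert M \<Longrightarrow> x \<in> M \<Longrightarrow> r *\<^sub>R x \<in> M"
  by (simp add: scaleR_scaleC hilbert_scaleC)

lemma hilbert_uminus: "hilbert M \<Longrightarrow> x \<in> M \<Longrightarrow> - x \<in> M"
  using hilbert_scaleC[of M x "- 1"] by (simp add: scaleC_minus_one)

lemma hilbert_diff: "hilbert M \<Longrightarrow> x \<in> M \<Longrightarrow> y \<in> M \<Longrightarrow> x - y \<in> M"
  using hilbert_add[of M x "- y"] hilbert_uminus[of M y] by simp

lemma hilbert_ext:
  assumes "hilbert M" "x \<in> M" "y \<in> M" "\<And>z. z \<in> M \<Longrightarrow> cinner z x = cinner z y"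
  shows "x = y"
proof -
  have "cinner (x - y) (x - y) = 0"
    using assms(4)[OF hilbert_diff[OF assms(1-3)]] by (simp add: cinner_diff_right)
  then show ?thesis by (simp add: cinner_self)
qed

lemma bounded_op_mem: "bounded_op M N A \<Longrightarrow> x \<in> M \<Longrightarrow> A x \<in> N"
  and bounded_op_add: "bounded_op M N A \<Longrightarrow> x \<in> M \<Longrightarrow> y \<in> M \<Longrightarrow> A (x + y) = A x + A y"
  and bounded_op_scaleC: "bounded_op M N A \<Longrightarrow> x \<in> M \<Longrightarrow> A (a *\<^sub>C x) = a *\<^sub>C A x"
  by (auto simp: bounded_op_def)

lemma bounded_op_scaleR: "bounded_op M N A \<Longrightarrow> x \<in> M \<Longrightarrow> A (r *\<^sub>R x) = r *\<^sub>R A x"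
  by (simp add: scaleR_scaleC bounded_op_scaleC)

lemma bounded_op_uminus: "bounded_op M N A \<Longrightarrow> x \<in> M \<Longrightarrow> A (- x) = - A x"
  by (metis scaleC_minus_one bounded_op_scaleC)

lemma bounded_op_diff:
  "hilbert M \<Longrightarrow> bounded_op M N A \<Longrightarrow> x \<in> M \<Longrightarrow> y \<in> M \<Longrightarrow> A (x - y) = A x - A y"
  using bounded_op_add[of M N A x "- y"] by (simp add: hilbert_uminus bounded_op_uminus)

lemma bounded_op_zero: "hilbert M \<Longrightarrow> bounded_op M N A \<Longrightarrow> A 0 = 0"
  using bounded_op_scaleC[of M N A 0 0]
    by (simp add: hilbert_zero scaleC_zero_left scaleC_zero_right)

lemma bounded_op_bound:
  assumes "bounded_op M N A"
  obtains C where "C > 0" "\<And>x. x \<in> M \<Longrightarrow> norm (A x) \<le> C * norm x"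
proof -
  obtain C where C: "\<And>x. x \<in> M \<Longrightarrow> norm (A x) \<le> C * norm x"
    using assms unfolding bounded_op_def by blast
  show ?thesis
  proof
    show "max C 1 > 0" by simp
    show "norm (A x) \<le> max C 1 * norm x" if "x \<in> M" for x
      using C[OF that] mult_right_mono[of C "max C 1" "norm x", OF _ norm_ge_zero] by linarith
  qed
qed

lemma bounded_opI:
  assumes "\<And>x. x \<in> M \<Longrightarrow> A x \<in> N"
    "\<And>x y. x \<in> M \<Longrightarrow> y \<in> M \<Longrightarrow> A (x + y) = A x + A y"
    "\<And>a x. x \<in> M \<Longrightarrow> A (a *\<^sub>C x) = a *\<^sub>C A x"
    "\<And>x. x \<in> M \<Longrightarrow> norm (A x) \<le> C * norm x"
  shows "bounded_op M N A"
  unfolding bounded_op_def using assms by blast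

lemma bounded_op_id: "bounded_op M M (\<lambda>x. x)"
  by (rule bounded_opI[where C = 1]) auto

lemma bounded_op_compose:
  assumes "bounded_op M N A" "bounded_op N L B"
  shows "bounded_op M L (\<lambda>x. B (A x))"
proof -
  obtain C where C: "C > 0" "\<And>x. x \<in> M \<Longrightarrow> norm (A x) \<le> C * norm x"
    using bounded_op_bound[OF assms(1)] by blast
  obtain D where D: "D > 0" "\<And>x. x \<in> N \<Longrightarrow> norm (B x) \<le> D * norm x"
    using bounded_op_bound[OF assms(2)] by blast
  show ?thesis
  proof (rule bounded_opI)
    fix x assume x: "x \<in> M"
    have "norm (B (A x)) \<le> D * norm (A x)" using D bounded_op_mem[OF assms(1) x] by blast
    also have "\<dots> \<le> D * (C * norm x)" using C D x by (intro mult_left_mono) auto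
    finally show "norm (B (A x)) \<le> (D * C) * norm x" by simp
  qed (use assms in \<open>auto simp: bounded_op_mem bounded_op_add bounded_op_scaleC\<close>)
qed

lemma bounded_op_plus:
  assumes "hilbert N" "bounded_op M N A" "bounded_op M N B"
  shows "bounded_op M N (\<lambda>x. A x + B x)"
proof -
  obtain C where C: "C > 0" "\<And>x. x \<in> M \<Longrightarrow> norm (A x) \<le> C * norm x"
    using bounded_op_bound[OF assms(2)] by blast
  obtain D where D: "D > 0" "\<And>x. x \<in> M \<Longrightarrow> norm (B x) \<le> D * norm x"
    using bounded_op_bound[OF assms(3)] by blast
  show ?thesis
  proof (rule bounded_opI)
    fix x assume x: "x \<in> M"
    show "norm (A x + B x) \<le> (C + D) * norm x"
      using C(2)[OF x] D(2)[OF x] norm_triangle_ineq[of "A x" "B x"] by (simp add: algebra_simps)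
  qed (use assms in \<open>auto simp: bounded_op_mem bounded_op_add bounded_op_scaleC hilbert_add
        scaleC_add_right\<close>)
qed

lemma bounded_op_scale:
  assumes "hilbert N" "bounded_op M N A"
  shows "bounded_op M N (\<lambda>x. a *\<^sub>C A x)"
proof -
  obtain C where C: "C > 0" "\<And>x. x \<in> M \<Longrightarrow> norm (A x) \<le> C * norm x"
    using bounded_op_bound[OF assms(2)] by blast
  show ?thesis
  proof (rule bounded_opI)
    fix x assume x: "x \<in> M"
    show "norm (a *\<^sub>C A x) \<le> (cmod a * C) * norm x"
      using mult_left_mono[OF C(2)[OF x], of "cmod a"] by (simp add: norm_scaleC mult.assoc)
  qed (use assms in \<open>auto simp: bounded_op_mem bounded_op_add bounded_op_scaleC hilbert_scaleC
        scaleC_add_right scaleC_scaleC mult.commute\<close>)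
qed

lemma bounded_op_minus:
  assumes "hilbert N" "bounded_op M N A" "bounded_op M N B"
  shows "bounded_op M N (\<lambda>x. A x - B x)"
  using bounded_op_plus[OF assms(1,2) bounded_op_scale[OF assms(1,3), of "- 1"]]
  by (simp add: scaleC_minus_one)

lemma bounded_op_setsum:
  assumes "hilbert N" "\<And>i. i \<in> I \<Longrightarrow> bounded_op M N (A i)"
  shows "bounded_op M N (\<lambda>x. \<Sum>i\<in>I. A i x)"
  using assms(2)
proof (induction I rule: infinite_finite_induct)
  case (insert i I)
  then show ?case using bounded_op_plus[OF assms(1), of M "A i"] by simp
qed (auto intro!: bounded_opI[where C = 0] simp: assms(1) hilbert_zero scaleC_zero_right)

lemma bounded_op_cong:
  "bounded_op M N A \<Longrightarrow> hilbert M \<Longrightarrow> (\<And>x. x \<in> M \<Longrightarrow> A x = B x) \<Longrightarrow> bounded_op M N B"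
  unfolding bounded_op_def by (auto simp: hilbert_add hilbert_scaleC)

section \<open>Riesz representation and adjoints\<close>

lemma quadratic_min_zero:
  fixes b c :: real
  assumes "\<And>t. 0 \<le> t\<^sup>2 * c + 2 * t * b" "c \<ge> 0"
  shows "b = 0"
proof (rule ccontr)
  assume b: "b \<noteq> 0"
  \<comment> \<open>The minimiser - b / c makes no sense for c = 0; enlarging the denominator still
    gives a negative value.\<close>
  have "0 \<le> (- b / (c + 1))\<^sup>2 * c + 2 * (- b / (c + 1)) * b" by (rule assms)
  also have "\<dots> = b\<^sup>2 * ((- c - 2) / (c + 1)\<^sup>2)"
    using assms(2) by (simp add: divide_simps) (simp add: power2_eq_square algebra_simps)
  finally have "0 \<le> b\<^sup>2 * ((- c - 2) / (c + 1)\<^sup>2)" .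
  moreover have "(- c - 2) / (c + 1)\<^sup>2 < 0" using assms(2) by (intro divide_neg_pos) auto
  ultimately show False using b mult_pos_neg[of "b\<^sup>2" "(- c - 2) / (c + 1)\<^sup>2"] by simp
qed

text \<open>The representing vector minimises $\|z\|^2 - 2 \mathrm{Re} f(z)$ over \<open>M\<close>.\<close>

lemma riesz_representation:
  assumes M: "hilbert M"
    and add: "\<And>x y. x \<in> M \<Longrightarrow> y \<in> M \<Longrightarrow> f (x + y) = f x + f y"
    and scale: "\<And>a x. x \<in> M \<Longrightarrow> f (a *\<^sub>C x) = a * f x"
    and bound: "\<And>x. x \<in> M \<Longrightarrow> cmod (f x) \<le> C * norm x"
  shows "\<exists>x\<in>M. \<forall>z\<in>M. f z = cinner z x"
proof -
  define J where "J z = (norm z)\<^sup>2 - 2 * Re (f z)" for z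
  have J_lb: "- C\<^sup>2 \<le> J z" if "z \<in> M" for z
  proof -
    have "Re (f z) \<le> C * norm z" using bound[OF that] complex_Re_le_cmod[of "f z"] by linarith
    moreover have "0 \<le> (norm z - C)\<^sup>2" by simp
    ultimately show ?thesis by (simp add: J_def power2_eq_square algebra_simps)
  qed
  define m where "m = Inf (J ` M)"
  have bdd: "bdd_below (J ` M)" using J_lb by (auto simp: bdd_below_def)
  have m: "m \<le> J z" if "z \<in> M" for z unfolding m_def using that bdd by (intro cInf_lower) auto
  have "\<exists>z\<in>M. J z < m + e" if "e > 0" for e
  proof -
    have "Inf (J ` M) < m + e" unfolding m_def using that by simp
    then show ?thesis using cInf_lessD[of "J ` M"] hilbert_zero[OF M] by blast
  qed
  then have "\<exists>z. z \<in> M \<and> J z < m + inverse (real (Suc j))" for j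
    by (metis inverse_positive_iff_positive of_nat_0_less_iff zero_less_Suc)
  then obtain X where X: "\<And>j. X j \<in> M" "\<And>j. J (X j) < m + inverse (real (Suc j))" by metis
  \<comment> \<open>Parallelogram law, with the infimum \<open>m\<close> as lower bound for
    \<open>J\<close> at the midpoint: near-minimisers are close to each other.\<close>
  have par: "(norm (x - y))\<^sup>2 \<le> 2 * (J x - m) + 2 * (J y - m)" if "x \<in> M" "y \<in> M" for x y
  proof -
    have z: "(1 / 2) *\<^sub>R (x + y) \<in> M" using that M by (intro hilbert_scaleR hilbert_add)
    have f: "f ((1 / 2) *\<^sub>R (x + y)) = of_real (1 / 2) * (f x + f y)"
      unfolding scaleR_scaleC using that by (simp add: scale add hilbert_add[OF M])
    have "Re (f ((1 / 2) *\<^sub>R (x + y))) = (Re (f x) + Re (f y)) / 2" unfolding f by simp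
    then have "J ((1 / 2) *\<^sub>R (x + y)) = (norm (x + y))\<^sup>2 / 4 - (Re (f x) + Re (f y))"
      by (simp add: J_def power_mult_distrib power2_eq_square)
    with m[OF z] have "m \<le> (norm (x + y))\<^sup>2 / 4 - (Re (f x) + Re (f y))" by simp
    moreover have "(norm (x + y))\<^sup>2 + (norm (x - y))\<^sup>2 = 2 * (norm x)\<^sup>2 + 2 * (norm y)\<^sup>2"
      by (simp add: power2_norm_eq_inner inner_add_left inner_add_right inner_diff_left
          inner_diff_right inner_commute)
    ultimately show ?thesis by (simp add: J_def)
  qed
  have "Cauchy X"
  proof (rule metric_CauchyI)
    fix e :: real assume e: "e > 0"
    obtain N where N: "inverse (real (Suc N)) < e\<^sup>2 / 4"
      using reals_Archimedean[of "e\<^sup>2 / 4"] e by auto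
    have J: "J (X j) - m < e\<^sup>2 / 4" if "j \<ge> N" for j
    proof -
      have "inverse (real (Suc j)) \<le> inverse (real (Suc N))" using that
        by (simp add: le_imp_inverse_le)
      then show ?thesis using X(2)[of j] N by linarith
    qed
    show "\<exists>N. \<forall>i\<ge>N. \<forall>j\<ge>N. dist (X i) (X j) < e"
    proof (intro exI allI impI)
      fix i j assume "i \<ge> N" "j \<ge> N"
      have "2 * (J (X i) - m) + 2 * (J (X j) - m) < e\<^sup>2"
        using J[OF \<open>i \<ge> N\<close>] J[OF \<open>j \<ge> N\<close>] by argo
      then have "(norm (X i - X j))\<^sup>2 < e\<^sup>2" by (rule le_less_trans[OF par[OF X(1) X(1)]])
      then show "dist (X i) (X j) < e" using e by (simp add: dist_norm power2_less_imp_less)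
    qed
  qed
  then obtain x where x: "X \<longlonglongrightarrow> x" using Cauchy_convergent_iff convergent_def by blast
  have xM: "x \<in> M" using hilbert_closed[OF M] X(1) x closed_sequentially by blast
  have fdiff: "f (u - v) = f u - f v" if "u \<in> M" "v \<in> M" for u v
    using add[of "u - v" v] that hilbert_diff[OF M that] by simp
  have fx: "(\<lambda>j. f (X j)) \<longlonglongrightarrow> f x"
  proof (rule Lim_null_comparison[THEN LIM_zero_cancel])
    show "\<forall>\<^sub>F j in sequentially. norm (f (X j) - f x) \<le> C * norm (X j - x)"
      using bound[OF hilbert_diff[OF M X(1) xM]] by (simp add: fdiff X(1) xM)
    have "(\<lambda>j. C * norm (X j - x)) \<longlonglongrightarrow> C * norm (x - x)" by (intro tendsto_intros x)
    then show "(\<lambda>j. C * norm (X j - x)) \<longlonglongrightarrow> 0" by simp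
  qed
  have Jx: "J x \<le> m"
  proof (rule LIMSEQ_le)
    show "(\<lambda>j. J (X j)) \<longlonglongrightarrow> J x" unfolding J_def by (intro tendsto_intros x fx)
    show "(\<lambda>j. m + inverse (real (Suc j))) \<longlonglongrightarrow> m"
      by (rule LIMSEQ_inverse_real_of_nat_add)
    show "\<exists>N. \<forall>j\<ge>N. J (X j) \<le> m + inverse (real (Suc j))" using X(2) less_imp_le by blast
  qed
  \<comment> \<open>First-order condition: moving the minimiser along real multiples of z cannot
    decrease \<open>J\<close>.\<close>
  have re: "Re (f z) = inner z x" if z: "z \<in> M" for z
  proof -
    have "inner z x - Re (f z) = 0"
    proof (rule quadratic_min_zero)
      fix t :: real
      have tz: "t *\<^sub>R z \<in> M" using z M by (intro hilbert_scaleR)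
      have "J x \<le> J (x + t *\<^sub>R z)" using m[OF hilbert_add[OF M xM tz]] Jx by linarith
      moreover have "f (x + t *\<^sub>R z) = f x + of_real t * f z"
        using add[OF xM tz] scale[OF z, of "of_real t"] by (simp add: scaleR_scaleC)
      moreover have "(norm (x + t *\<^sub>R z))\<^sup>2 = (norm x)\<^sup>2 + 2 * t * inner z x + t\<^sup>2 * (norm z)\<^sup>2"
        by (simp add: power2_norm_eq_inner inner_add_left inner_add_right inner_commute
            algebra_simps)
          (simp add: power2_eq_square)
      ultimately show "0 \<le> t\<^sup>2 * (norm z)\<^sup>2 + 2 * t * (inner z x - Re (f z))"
        by (simp add: J_def algebra_simps)
    qed simp
    then show ?thesis by simp
  qed
  have "f z = cinner z x" if z: "z \<in> M" for z
  proof (rule complex_eqI)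
    show "Re (f z) = Re (cinner z x)" using re[OF z] by (simp add: inner_Re_cinner)
    \<comment> \<open>The imaginary part at z is read off from the real part at i z.\<close>
    have "Re (f (\<i> *\<^sub>C z)) = inner (\<i> *\<^sub>C z) x" using re hilbert_scaleC[OF M z] by blast
    then show "Im (f z) = Im (cinner z x)"
      by (simp add: scale[OF z] inner_Re_cinner cinner_scaleC_left)
  qed
  then show ?thesis using xM by blast
qed

text \<open>The definite description in \<open>adj\<close> is justified by Riesz for z \<mapsto>
  \<open>cinner (A z) y\<close> and by \<open>hilbert_ext\<close>. The vector y ranges over the
  whole ambient type, so the adjoint is total.\<close>

lemma adj_char:
  assumes "hilbert M" "bounded_op M N A"
  shows "adj M A y \<in> M \<and> (\<forall>z\<in>M. cinner (A z) y = cinner z (adj M A y))"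
proof -
  obtain C where C: "\<And>x. x \<in> M \<Longrightarrow> norm (A x) \<le> C * norm x"
    using assms(2) unfolding bounded_op_def by blast
  have "\<exists>x\<in>M. \<forall>z\<in>M. cinner (A z) y = cinner z x"
  proof (rule riesz_representation[OF assms(1)])
    show "cmod (cinner (A x) y) \<le> (C * norm y) * norm x" if "x \<in> M" for x
      using norm_cinner_le[of "A x" y] mult_right_mono[OF C[OF that], of "norm y"]
      by (simp add: algebra_simps)
  qed (use assms(2) in \<open>auto simp: bounded_op_add bounded_op_scaleC cinner_add_left
        cinner_scaleC_left\<close>)
  then have "\<exists>!x. x \<in> M \<and> (\<forall>z\<in>M. cinner (A z) y = cinner z x)"
    using hilbert_ext[OF assms(1)] by metis
  then show ?thesis unfolding adj_def by (rule theI')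
qed

lemma adj_mem: "hilbert M \<Longrightarrow> bounded_op M N A \<Longrightarrow> adj M A y \<in> M"
  using adj_char by blast

lemma cinner_adj:
  "hilbert M \<Longrightarrow> bounded_op M N A \<Longrightarrow> z \<in> M \<Longrightarrow> cinner z (adj M A y) = cinner (A z) y"
  using adj_char by metis

lemma cinner_adj_left:
  "hilbert M \<Longrightarrow> bounded_op M N A \<Longrightarrow> z \<in> M \<Longrightarrow> cinner (adj M A y) z = cinner y (A z)"
  using cinner_adj cinner_commute by metis

lemma adj_eqI:
  assumes "hilbert M" "x \<in> M" "\<And>z. z \<in> M \<Longrightarrow> cinner (A z) y = cinner z x"
  shows "adj M A y = x"
  unfolding adj_def
  by (rule the_equality) (use assms hilbert_ext[OF assms(1)] in metis)+

lemma adj_add: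
  assumes "hilbert M" "bounded_op M N A"
  shows "adj M A (x + y) = adj M A x + adj M A y"
  by (rule adj_eqI)
    (use assms in \<open>auto intro!: hilbert_add adj_mem simp: cinner_add_right cinner_adj\<close>)

lemma adj_scaleC:
  assumes "hilbert M" "bounded_op M N A"
  shows "adj M A (a *\<^sub>C x) = a *\<^sub>C adj M A x"
  by (rule adj_eqI)
    (use assms in \<open>auto intro!: hilbert_scaleC adj_mem simp: cinner_scaleC_right cinner_adj\<close>)

lemma adj_norm_le:
  assumes "hilbert M" "bounded_op M N A" "C \<ge> 0" "\<And>x. x \<in> M \<Longrightarrow> norm (A x) \<le> C * norm x"
  shows "norm (adj M A y) \<le> C * norm y"
proof (cases "adj M A y = 0")
  case False
  let ?x = "adj M A y"
  have x: "?x \<in> M" using assms by (intro adj_mem)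
  have "norm ?x * norm ?x = cmod (cinner ?x ?x)"
    by (simp add: cinner_self power2_eq_square norm_mult)
  also have "\<dots> = cmod (cinner (A ?x) y)" using cinner_adj[OF assms(1,2) x] by simp
  also have "\<dots> \<le> norm (A ?x) * norm y" by (rule norm_cinner_le)
  also have "\<dots> \<le> C * norm ?x * norm y" using assms(4)[OF x] by (intro mult_right_mono) auto
  finally have "norm ?x * norm ?x \<le> norm ?x * (C * norm y)" by (simp add: algebra_simps)
  then show ?thesis using False by simp
qed (use assms in auto)

text \<open>\<open>N'\<close> is free because the adjoint is total and bounded on the ambient type;
  in particular it may be all of it.\<close>

lemma bounded_op_adj:
  assumes "hilbert M" "bounded_op M N A"
  shows "bounded_op N' M (adj M A)"
proof -
  obtain C where C: "C > 0" "\<And>x. x \<in> M \<Longrightarrow> norm (A x) \<le> C * norm x"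
    using bounded_op_bound[OF assms(2)] by blast
  show ?thesis
    by (rule bounded_opI[where C = C])
      (use assms C in \<open>auto simp: adj_mem[OF assms] adj_add[OF assms] adj_scaleC[OF assms]
        intro!: adj_norm_le\<close>)
qed

lemma adj_adj:
  assumes "hilbert M" "hilbert N" "bounded_op M N A" "x \<in> M"
  shows "adj N (adj M A) x = A x"
  by (rule adj_eqI) (use assms in \<open>auto simp: bounded_op_mem cinner_adj_left\<close>)

lemma adj_compose:
  assumes "hilbert M" "hilbert N" "bounded_op M N A" "bounded_op N L B"
  shows "adj M (\<lambda>x. B (A x)) y = adj M A (adj N B y)"
  by (rule adj_eqI)
    (use assms in \<open>auto simp: adj_mem cinner_adj bounded_op_mem\<close>)

section \<open>Closures, dense ranges and extension by continuity\<close>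

lemma tendsto_scaleC:
  assumes "X \<longlonglongrightarrow> x"
  shows "(\<lambda>n. a *\<^sub>C X n) \<longlonglongrightarrow> a *\<^sub>C x"
proof (rule Lim_null_comparison[THEN LIM_zero_cancel])
  show "\<forall>\<^sub>F n in sequentially. norm (a *\<^sub>C X n - a *\<^sub>C x) \<le> cmod a * norm (X n - x)"
    by (simp flip: scaleC_diff_right add: norm_scaleC)
  have "(\<lambda>n. cmod a * norm (X n - x)) \<longlonglongrightarrow> cmod a * norm (x - x)"
    by (intro tendsto_intros assms)
  then show "(\<lambda>n. cmod a * norm (X n - x)) \<longlonglongrightarrow> 0" by simp
qed

lemma hilbert_closure_range:
  assumes L: "hilbert L" and A: "bounded_op L M A"
  shows "hilbert (closure (A ` L))"
  unfolding hilbert_def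
proof (intro conjI ballI allI)
  show "0 \<in> closure (A ` L)"
    using subsetD[OF closure_subset imageI[OF hilbert_zero[OF L], of A]] bounded_op_zero[OF L A]
      by simp
  show "x + y \<in> closure (A ` L)" if x: "x \<in> closure (A ` L)" and y: "y \<in> closure (A ` L)" for x y
  proof -
    obtain X where "\<And>n. X n \<in> A ` L" "X \<longlonglongrightarrow> x"
      using x unfolding closure_sequential by metis
    moreover obtain Y where "\<And>n. Y n \<in> A ` L" "Y \<longlonglongrightarrow> y"
      using y unfolding closure_sequential by metis
    moreover have "u + v \<in> A ` L" if "u \<in> A ` L" "v \<in> A ` L" for u v
      using that bounded_op_add[OF A] hilbert_add[OF L] by (auto simp: image_iff) metis
    ultimately have "\<forall>n. X n + Y n \<in> A ` L" "(\<lambda>n. X n + Y n) \<longlonglongrightarrow> x + y"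
      by (blast, auto intro: tendsto_add)
    then show ?thesis unfolding closure_sequential by (intro exI[of _ "\<lambda>n. X n + Y n"] conjI)
  qed
  show "a *\<^sub>C x \<in> closure (A ` L)" if x: "x \<in> closure (A ` L)" for a x
  proof -
    obtain X where X: "\<And>n. X n \<in> A ` L" "X \<longlonglongrightarrow> x"
      using x unfolding closure_sequential by metis
    have "a *\<^sub>C u \<in> A ` L" if "u \<in> A ` L" for u
      using that bounded_op_scaleC[OF A] hilbert_scaleC[OF L] by (auto simp: image_iff) metis
    then have "\<forall>n. a *\<^sub>C X n \<in> A ` L" using X by blast
    moreover have "(\<lambda>n. a *\<^sub>C X n) \<longlonglongrightarrow> a *\<^sub>C x" by (rule tendsto_scaleC[OF X(2)])
    ultimately show ?thesis unfolding closure_sequential by (intro exI[of _ "\<lambda>n. a *\<^sub>C X n"] conjI)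
  qed
qed simp

lemma closed_orthogonal: "closed {z. cinner z y = 0}"
proof -
  have "{z. cinner z y = 0} = {z. inner z y = 0} \<inter> {z. inner z (\<i> *\<^sub>C y) = 0}"
    by (auto simp: complex_eq_iff inner_Re_cinner Im_cinner)
  then show ?thesis by (auto intro!: closed_Int closed_Collect_eq continuous_intros)
qed

lemma closure_orthogonal_zero:
  assumes "y \<in> closure S" "\<And>z. z \<in> S \<Longrightarrow> cinner z y = 0"
  shows "y = 0"
proof -
  have "closure S \<subseteq> {z. cinner z y = 0}"
    by (rule closure_minimal[OF _ closed_orthogonal]) (use assms(2) in auto)
  then have "cinner y y = 0" using assms(1) by blast
  then show ?thesis by (simp add: cinner_self)
qed

lemma tendsto_bounded_op:
  assumes M: "hilbert M" and A: "bounded_op M N A" and X: "\<And>m. X m \<in> M" "x \<in> M" "X \<longlonglongrightarrow> x"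
  shows "(\<lambda>m. A (X m)) \<longlonglongrightarrow> A x"
proof -
  obtain C where C: "\<And>x. x \<in> M \<Longrightarrow> norm (A x) \<le> C * norm x"
    using bounded_op_bound[OF A] by blast
  have le: "norm (A (X m) - A x) \<le> C * norm (X m - x)" for m
    using C[OF hilbert_diff[OF M X(1) X(2)]] by (simp add: bounded_op_diff[OF M A X(1) X(2)])
  have lim: "(\<lambda>m. C * norm (X m - x)) \<longlonglongrightarrow> 0"
    by (rule tendsto_mult_right_zero[OF tendsto_norm_zero[OF LIM_zero[OF X(3)]]])
  have "(\<lambda>m. A (X m) - A x) \<longlonglongrightarrow> 0"
    by (rule Lim_null_comparison[OF _ lim]) (simp add: le)
  then show ?thesis by (rule LIM_zero_cancel)
qed

lemma closure_range_sequence: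
  fixes x :: "'a::real_normed_vector"
  assumes "x \<in> closure (A ` L)"
  obtains X where "\<And>m. X m \<in> L" "(\<lambda>m. A (X m)) \<longlonglongrightarrow> x"
proof -
  obtain Y where Y: "\<And>j. Y j \<in> A ` L" "Y \<longlonglongrightarrow> x"
    using assms unfolding closure_sequential by metis
  have "\<forall>j. \<exists>x. x \<in> L \<and> Y j = A x" using Y(1) by blast
  then obtain X where X: "\<And>j. X j \<in> L" "\<And>j. Y j = A (X j)" by metis
  have "(\<lambda>j. A (X j)) \<longlonglongrightarrow> x" using Y(2) by (simp flip: X(2))
  with X(1) show ?thesis by (rule that)
qed

lemma bounded_op_eq_dense:
  assumes M: "hilbert M" and A: "bounded_op M N A" and B: "bounded_op M N' B"
    and dense: "closure (C ` L) = M" and eq: "\<And>x. x \<in> L \<Longrightarrow> A (C x) = B (C x)" and x: "x \<in> M"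
  shows "A x = B x"
proof -
  obtain X where X: "\<And>m. X m \<in> L" "(\<lambda>m. C (X m)) \<longlonglongrightarrow> x"
    using closure_range_sequence x dense by metis
  have CX: "C (X m) \<in> M" for m using subsetD[OF closure_subset imageI[OF X(1)], of C] dense by blast
  have "(\<lambda>m. A (C (X m))) \<longlonglongrightarrow> A x" "(\<lambda>m. B (C (X m))) \<longlonglongrightarrow> B x"
    by (rule tendsto_bounded_op[OF M A CX x X(2)], rule tendsto_bounded_op[OF M B CX x X(2)])
  then show ?thesis using LIMSEQ_unique eq[OF X(1)] by simp
qed

text \<open>Polarisation: the real part comes from the norm of a sum, the imaginary part from
  replacing y by i y.\<close>

lemma isometry_cinner:
  assumes M: "hilbert M" and A: "bounded_op M N A" and iso: "\<And>x. x \<in> M \<Longrightarrow> norm (A x) = norm x"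
    and xy: "x \<in> M" "y \<in> M"
  shows "cinner (A x) (A y) = cinner x y"
proof -
  have inner: "inner (A u) (A v) = inner u v" if "u \<in> M" "v \<in> M" for u v
  proof -
    have "(norm (A u + A v))\<^sup>2 = (norm (u + v))\<^sup>2"
      using iso[OF hilbert_add[OF M that]] by (simp add: bounded_op_add[OF A that])
    moreover have "(norm (A u))\<^sup>2 = (norm u)\<^sup>2" "(norm (A v))\<^sup>2 = (norm v)\<^sup>2"
      using iso that by simp_all
    ultimately show ?thesis
      by (simp add: power2_norm_eq_inner inner_add_left inner_add_right inner_commute)
  qed
  show ?thesis
  proof (rule complex_eqI)
    show "Re (cinner (A x) (A y)) = Re (cinner x y)" using inner[OF xy]
      by (simp add: inner_Re_cinner)
    show "Im (cinner (A x) (A y)) = Im (cinner x y)"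
      using inner[OF xy(1) hilbert_scaleC[OF M xy(2), of \<i>]]
        by (simp add: Im_cinner bounded_op_scaleC[OF A xy(2)])
  qed
qed

lemma dense_rangeI:
  assumes M: "hilbert M" and L: "hilbert L" and A: "bounded_op L M A"
    and orth: "\<And>x. x \<in> M \<Longrightarrow> (\<And>z. z \<in> L \<Longrightarrow> cinner (A z) x = 0) \<Longrightarrow> x = 0"
  shows "closure (A ` L) = M"
proof -
  have sub: "closure (A ` L) \<subseteq> M"
    using A hilbert_closed[OF M] by (intro closure_minimal) (auto simp: bounded_op_mem)
  have hc: "hilbert (closure (A ` L))" by (rule hilbert_closure_range[OF L A])
  have "x \<in> closure (A ` L)" if x: "x \<in> M" for x
  proof -
    \<comment> \<open>The adjoint of the inclusion of a closed subspace is the orthogonal projection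
      onto it.\<close>
    let ?p = "adj (closure (A ` L)) (\<lambda>x. x) x"
    have p: "?p \<in> closure (A ` L)" using adj_mem[OF hc bounded_op_id] .
    have "x - ?p = 0"
    proof (rule orth)
      show "x - ?p \<in> M" using x p sub M by (blast intro: hilbert_diff)
      show "cinner (A z) (x - ?p) = 0" if "z \<in> L" for z
      proof -
        have "A z \<in> closure (A ` L)" by (rule subsetD[OF closure_subset imageI[OF that]])
        then show ?thesis
          using cinner_adj[OF hc bounded_op_id, of "A z" x] by (simp add: cinner_diff_right)
      qed
    qed
    with p show ?thesis by simp
  qed
  with sub show ?thesis by blast
qed

lemma bounded_extension:
  assumes L: "hilbert L" and M: "hilbert M" and N: "hilbert N"
    and A: "bounded_op L M A" and B: "bounded_op L N B" and dense: "closure (A ` L) = M"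
    and le: "\<And>x. x \<in> L \<Longrightarrow> norm (B x) \<le> c * norm (A x)"
  shows "\<exists>W. bounded_op M N W \<and> (\<forall>x\<in>L. W (A x) = B x) \<and> (\<forall>m\<in>M. norm (W m) \<le> c * norm m)"
proof -
  \<comment> \<open>The image of m is specified by one inequality against all of L instead of by a
    chosen sequence. Taking m = A x yields the extension property, x = 0 the bound, and
    approximation of m the linearity.\<close>
  have ex: "\<exists>w\<in>N. \<forall>x\<in>L. norm (w - B x) \<le> c * norm (m - A x)" if "m \<in> M" for m
  proof -
    obtain X where X: "\<And>j. X j \<in> L" "(\<lambda>j. A (X j)) \<longlonglongrightarrow> m"
      using closure_range_sequence \<open>m \<in> M\<close> dense by metis
    have diff: "norm (B x - B y) \<le> \<bar>c\<bar> * norm (A x - A y)" if "x \<in> L" "y \<in> L" for x y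
    proof -
      have "norm (B (x - y)) \<le> c * norm (A (x - y))" using that L by (intro le hilbert_diff)
      also have "\<dots> \<le> \<bar>c\<bar> * norm (A (x - y))" by (rule mult_right_mono) auto
      finally show ?thesis using that by (simp add: bounded_op_diff[OF L A] bounded_op_diff[OF L B])
    qed
    have cauchy: "Cauchy (\<lambda>j. B (X j))"
    proof (rule metric_CauchyI)
      fix e :: real assume e: "e > 0"
      have "Cauchy (\<lambda>j. A (X j))" using X(2) LIMSEQ_imp_Cauchy by blast
      then obtain K where K: "\<And>i j. i \<ge> K \<Longrightarrow> j \<ge> K \<Longrightarrow> norm (A (X i) - A (X j)) < e / (\<bar>c\<bar> + 1)"
        using e metric_CauchyD[of "\<lambda>j. A (X j)" "e / (\<bar>c\<bar> + 1)"]
        by (auto simp: dist_norm)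
      have "norm (B (X i) - B (X j)) < e" if "i \<ge> K" "j \<ge> K" for i j
      proof -
        have "norm (B (X i) - B (X j)) \<le> \<bar>c\<bar> * norm (A (X i) - A (X j))" using diff X(1) by blast
        also have "\<dots> \<le> (\<bar>c\<bar> + 1) * norm (A (X i) - A (X j))" by (rule mult_right_mono) auto
        also have "\<dots> < e" using K[OF that] by (simp add: field_simps)
        finally show ?thesis .
      qed
      then show "\<exists>K. \<forall>i\<ge>K. \<forall>j\<ge>K. dist (B (X i)) (B (X j)) < e" by (auto simp: dist_norm)
    qed
    then obtain w where w: "(\<lambda>j. B (X j)) \<longlonglongrightarrow> w" using Cauchy_convergent_iff convergent_def by blast
    show ?thesis
    proof (intro bexI[of _ w] ballI)
      show "w \<in> N"
        using closed_sequentially[OF hilbert_closed[OF N] _ w] X(1) bounded_op_mem[OF B] by blast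
      fix x assume x: "x \<in> L"
      show "norm (w - B x) \<le> c * norm (m - A x)"
      proof (rule LIMSEQ_le)
        show "(\<lambda>j. norm (B (X j) - B x)) \<longlonglongrightarrow> norm (w - B x)" by (intro tendsto_intros w)
        show "(\<lambda>j. c * norm (A (X j) - A x)) \<longlonglongrightarrow> c * norm (m - A x)" by (intro tendsto_intros X)
        show "\<exists>K. \<forall>j\<ge>K. norm (B (X j) - B x) \<le> c * norm (A (X j) - A x)"
          using le[OF hilbert_diff[OF L X(1) x]]
          by (simp add: bounded_op_diff[OF L A] bounded_op_diff[OF L B] X(1) x)
      qed
    qed
  qed
  then obtain W where W: "\<And>m. m \<in> M \<Longrightarrow> W m \<in> N"
    "\<And>m x. m \<in> M \<Longrightarrow> x \<in> L \<Longrightarrow> norm (W m - B x) \<le> c * norm (m - A x)"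
    by metis
  have WA: "W (A x) = B x" if "x \<in> L" for x
    using W(2)[OF bounded_op_mem[OF A that] that] by simp
  have bd: "norm (W m) \<le> c * norm m" if "m \<in> M" for m
    using W(2)[OF that hilbert_zero[OF L]]
      by (simp add: bounded_op_zero[OF L A] bounded_op_zero[OF L B])
  have approx: "\<exists>x\<in>L. norm (m - A x) < e" if "m \<in> M" "e > 0" for m e
  proof -
    have "\<exists>y\<in>A ` L. dist y m < e" using that closure_approachable dense by blast
    then show ?thesis by (auto simp: dist_norm norm_minus_commute)
  qed
  \<comment> \<open>The sign of \<open>c\<close> is unrestricted, so estimates that enlarge the
    other factor pass to its absolute value.\<close>
  have c: "norm u \<le> \<bar>c\<bar> * norm v" if "norm u \<le> c * norm v" for u :: 'c and v :: 'b
    by (rule order_trans[OF that mult_right_mono[OF abs_ge_self norm_ge_zero]])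
  have zeroI: "u = 0" if "\<And>e. e > 0 \<Longrightarrow> norm u \<le> C * e" for u :: 'c and C :: real
  proof (rule ccontr)
    assume u: "u \<noteq> 0"
    have "norm u \<le> C * (norm u / (2 * (\<bar>C\<bar> + 1)))" using u by (intro that) auto
    also have "\<dots> \<le> (\<bar>C\<bar> + 1) * (norm u / (2 * (\<bar>C\<bar> + 1)))" by (rule mult_right_mono) auto
    also have "\<dots> = norm u / 2" by (simp add: field_simps)
    finally show False using u by simp
  qed
  have "bounded_op M N W"
  proof (rule bounded_opI[where C = c])
    fix m m' assume m: "m \<in> M" "m' \<in> M"
    have "W (m + m') - W m - W m' = 0"
    \<comment> \<open>The approximation errors of m + m', m and m' contribute 2, 1 and 1.\<close>
    proof (rule zeroI[where C = "4 * \<bar>c\<bar>"])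
      fix e :: real assume e: "e > 0"
      obtain x where x: "x \<in> L" "norm (m - A x) < e" using approx m e by blast
      obtain y where y: "y \<in> L" "norm (m' - A y) < e" using approx m e by blast
      have s: "norm ((m + m') - A (x + y)) \<le> 2 * e"
        using norm_triangle_ineq[of "m - A x" "m' - A y"] x y
        by (simp add: bounded_op_add[OF A] algebra_simps)
      have 1: "norm (W (m + m') - B (x + y)) \<le> \<bar>c\<bar> * (2 * e)"
        by (rule order_trans[OF c[OF W(2)]])
          (use s m M L x y in \<open>auto intro!: mult_left_mono hilbert_add\<close>)
      have 2: "norm (W m - B x) \<le> \<bar>c\<bar> * e"
        by (rule order_trans[OF c[OF W(2)]]) (use m x in \<open>auto intro!: mult_left_mono\<close>)
      have 3: "norm (W m' - B y) \<le> \<bar>c\<bar> * e"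
        by (rule order_trans[OF c[OF W(2)]]) (use m y in \<open>auto intro!: mult_left_mono\<close>)
      have "W (m + m') - W m - W m' = (W (m + m') - B (x + y)) - (W m - B x) - (W m' - B y)"
        using x y by (simp add: bounded_op_add[OF B])
      also have "norm \<dots> \<le> norm (W (m + m') - B (x + y)) + norm (W m - B x) + norm (W m' - B y)"
        using norm_triangle_ineq4[of "(W (m + m') - B (x + y)) - (W m - B x)" "W m' - B y"]
          norm_triangle_ineq4[of "W (m + m') - B (x + y)" "W m - B x"] by linarith
      finally show "norm (W (m + m') - W m - W m') \<le> 4 * \<bar>c\<bar> * e" using 1 2 3 by linarith
    qed
    then show "W (m + m') = W m + W m'" by (simp add: algebra_simps)
  next
    fix a m assume m: "m \<in> M"
    have "W (a *\<^sub>C m) - a *\<^sub>C W m = 0"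
    proof (rule zeroI[where C = "2 * \<bar>c\<bar> * cmod a"])
      fix e :: real assume e: "e > 0"
      obtain x where x: "x \<in> L" "norm (m - A x) < e" using approx m e by blast
      have s: "norm (a *\<^sub>C m - A (a *\<^sub>C x)) \<le> cmod a * e"
        using x by (simp add: bounded_op_scaleC[OF A] scaleC_diff_right[symmetric] norm_scaleC
            mult_left_mono)
      have 1: "norm (W (a *\<^sub>C m) - B (a *\<^sub>C x)) \<le> \<bar>c\<bar> * (cmod a * e)"
        by (rule order_trans[OF c[OF W(2)]])
          (use s m M L x in \<open>auto intro!: mult_left_mono hilbert_scaleC\<close>)
      have 2: "norm (W m - B x) \<le> \<bar>c\<bar> * e"
        by (rule order_trans[OF c[OF W(2)]]) (use m x in \<open>auto intro!: mult_left_mono\<close>)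
      have 3: "norm (a *\<^sub>C (W m - B x)) \<le> cmod a * (\<bar>c\<bar> * e)"
        unfolding norm_scaleC using 2 by (rule mult_left_mono) simp
      have "W (a *\<^sub>C m) - a *\<^sub>C W m = (W (a *\<^sub>C m) - B (a *\<^sub>C x)) - a *\<^sub>C (W m - B x)"
        using x by (simp add: bounded_op_scaleC[OF B] scaleC_diff_right)
      also have "norm \<dots> \<le> norm (W (a *\<^sub>C m) - B (a *\<^sub>C x)) + norm (a *\<^sub>C (W m - B x))"
        by (rule norm_triangle_ineq4)
      finally show "norm (W (a *\<^sub>C m) - a *\<^sub>C W m) \<le> 2 * \<bar>c\<bar> * cmod a * e"
        using 1 3 by (simp add: algebra_simps)
    qed
    then show "W (a *\<^sub>C m) = a *\<^sub>C W m" by simp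
  qed (use W bd in auto)
  then show ?thesis using WA bd by blast
qed

text \<open>The correspondence A x \<mapsto> B x extends to a contraction in both directions. The
  two extensions invert each other on dense ranges, so both are isometric and each is the adjoint of
  the other.\<close>

lemma exists_unitary:
  assumes L: "hilbert L" and M: "hilbert M" and N: "hilbert N"
    and A: "bounded_op L M A" and B: "bounded_op L N B"
    and dense: "closure (A ` L) = M" "closure (B ` L) = N"
    and norm: "\<And>x. x \<in> L \<Longrightarrow> norm (A x) = norm (B x)"
  shows "\<exists>W. unitary_op M N W \<and> (\<forall>x\<in>L. W (A x) = B x)"
proof -
  obtain W where W: "bounded_op M N W" "\<And>x. x \<in> L \<Longrightarrow> W (A x) = B x"
    "\<And>m. m \<in> M \<Longrightarrow> norm (W m) \<le> 1 * norm m"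
    using bounded_extension[OF L M N A B dense(1), of 1] norm by auto
  obtain V where V: "bounded_op N M V" "\<And>x. x \<in> L \<Longrightarrow> V (B x) = A x"
    "\<And>m. m \<in> N \<Longrightarrow> norm (V m) \<le> 1 * norm m"
    using bounded_extension[OF L N M B A dense(2), of 1] norm by auto
  have VW: "V (W x) = x" if "x \<in> M" for x
    by (rule bounded_op_eq_dense[OF M bounded_op_compose[OF W(1) V(1)] bounded_op_id dense(1) _
        that])
      (simp add: W V)
  have WV: "W (V x) = x" if "x \<in> N" for x
    by (rule bounded_op_eq_dense[OF N bounded_op_compose[OF V(1) W(1)] bounded_op_id dense(2) _
        that])
      (simp add: W V)
  have iso: "norm (W x) = norm x" if "x \<in> M" for x
    using W(3)[OF that] V(3)[OF bounded_op_mem[OF W(1) that]] by (simp add: VW[OF that])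
  have adj: "adj M W y = V y" if y: "y \<in> N" for y
  proof (rule adj_eqI[OF M bounded_op_mem[OF V(1) y]])
    fix z assume z: "z \<in> M"
    show "cinner (W z) y = cinner z (V y)"
      using isometry_cinner[OF M W(1) iso z bounded_op_mem[OF V(1) y]] by (simp add: WV[OF y])
  qed
  have "unitary_op M N W"
    using W(1) by (simp add: unitary_op_def adj VW WV bounded_op_mem)
  then show ?thesis using W(2) by blast
qed

section \<open>Positive operators and their square roots\<close>

lemma pos_opD:
  assumes "pos_op M A" "x \<in> M"
  shows "cinner (A x) x = of_real (Re (cinner (A x) x))" "0 \<le> Re (cinner (A x) x)"
  using assms by (auto simp: pos_op_def complex_nonneg_Reals_iff complex_eq_iff)

lemma pos_opI: "(\<And>x. x \<in> M \<Longrightarrow> \<exists>r\<ge>0. cinner (A x) x = of_real r) \<Longrightarrow> pos_op M A"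
  unfolding pos_op_def by (metis nonneg_Reals_of_real_iff)

text \<open>Expanding the form at x + y relates the imaginary parts of the mixed terms, and at i x +
  y the real parts.\<close>

lemma symmetric_if_real_form:
  assumes M: "hilbert M" and A: "bounded_op M M A"
    and real: "\<And>x. x \<in> M \<Longrightarrow> Im (cinner (A x) x) = 0" and xy: "x \<in> M" "y \<in> M"
  shows "cinner (A x) y = cinner x (A y)"
proof -
  have im: "Im (cinner (A u) v) + Im (cinner (A v) u) = 0" if "u \<in> M" "v \<in> M" for u v
    using real[OF hilbert_add[OF M that]] real[OF that(1)] real[OF that(2)]
    by (simp add: bounded_op_add[OF A] that cinner_add_left cinner_add_right)
  have "Im (cinner (A x) y) + Im (cinner (A y) x) = 0" by (rule im[OF xy])
  moreover have "Re (cinner (A x) y) = Re (cinner (A y) x)"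
    using im[OF hilbert_scaleC[OF M xy(1), of \<i>] xy(2)]
    by (simp add: bounded_op_scaleC[OF A] xy cinner_scaleC_left cinner_scaleC_right)
  moreover have "cinner x (A y) = cnj (cinner (A y) x)" by (rule cinner_commute)
  ultimately show ?thesis by (simp add: complex_eq_iff)
qed

lemma pos_op_symmetric:
  "hilbert M \<Longrightarrow> bounded_op M M A \<Longrightarrow> pos_op M A \<Longrightarrow> x \<in> M \<Longrightarrow> y \<in> M \<Longrightarrow>
    cinner (A x) y = cinner x (A y)"
  by (rule symmetric_if_real_form) (auto simp: pos_op_def complex_nonneg_Reals_iff)

text \<open>Evaluate the form at x - A x. Its mixed terms are - 2 |A x|^2, and the form at A x is at
  most |A x|^2, which leaves |A x|^2 \<le> |x|^2.\<close>

lemma contraction_if_form_le: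
  assumes M: "hilbert M" and A: "bounded_op M M A" and pos: "pos_op M A"
    and le: "\<And>x. x \<in> M \<Longrightarrow> Re (cinner (A x) x) \<le> (norm x)\<^sup>2" and x: "x \<in> M"
  shows "norm (A x) \<le> norm x"
proof -
  define y where "y = A x"
  have y: "y \<in> M" unfolding y_def by (rule bounded_op_mem[OF A x])
  define n where "n = (norm y)\<^sup>2"
  have ay: "cinner (A x) y = of_real n" "cinner (A y) x = of_real n"
    using pos_op_symmetric[OF M A pos y x] by (simp_all add: y_def n_def cinner_self)
  have "0 \<le> Re (cinner (A (x - y)) (x - y))" by (rule pos_opD(2)[OF pos hilbert_diff[OF M x y]])
  also have "\<dots> = Re (cinner (A x) x) - 2 * n + Re (cinner (A y) y)"
    by (simp add: bounded_op_diff[OF M A x y] cinner_diff_left cinner_diff_right ay)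
  also have "\<dots> \<le> (norm x)\<^sup>2 - 2 * n + n" using le[OF x] le[OF y] by (simp add: n_def)
  finally have "(norm y)\<^sup>2 \<le> (norm x)\<^sup>2" by (simp add: n_def)
  then show ?thesis unfolding y_def by (rule power2_le_imp_le) simp
qed


text \<open>
  The square root of \<open>I - C\<close> is \<open>I - Z\<close> with $Z = \lim Z_j$, $Z_{j+1} = (C + Z_j^2)/2$; the
  scalar sequence with \<open>C = 1\<close> dominates the increments.
\<close>

fun sqrt_approx :: "('a::complex_hilbert \<Rightarrow> 'a) \<Rightarrow> nat \<Rightarrow> 'a \<Rightarrow> 'a" where
  "sqrt_approx C 0 x = 0"
| "sqrt_approx C (Suc j) x = (1 / 2) *\<^sub>R (C x + sqrt_approx C j (sqrt_approx C j x))"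

fun sqrt_majorant :: "nat \<Rightarrow> real" where
  "sqrt_majorant 0 = 0"
| "sqrt_majorant (Suc j) = (1 + (sqrt_majorant j)\<^sup>2) / 2"

lemma sqrt_majorant_bounds: "0 \<le> sqrt_majorant j \<and> sqrt_majorant j \<le> 1"
  by (induction j) (auto intro: power_le_one add_nonneg_nonneg)

lemma sqrt_majorant_mono: "sqrt_majorant j \<le> sqrt_majorant (Suc j)"
  using sum_squares_ge_zero[of "sqrt_majorant j - 1" 0]
    by (simp add: power2_eq_square algebra_simps)

context
  fixes M :: "'a::complex_hilbert set" and C :: "'a \<Rightarrow> 'a"
  assumes M: "hilbert M" and C: "bounded_op M M C"
    and contr: "\<And>x. x \<in> M \<Longrightarrow> norm (C x) \<le> norm x"
begin

lemma bounded_op_sqrt_approx: "bounded_op M M (sqrt_approx C j)"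
proof (induction j)
  case 0
  show ?case by (rule bounded_opI[where C = 0]) (auto simp: hilbert_zero M scaleC_zero_right)
next
  case (Suc j)
  have "bounded_op M M (\<lambda>x. of_real (1 / 2) *\<^sub>C (C x + sqrt_approx C j (sqrt_approx C j x)))"
    by (intro bounded_op_scale bounded_op_plus M C bounded_op_compose[OF Suc Suc])
  then show ?case by (rule bounded_op_cong) (auto simp: M scaleR_scaleC)
qed

lemma sqrt_approx_mem: "x \<in> M \<Longrightarrow> sqrt_approx C j x \<in> M"
  by (rule bounded_op_mem[OF bounded_op_sqrt_approx])

lemma norm_sqrt_approx: "x \<in> M \<Longrightarrow> norm (sqrt_approx C j x) \<le> sqrt_majorant j * norm x"
proof (induction j arbitrary: x)
  case (Suc j)
  have "norm (sqrt_approx C j (sqrt_approx C j x)) \<le> sqrt_majorant j * (sqrt_majorant j * norm x)"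
    using Suc.IH[OF sqrt_approx_mem[OF Suc.prems, of j]] Suc.IH[OF Suc.prems]
        sqrt_majorant_bounds[of j]
    by (meson mult_left_mono order_trans)
  moreover have "norm (sqrt_approx C (Suc j) x) \<le>
      (norm (C x) + norm (sqrt_approx C j (sqrt_approx C j x))) / 2"
    by (simp add: norm_triangle_ineq)
  ultimately show ?case using contr[OF Suc.prems] by (simp add: power2_eq_square algebra_simps)
qed simp

lemma sqrt_approx_step:
  "x \<in> M \<Longrightarrow> norm (sqrt_approx C (Suc j) x - sqrt_approx C j x)
    \<le> (sqrt_majorant (Suc j) - sqrt_majorant j) * norm x"
proof (induction j arbitrary: x)
  case 0
  then show ?case using contr[OF 0] by simp
next
  case (Suc j)
  let ?Z = "sqrt_approx C" and ?z = sqrt_majorant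
  let ?d = "?z (Suc j) - ?z j"
  have mem: "?Z i y \<in> M" if "y \<in> M" for i y using that by (rule sqrt_approx_mem)
  have d: "?d \<ge> 0" using sqrt_majorant_mono[of j] by simp
  \<comment> \<open>For X = Z_(j+1) and Z = Z_j, the splitting X^2 - Z^2 = X (X - Z) + (X - Z) Z
    holds without commutativity. The scalar majorant satisfies the same identity, which is why the
    bounds match exactly.\<close>
  define u where "u = ?Z (Suc j) (?Z (Suc j) x - ?Z j x)"
  define v where "v = ?Z (Suc j) (?Z j x) - ?Z j (?Z j x)"
  have "?Z (Suc (Suc j)) x - ?Z (Suc j) x =
      (1 / 2) *\<^sub>R (C x + ?Z (Suc j) (?Z (Suc j) x)) - (1 / 2) *\<^sub>R (C x + ?Z j (?Z j x))"
    by (simp only: sqrt_approx.simps(2))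
  also have "\<dots> = (1 / 2) *\<^sub>R (u + v)"
    using mem[OF Suc.prems]
    by (simp add: u_def v_def bounded_op_diff[OF M bounded_op_sqrt_approx] scaleR_diff_right
        scaleR_add_right del: sqrt_approx.simps)
  finally have "norm (?Z (Suc (Suc j)) x - ?Z (Suc j) x) = norm (u + v) / 2" by simp
  also have "\<dots> \<le> (norm u + norm v) / 2" by (simp add: norm_triangle_ineq)
  also have "\<dots> \<le> (?z (Suc j) * (?d * norm x) + ?d * (?z j * norm x)) / 2"
    unfolding u_def v_def
  proof (intro divide_right_mono add_mono)
    show "norm (?Z (Suc j) (?Z (Suc j) x - ?Z j x)) \<le> ?z (Suc j) * (?d * norm x)"
      by (rule order_trans[OF norm_sqrt_approx[OF hilbert_diff[OF M mem mem]] mult_left_mono])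
        (use Suc sqrt_majorant_bounds in auto)
    show "norm (?Z (Suc j) (?Z j x) - ?Z j (?Z j x)) \<le> ?d * (?z j * norm x)"
      by (rule order_trans[OF Suc.IH[OF mem] mult_left_mono])
        (use Suc.prems d norm_sqrt_approx in auto)
  qed simp
  also have "\<dots> = (?z (Suc (Suc j)) - ?z (Suc j)) * norm x"
  proof -
    have 1: "?z (Suc (Suc j)) = (1 + (?z (Suc j))\<^sup>2) / 2" by simp
    have 2: "?z (Suc j) * (?z (Suc j) - ?z j) + (?z (Suc j) - ?z j) * ?z j =
        (?z (Suc j))\<^sup>2 - (?z j)\<^sup>2"
      by (simp add: power2_eq_square algebra_simps del: sqrt_majorant.simps)
    have 3: "(?z j)\<^sup>2 = 2 * ?z (Suc j) - 1" by (simp add: field_simps)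
    have a: "(?z (Suc j) * (?d * norm x) + ?d * (?z j * norm x)) / 2
        = (?z (Suc j) * ?d + ?d * ?z j) * norm x / 2" by (simp only: algebra_simps)
    have b: "?z (Suc (Suc j)) - ?z (Suc j) = ((?z (Suc j))\<^sup>2 - (?z j)\<^sup>2) / 2"
      using 1 3 by argo
    show ?thesis unfolding a b 2 by simp
  qed
  finally show ?case .
qed

lemma sqrt_approx_diff:
  assumes "x \<in> M" "i \<le> j"
  shows "norm (sqrt_approx C j x - sqrt_approx C i x) \<le>
      (sqrt_majorant j - sqrt_majorant i) * norm x"
  using assms(2)
proof (induction j rule: dec_induct)
  case (step j)
  have "norm (sqrt_approx C (Suc j) x - sqrt_approx C i x) \<le>
      norm (sqrt_approx C (Suc j) x - sqrt_approx C j x) + norm (sqrt_approx C j x - sqrt_approx C i x)"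
    using norm_triangle_ineq[of "sqrt_approx C (Suc j) x - sqrt_approx C j x"
        "sqrt_approx C j x - sqrt_approx C i x"] by (simp del: sqrt_approx.simps)
  then show ?case using step sqrt_approx_step[OF assms(1), of j] by (simp add: algebra_simps)
qed simp

text \<open>The limit solves 2 Z = C + Z^2, that is (I - Z)^2 = I - C. Convergence of the iterates
  is part of the conclusion because \<open>exists_sqrt\<close> transfers the reality of their forms
  to Z.\<close>

lemma exists_sqrt_complement:
  "\<exists>Z. bounded_op M M Z \<and> (\<forall>x\<in>M. norm (Z x) \<le> norm x) \<and> (\<forall>x\<in>M. Z x = (1 / 2) *\<^sub>R (C x + Z (Z x)))
     \<and> (\<forall>x\<in>M. (\<lambda>j. sqrt_approx C j x) \<longlonglongrightarrow> Z x)"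
proof -
  let ?Z = "sqrt_approx C" and ?z = sqrt_majorant
  have "incseq ?z" using sqrt_majorant_mono by (simp add: incseq_Suc_iff)
  then obtain l where l: "?z \<longlonglongrightarrow> l" "\<And>j. ?z j \<le> l"
    using incseq_convergent[of ?z 1] sqrt_majorant_bounds by blast
  \<comment> \<open>The telescoped increments are dominated by the tail of the convergent
    majorant.\<close>
  have bnd: "norm (?Z j x - ?Z i x) \<le> (l - ?z i) * norm x" if "x \<in> M" "i \<le> j" for x i j
    by (rule order_trans[OF sqrt_approx_diff[OF that] mult_right_mono]) (use l in auto)
  have rest: "(\<lambda>i. (l - ?z i) * c) \<longlonglongrightarrow> 0" for c :: real
    using tendsto_mult[OF tendsto_diff[OF tendsto_const[of l] l(1)] tendsto_const[of c]] by simp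
  have "\<exists>w. (\<lambda>j. ?Z j x) \<longlonglongrightarrow> w" if x: "x \<in> M" for x
  proof -
    have "Cauchy (\<lambda>j. ?Z j x)"
    proof (rule metric_CauchyI)
      fix e :: real assume "e > 0"
      then have "\<forall>\<^sub>F i in sequentially. (l - ?z i) * norm x < e / 2"
        using order_tendstoD(2)[OF rest, of "e / 2" "norm x"] by simp
      then obtain K where K: "(l - ?z K) * norm x < e / 2" by (auto simp: eventually_sequentially)
      have "norm (?Z i x - ?Z j x) < e" if "i \<ge> K" "j \<ge> K" for i j
        using bnd[OF x that(1)] bnd[OF x that(2)] K
          norm_triangle_ineq4[of "?Z i x - ?Z K x" "?Z j x - ?Z K x"] by simp
      then show "\<exists>K. \<forall>i\<ge>K. \<forall>j\<ge>K. dist (?Z i x) (?Z j x) < e" by (auto simp: dist_norm)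
    qed
    then show ?thesis using Cauchy_convergent_iff convergent_def by blast
  qed
  then obtain Z where Z: "\<And>x. x \<in> M \<Longrightarrow> (\<lambda>j. ?Z j x) \<longlonglongrightarrow> Z x" by metis
  have ZM: "Z x \<in> M" if "x \<in> M" for x
    using closed_sequentially[OF hilbert_closed[OF M] _ Z[OF that]] sqrt_approx_mem[OF that]
      by blast
  have Zn: "norm (Z x) \<le> norm x" if x: "x \<in> M" for x
  proof (rule LIMSEQ_le_const2[OF tendsto_norm[OF Z[OF x]]], intro exI allI impI)
    fix j
    show "norm (?Z j x) \<le> norm x"
      using norm_sqrt_approx[OF x, of j]
          mult_right_mono[OF conjunct2[OF sqrt_majorant_bounds[of j]], of "norm x"]
      by simp
  qed
  have "bounded_op M M Z"
  proof (rule bounded_opI[where C = 1])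
    fix x y assume xy: "x \<in> M" "y \<in> M"
    show "Z (x + y) = Z x + Z y"
    proof (rule LIMSEQ_unique)
      show "(\<lambda>j. ?Z j (x + y)) \<longlonglongrightarrow> Z (x + y)" by (rule Z[OF hilbert_add[OF M xy]])
      show "(\<lambda>j. ?Z j (x + y)) \<longlonglongrightarrow> Z x + Z y"
        using tendsto_add[OF Z[OF xy(1)] Z[OF xy(2)]]
        by (simp add: bounded_op_add[OF bounded_op_sqrt_approx xy])
    qed
  next
    fix a x assume x: "x \<in> M"
    show "Z (a *\<^sub>C x) = a *\<^sub>C Z x"
    proof (rule LIMSEQ_unique)
      show "(\<lambda>j. ?Z j (a *\<^sub>C x)) \<longlonglongrightarrow> Z (a *\<^sub>C x)" by (rule Z[OF hilbert_scaleC[OF M x]])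
      show "(\<lambda>j. ?Z j (a *\<^sub>C x)) \<longlonglongrightarrow> a *\<^sub>C Z x"
        unfolding bounded_op_scaleC[OF bounded_op_sqrt_approx x]
          by (rule tendsto_scaleC[OF Z[OF x]])
    qed
  qed (use ZM Zn in auto)
  moreover have "Z x = (1 / 2) *\<^sub>R (C x + Z (Z x))" if x: "x \<in> M" for x
  proof (rule LIMSEQ_unique)
    show "(\<lambda>j. ?Z (Suc j) x) \<longlonglongrightarrow> Z x" using Z[OF x] LIMSEQ_Suc by blast
    have "(\<lambda>j. ?Z j (?Z j x)) \<longlonglongrightarrow> Z (Z x)"
    proof (rule LIM_zero_cancel, rule Lim_null_comparison)
      have "norm (?Z j (?Z j x) - Z (Z x)) \<le>
          norm (?Z j x - Z x) + norm (?Z j (Z x) - Z (Z x))" for j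
      proof -
        \<comment> \<open>Contractivity of the iterates, uniform in j, absorbs the first term, so
          pointwise convergence suffices for the composition.\<close>
        have e: "?Z j (?Z j x) - Z (Z x) = ?Z j (?Z j x - Z x) + (?Z j (Z x) - Z (Z x))"
          using x by (simp add: bounded_op_diff[OF M bounded_op_sqrt_approx] sqrt_approx_mem ZM)
        have "norm (?Z j (?Z j x - Z x)) \<le> norm (?Z j x - Z x)"
          using norm_sqrt_approx[OF hilbert_diff[OF M sqrt_approx_mem[OF x] ZM[OF x]], of j j]
            mult_right_mono[OF conjunct2[OF sqrt_majorant_bounds[of j]], of "norm (?Z j x - Z x)"]
          by simp
        then show ?thesis unfolding e
          using norm_triangle_ineq[of "?Z j (?Z j x - Z x)" "?Z j (Z x) - Z (Z x)"] by linarith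
      qed
      then show "\<forall>\<^sub>F j in sequentially. norm (?Z j (?Z j x) - Z (Z x)) \<le>
          norm (?Z j x - Z x) + norm (?Z j (Z x) - Z (Z x))" by simp
      show "(\<lambda>j. norm (?Z j x - Z x) + norm (?Z j (Z x) - Z (Z x))) \<longlonglongrightarrow> 0"
        using tendsto_add[OF tendsto_norm_zero[OF LIM_zero[OF Z[OF x]]]
            tendsto_norm_zero[OF LIM_zero[OF Z[OF ZM[OF x]]]]] by simp
    qed
    then show "(\<lambda>j. ?Z (Suc j) x) \<longlonglongrightarrow> (1 / 2) *\<^sub>R (C x + Z (Z x))"
      by (auto intro!: tendsto_intros)
  qed
  ultimately show ?thesis using Z Zn by blast
qed

end


lemma exists_sqrt:
  assumes M: "hilbert M" and A: "bounded_op M M A" and pos: "pos_op M A"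
  shows "\<exists>B. bounded_op M M B \<and> pos_op M B \<and> (\<forall>x\<in>M. B (B x) = A x)"
proof -
  obtain c where c: "c > 0" "\<And>x. x \<in> M \<Longrightarrow> norm (A x) \<le> c * norm x"
    using bounded_op_bound[OF A] by blast
  \<comment> \<open>A / c lies between 0 and I, so C = I - A / c is a positive contraction. With its
    fixed point Z, the operator sqrt c (I - Z) squares to c (I - C) = A.\<close>
  define C where "C x = x - of_real (1 / c) *\<^sub>C A x" for x
  have C: "bounded_op M M C"
    unfolding C_def by (intro bounded_op_minus bounded_op_scale bounded_op_id A M)
  have form: "cinner (C x) x = of_real ((norm x)\<^sup>2 - Re (cinner (A x) x) / c)" if "x \<in> M" for x
    using pos_opD(1)[OF pos that]
    by (simp add: C_def cinner_diff_left cinner_scaleC_left cinner_self) 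
  have small: "Re (cinner (A x) x) / c \<le> (norm x)\<^sup>2" if "x \<in> M" for x
  proof -
    have "Re (cinner (A x) x) \<le> norm (A x) * norm x"
      using complex_Re_le_cmod norm_cinner_le order_trans by blast
    also have "\<dots> \<le> c * norm x * norm x" using c(2)[OF that] by (rule mult_right_mono) simp
    finally show ?thesis using c(1) by (simp add: divide_simps power2_eq_square mult_ac)
  qed
  have posC: "pos_op M C"
  proof (rule pos_opI)
    fix x assume "x \<in> M"
    then show "\<exists>r\<ge>0. cinner (C x) x = of_real r"
      using form small by (intro exI[of _ "(norm x)\<^sup>2 - Re (cinner (A x) x) / c"]) auto
  qed
  have contr: "norm (C x) \<le> norm x" if "x \<in> M" for x
  proof (rule contraction_if_form_le[OF M C posC _ that])
    fix x assume x: "x \<in> M"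
    show "Re (cinner (C x) x) \<le> (norm x)\<^sup>2"
      using pos_opD(2)[OF pos x] c(1) by (simp add: form[OF x])
  qed
  obtain Z where Z: "bounded_op M M Z" "\<And>x. x \<in> M \<Longrightarrow> norm (Z x) \<le> norm x"
    "\<And>x. x \<in> M \<Longrightarrow> Z x = (1 / 2) *\<^sub>R (C x + Z (Z x))"
    "\<And>x. x \<in> M \<Longrightarrow> (\<lambda>j. sqrt_approx C j x) \<longlonglongrightarrow> Z x"
    using exists_sqrt_complement[OF M C contr] by blast
  have symC: "cinner (C x) y = cinner x (C y)" if "x \<in> M" "y \<in> M" for x y
    using pos_op_symmetric[OF M C posC that] .
  have mem: "sqrt_approx C j x \<in> M" if "x \<in> M" for j x
    by (rule sqrt_approx_mem[OF M C contr that])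
  have sym: "cinner (sqrt_approx C j x) y = cinner x (sqrt_approx C j y)"
    if "x \<in> M" "y \<in> M" for j x y
    using that
    by (induction j arbitrary: x y)
      (simp_all add: scaleR_scaleC cinner_scaleC_left cinner_scaleC_right cinner_add_left
        cinner_add_right symC mem)
  \<comment> \<open>Each iterate is built from C by sums and self-composition, hence symmetric with
    a real form; reality passes to the limit.\<close>
  have realZ: "Im (cinner (Z x) x) = 0" if x: "x \<in> M" for x
  proof -
    have im: "Im (cinner (sqrt_approx C j x) x) = 0" for j
      using arg_cong[OF sym[OF x x, of j], of Im] cinner_commute[of x "sqrt_approx C j x"] by simp
    have "(\<lambda>j. inner (sqrt_approx C j x) (\<i> *\<^sub>C x)) \<longlonglongrightarrow> inner (Z x) (\<i> *\<^sub>C x)"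
      by (intro tendsto_intros Z x)
    then show ?thesis using im LIMSEQ_const_iff[of "0 :: real"] by (simp flip: Im_cinner)
  qed
  define B where "B x = of_real (sqrt c) *\<^sub>C (x - Z x)" for x
  have B: "bounded_op M M B"
    unfolding B_def by (intro bounded_op_minus bounded_op_scale bounded_op_id Z M)
  moreover have "pos_op M B"
  proof (rule pos_opI)
    fix x assume x: "x \<in> M"
    have "cinner (Z x) x = of_real (Re (cinner (Z x) x))" using realZ[OF x]
      by (simp add: complex_eq_iff)
    then have "cinner (B x) x = of_real (sqrt c * ((norm x)\<^sup>2 - Re (cinner (Z x) x)))"
      by (simp add: B_def cinner_scaleC_left cinner_diff_left cinner_self)
    moreover have "Re (cinner (Z x) x) \<le> (norm x)\<^sup>2"
    proof -
      have "Re (cinner (Z x) x) \<le> norm (Z x) * norm x"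
        using complex_Re_le_cmod norm_cinner_le order_trans by blast
      also have "\<dots> \<le> norm x * norm x" using Z(2)[OF x] by (rule mult_right_mono) simp
      finally show ?thesis by (simp add: power2_eq_square)
    qed
    ultimately show "\<exists>r\<ge>0. cinner (B x) x = of_real r" using c(1)
      by (metis diff_ge_0_iff_ge mult_nonneg_nonneg less_imp_le real_sqrt_ge_0_iff)
  qed
  moreover have "B (B x) = A x" if x: "x \<in> M" for x
  proof -
    let ?y = "x - Z x"
    have y: "?y \<in> M" using x by (intro hilbert_diff M bounded_op_mem[OF Z(1)])
    have "B (B x) = of_real (sqrt c * sqrt c) *\<^sub>C (?y - Z ?y)"
      unfolding B_def using bounded_op_scaleC[OF Z(1) y]
      by (simp only: of_real_mult scaleC_diff_right[symmetric] scaleC_scaleC)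
    also have "\<dots> = c *\<^sub>R (?y - Z ?y)" using c(1) by (simp add: scaleR_scaleC)
    also have "?y - Z ?y = x - 2 *\<^sub>R Z x + Z (Z x)"
      using bounded_op_diff[OF M Z(1) x bounded_op_mem[OF Z(1) x]] by (simp add: scaleR_2)
    also have "2 *\<^sub>R Z x = C x + Z (Z x)" by (subst Z(3)[OF x]) simp
    also have "c *\<^sub>R (x - (C x + Z (Z x)) + Z (Z x)) = A x"
      using c(1) by (simp add: C_def scaleR_scaleC scaleC_scaleC scaleC_one)
    finally show ?thesis .
  qed
  ultimately show ?thesis by blast
qed

text \<open>Later facts about square roots are all drawn from these three properties of the chosen
  root.\<close>

lemma sqrt_op:
  assumes "hilbert M" "bounded_op M M A" "pos_op M A"
  shows "bounded_op M M (sqrt_op M A)" "pos_op M (sqrt_op M A)"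
    "x \<in> M \<Longrightarrow> sqrt_op M A (sqrt_op M A x) = A x"
  using someI_ex[OF exists_sqrt[OF assms]] unfolding sqrt_op_def by auto

context
  fixes M :: "'a::complex_hilbert set" and A :: "'a \<Rightarrow> 'a"
  assumes M: "hilbert M" and A: "bounded_op M M A" and pos: "pos_op M A"
begin

lemma sqrt_op_mem: "x \<in> M \<Longrightarrow> sqrt_op M A x \<in> M"
  using sqrt_op(1)[OF M A pos] by (rule bounded_op_mem)

lemma sqrt_op_symmetric: "x \<in> M \<Longrightarrow> y \<in> M \<Longrightarrow> cinner (sqrt_op M A x) y = cinner x (sqrt_op M A y)"
  by (rule pos_op_symmetric[OF M sqrt_op(1,2)[OF M A pos]])

lemma cinner_sqrt_op: "x \<in> M \<Longrightarrow> y \<in> M \<Longrightarrow> cinner (sqrt_op M A x) (sqrt_op M A y) = cinner (A x) y"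
  using sqrt_op_symmetric[of "sqrt_op M A x" y] sqrt_op(3)[OF M A pos] by (simp add: sqrt_op_mem)

lemma norm_sqrt_op: "x \<in> M \<Longrightarrow> (norm (sqrt_op M A x))\<^sup>2 = Re (cinner (A x) x)"
  using arg_cong[OF cinner_sqrt_op[of x x], of Re] by (simp only: cinner_self Re_complex_of_real)

text \<open>Let B be the root. If y lies in the closure of the range of B and is orthogonal to the
  range of A, then |B y|^2 = <A y, y> = 0. By symmetry y is orthogonal to the range of B as well, so
  y = 0.\<close>

lemma closure_range_sqrt_op: "closure (sqrt_op M A ` M) = closure (A ` M)"
proof
  let ?B = "sqrt_op M A" and ?N = "closure (sqrt_op M A ` M)"
  have N: "hilbert ?N" by (rule hilbert_closure_range[OF M sqrt_op(1)[OF M A pos]])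
  have NM: "?N \<subseteq> M" using sqrt_op_mem by (intro closure_minimal hilbert_closed[OF M]) auto
  have sub: "A ` M \<subseteq> ?B ` M"
  proof
    fix y assume "y \<in> A ` M"
    then obtain x where "x \<in> M" "y = ?B (?B x)" using sqrt_op(3)[OF M A pos] by fastforce
    then show "y \<in> ?B ` M" using sqrt_op_mem by blast
  qed
  then show "closure (A ` M) \<subseteq> ?N" by (rule closure_mono)
  have "bounded_op M ?N A"
    using A sub closure_subset[of "?B ` M"] unfolding bounded_op_def by blast
  then have "closure (A ` M) = ?N"
  proof (rule dense_rangeI[OF N M])
    fix y assume y: "y \<in> ?N" and orth: "\<And>z. z \<in> M \<Longrightarrow> cinner (A z) y = 0"
    have yM: "y \<in> M" using y NM by blast
    have "cinner (?B y) (?B y) = 0" using cinner_sqrt_op[OF yM yM] orth[OF yM] by simp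
    then have By: "?B y = 0" by (simp add: cinner_self)
    show "y = 0" by (rule closure_orthogonal_zero[OF y]) (use sqrt_op_symmetric[OF _ yM] By in auto)
  qed
  then show "?N \<subseteq> closure (A ` M)" by simp
qed

end

section \<open>Shifts on the full Fock space\<close>

lemma ell2_eqI: "(\<And>x. coord f x = coord g x) \<Longrightarrow> f = g"
  using coord_inject by blast

lemma coord_add: "coord (f + g) x = coord f x + coord g x"
  by (rule plus_ell2.rep_eq[THEN fun_cong])

lemma coord_diff: "coord (f - g) x = coord f x - coord g x"
  by (rule minus_ell2.rep_eq[THEN fun_cong])

lemma coord_zero: "coord 0 x = 0"
  by (rule zero_ell2.rep_eq[THEN fun_cong])

lemma norm_coord_le: "norm (coord f x) \<le> norm f"
  by (rule power2_le_imp_le) (use ell2_finite_sum_le[of "{x}" f] in simp_all)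

lemma tendsto_coord: "X \<longlonglongrightarrow> f \<Longrightarrow> (\<lambda>m. coord (X m) x) \<longlonglongrightarrow> coord f x"
  by (rule LIM_zero_cancel, rule
      Lim_null_comparison[OF always_eventually tendsto_norm_zero[OF LIM_zero]])
    (auto simp flip: coord_diff simp: norm_coord_le)

text \<open>\<open>ell2_of\<close> is meaningful only on square summable families; a uniform bound
  on finite partial sums is the criterion applied to the families given by a formula below.\<close>

lemma coord_ell2_of_bounded:
  assumes "\<And>A. finite A \<Longrightarrow> (\<Sum>x\<in>A. (norm (f x))\<^sup>2) \<le> C\<^sup>2"
  shows "coord (ell2_of f) = f"
proof -
  have "(\<lambda>x. (norm (f x))\<^sup>2) summable_on UNIV"
    using assms by (intro nonneg_bdd_above_summable_on bdd_aboveI2[where M = "C\<^sup>2"]) auto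
  then show ?thesis by (simp add: ell2_of_inverse)
qed

lemma norm_ell2_le:
  assumes "C \<ge> 0" "\<And>A. finite A \<Longrightarrow> (\<Sum>x\<in>A. (norm (coord f x))\<^sup>2) \<le> C\<^sup>2"
  shows "norm f \<le> C"
proof -
  have "(norm f)\<^sup>2 \<le> C\<^sup>2"
    unfolding ell2_norm_sq by (rule infsum_le_finite_sums[OF coord_sq_summable assms(2)])
  then show ?thesis using assms(1) by (rule power2_le_imp_le)
qed

lemma hilbert_ell2_tensor:
  assumes "hilbert E"
  shows "hilbert (ell2_tensor F E)"
proof -
  have E: "hilbert (if x \<in> F then E else {0})" for x
    using assms by (auto simp: hilbert_def scaleC_zero_right)
  show ?thesis
    unfolding hilbert_def
  proof (intro conjI ballI allI)
    show "closed (ell2_tensor F E)"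
      unfolding closed_sequential_limits
    proof (intro allI impI, elim conjE)
      fix X f assume X: "\<forall>m. X m \<in> ell2_tensor F E" and lim: "X \<longlonglongrightarrow> f"
      have "coord f x \<in> (if x \<in> F then E else {0})" for x
        using closed_sequentially[OF hilbert_closed[OF E] _ tendsto_coord[OF lim]] X
        unfolding ell2_tensor_def by blast
      then show "f \<in> ell2_tensor F E" by (simp add: ell2_tensor_def)
    qed
  qed (use hilbert_zero[OF E] hilbert_add[OF E] hilbert_scaleC[OF E] in
      \<open>simp_all add: ell2_tensor_def coord_zero coord_add coord_scaleC\<close>)
qed

lemma ell2_tensor_coord: "f \<in> ell2_tensor F E \<Longrightarrow> x \<in> F \<Longrightarrow> coord f x \<in> E"
  unfolding ell2_tensor_def by (auto dest: spec[of _ x])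

lemma ell2_tensor_coord_zero: "f \<in> ell2_tensor F E \<Longrightarrow> x \<notin> F \<Longrightarrow> coord f x = 0"
  unfolding ell2_tensor_def by (auto dest: spec[of _ x])

text \<open>The model shifts and their adjoints are both of this kind, with unimodular weights and
  an injective index map. Coefficients lie in any Hilbert space, so the tensor factor I is built
  in.\<close>

definition weighted_comp ::
  "'i set \<Rightarrow> ('i \<Rightarrow> complex) \<Rightarrow> ('i \<Rightarrow> 'i) \<Rightarrow> ('i, 'a::complex_hilbert) ell2 \<Rightarrow> ('i, 'a) ell2" where
  "weighted_comp A c \<phi> f = ell2_of (\<lambda>x. if x \<in> A then c x *\<^sub>C coord f (\<phi> x) else 0)"

context
  fixes A :: "'i set" and c :: "'i \<Rightarrow> complex" and \<phi> :: "'i \<Rightarrow> 'i"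
  assumes inj: "inj_on \<phi> A" and c: "\<And>x. x \<in> A \<Longrightarrow> cmod (c x) = 1"
begin

lemma weighted_comp_sum_le:
  assumes "finite B"
  shows "(\<Sum>x\<in>B. (norm (if x \<in> A then c x *\<^sub>C coord f (\<phi> x) else 0))\<^sup>2) \<le> (norm f)\<^sup>2"
proof -
  have "(\<Sum>x\<in>B. (norm (if x \<in> A then c x *\<^sub>C coord f (\<phi> x) else 0))\<^sup>2) =
      (\<Sum>x\<in>B \<inter> A. (norm (coord f (\<phi> x)))\<^sup>2)"
    using assms by (intro sum.mono_neutral_cong_right) (auto simp: norm_scaleC c)
  also have "\<dots> = (\<Sum>y\<in>\<phi> ` (B \<inter> A). (norm (coord f y))\<^sup>2)"
    using inj by (subst sum.reindex) (auto simp: inj_on_def)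
  also have "\<dots> \<le> (norm f)\<^sup>2" using assms by (intro ell2_finite_sum_le) auto
  finally show ?thesis .
qed

lemma coord_weighted_comp:
  "coord (weighted_comp A c \<phi> f) x = (if x \<in> A then c x *\<^sub>C coord f (\<phi> x) else 0)"
  unfolding weighted_comp_def by (subst coord_ell2_of_bounded[OF weighted_comp_sum_le]) auto

lemma norm_weighted_comp: "norm (weighted_comp A c \<phi> f) \<le> norm f"
  by (rule norm_ell2_le) (use weighted_comp_sum_le[of _ f] in \<open>auto simp: coord_weighted_comp\<close>)

lemma bounded_op_weighted_comp:
  assumes "hilbert E" "A \<subseteq> F" "\<phi> ` A \<subseteq> F"
  shows "bounded_op (ell2_tensor F E) (ell2_tensor F E) (weighted_comp A c \<phi>)"
proof (rule bounded_opI[where C = 1])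
  fix f assume f: "f \<in> ell2_tensor F E"
  show "weighted_comp A c \<phi> f \<in> ell2_tensor F E"
    using assms ell2_tensor_coord[OF f] hilbert_scaleC[OF assms(1)] hilbert_zero[OF assms(1)]
    by (auto simp: ell2_tensor_def coord_weighted_comp)
qed (auto intro!: ell2_eqI simp: coord_weighted_comp coord_add coord_scaleC scaleC_add_right
    scaleC_scaleC scaleC_zero_right mult.commute norm_weighted_comp)

end

text \<open>The adjoint composes with the inverse index map and conjugates the weights; the inner
  product is reindexed along the bijection.\<close>

lemma cinner_weighted_comp:
  assumes \<phi>: "bij_betw \<phi> A B" and c: "\<And>x. x \<in> A \<Longrightarrow> cmod (c x) = 1"
    and \<psi>: "\<And>x. x \<in> A \<Longrightarrow> \<psi> (\<phi> x) = x" and d: "\<And>x. x \<in> A \<Longrightarrow> d (\<phi> x) = cnj (c x)"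
  shows "cinner (weighted_comp A c \<phi> f) g = cinner f (weighted_comp B d \<psi> g)"
proof -
  have inj: "inj_on \<phi> A" and B: "B = \<phi> ` A" using \<phi> by (auto simp: bij_betw_def)
  have inj': "inj_on \<psi> B" unfolding B by (rule inj_onI) (auto simp: \<psi>)
  have d1: "cmod (d y) = 1" if "y \<in> B" for y using that by (auto simp: B d c)
  have "cinner (weighted_comp A c \<phi> f) g = (\<Sum>\<^sub>\<infinity>x\<in>A. c x * cinner (coord f (\<phi> x)) (coord g x))"
    unfolding cinner_ell2
    by (rule infsum_cong_neutral)
      (auto simp: coord_weighted_comp[OF inj c] cinner_scaleC_left)
  also have "\<dots> = (\<Sum>\<^sub>\<infinity>x\<in>A. cinner (coord f (\<phi> x)) (d (\<phi> x) *\<^sub>C coord g (\<psi> (\<phi> x))))"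
    by (rule infsum_cong) (simp add: d \<psi> cinner_scaleC_right)
  also have "\<dots> = (\<Sum>\<^sub>\<infinity>y\<in>B. cinner (coord f y) (d y *\<^sub>C coord g (\<psi> y)))"
    by (rule infsum_reindex_bij_betw[OF \<phi>])
  also have "\<dots> = cinner f (weighted_comp B d \<psi> g)"
    unfolding cinner_ell2
    by (rule infsum_cong_neutral)
      (auto simp: coord_weighted_comp[OF inj' d1] cinner_scaleC_left)
  finally show ?thesis .
qed

section \<open>The universal model in coordinates\<close>

locale unimodular =
  fixes k :: nat and n :: "nat \<Rightarrow> nat" and lam :: "nat \<Rightarrow> nat \<Rightarrow> nat \<Rightarrow> nat \<Rightarrow> complex"
  assumes cmod_lam: "\<And>i j s t. i \<in> {1..k} \<Longrightarrow> j \<in> {1..k} \<Longrightarrow> i \<noteq> j \<Longrightarrow> s \<in> {1..n i} \<Longrightarrow>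
    t \<in> {1..n j} \<Longrightarrow> cmod (lam i j s t) = 1"
begin

abbreviation "F \<equiv> multiwords k n"

text \<open>\<open>shift\<close> and \<open>bshift\<close> stand for $S_{i,s} \<otimes> I$ and
  $S_{i,s}^* \<otimes> I$; \<open>tensor_id_model\<close> and \<open>model_adj_tensor_id\<close>
  identify them with the official operators.\<close>

definition shift :: "nat \<Rightarrow> nat \<Rightarrow> 'a::complex_hilbert fock \<Rightarrow> 'a fock" where
  "shift i s = weighted_comp {\<beta> \<in> F. \<beta> i \<noteq> [] \<and> hd (\<beta> i) = s}
     (model_coeff lam i s) (\<lambda>\<beta>. \<beta>(i := tl (\<beta> i)))"

definition bshift :: "nat \<Rightarrow> nat \<Rightarrow> 'a::complex_hilbert fock \<Rightarrow> 'a fock" where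
  "bshift i s = weighted_comp F (\<lambda>\<beta>. cnj (model_coeff lam i s \<beta>)) (\<lambda>\<beta>. \<beta>(i := s # \<beta> i))"

lemma multiwords_update: "\<beta> \<in> F \<Longrightarrow> i \<in> {1..k} \<Longrightarrow> set w \<subseteq> {1..n i} \<Longrightarrow> \<beta>(i := w) \<in> F"
  by (auto simp: multiwords_def)

lemma multiwords_letters: "\<beta> \<in> F \<Longrightarrow> i \<in> {1..k} \<Longrightarrow> set (\<beta> i) \<subseteq> {1..n i}"
  by (auto simp: multiwords_def)

text \<open>The coefficient sees only the components below i. Hence it may be evaluated before or
  after the shift, and the weights of \<open>shift\<close> and \<open>bshift\<close> are conjugate
  to each other.\<close>

lemma model_coeff_update: "model_coeff lam i s (\<beta>(i := w)) = model_coeff lam i s \<beta>"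
  unfolding model_coeff_def by (rule prod.cong) auto

lemma cmod_model_coeff:
  assumes "\<beta> \<in> F" "i \<in> {1..k}" "s \<in> {1..n i}"
  shows "cmod (model_coeff lam i s \<beta>) = 1"
proof -
  have "cmod (lambda_word lam i j s w) = 1" if "j \<in> {1..<i}" "set w \<subseteq> {1..n j}" for j w
    using that(2)
  proof (induction w)
    case (Cons t w)
    then show ?case using that(1) assms cmod_lam[of i j s t]
      by (auto simp: lambda_word_def norm_mult)
  qed (simp add: lambda_word_def)
  moreover have "set (\<beta> j) \<subseteq> {1..n j}" if "j \<in> {1..<i}" for j
    using that assms(2) by (intro multiwords_letters[OF assms(1)]) auto
  ultimately have "(\<Prod>j\<in>{1..<i}. cmod (lambda_word lam i j s (\<beta> j))) = 1"
    by (intro prod.neutral) blast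
  then show ?thesis by (simp add: model_coeff_def prod_norm)
qed

context
  fixes i s :: nat
  assumes i: "i \<in> {1..k}" and s: "s \<in> {1..n i}"
begin

lemma bij_betw_tail:
  "bij_betw (\<lambda>\<beta>. \<beta>(i := tl (\<beta> i))) {\<beta> \<in> F. \<beta> i \<noteq> [] \<and> hd (\<beta> i) = s} F"
proof (rule bij_betw_byWitness[where f' = "\<lambda>\<beta>. \<beta>(i := s # \<beta> i)"])
  show "(\<lambda>\<beta>. \<beta>(i := tl (\<beta> i))) ` {\<beta> \<in> F. \<beta> i \<noteq> [] \<and> hd (\<beta> i) = s} \<subseteq> F"
  proof clarify
    fix \<beta> assume "\<beta> \<in> F"
    moreover have "set (tl (\<beta> i)) \<subseteq> set (\<beta> i)" by (cases "\<beta> i") auto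
    ultimately show "\<beta>(i := tl (\<beta> i)) \<in> F"
      using multiwords_letters[of \<beta> i] i by (intro multiwords_update) auto
  qed
  show "(\<lambda>\<beta>. \<beta>(i := s # \<beta> i)) ` F \<subseteq> {\<beta> \<in> F. \<beta> i \<noteq> [] \<and> hd (\<beta> i) = s}"
  proof clarify
    fix \<beta> assume "\<beta> \<in> F"
    then have "\<beta>(i := s # \<beta> i) \<in> F"
      using multiwords_letters[of \<beta> i] i s by (intro multiwords_update) auto
    then show "\<beta>(i := s # \<beta> i) \<in> F \<and> (\<beta>(i := s # \<beta> i)) i \<noteq> [] \<and> hd ((\<beta>(i := s # \<beta> i)) i) = s"
      by simp
  qed
qed (auto simp: fun_eq_iff)

lemma cons_mem: "\<beta> \<in> F \<Longrightarrow> \<beta>(i := s # \<beta> i) \<in> F"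
  using multiwords_letters[of \<beta> i] i s by (intro multiwords_update) auto

lemma inj_on_cons: "inj_on (\<lambda>\<beta>. \<beta>(i := s # \<beta> i)) F"
proof (rule inj_onI)
  fix \<alpha> \<beta> :: "nat \<Rightarrow> nat list" assume e: "\<alpha>(i := s # \<alpha> i) = \<beta>(i := s # \<beta> i)"
  show "\<alpha> = \<beta>"
  proof
    fix j show "\<alpha> j = \<beta> j" using fun_cong[OF e, of j] by (cases "j = i") auto
  qed
qed

lemma coord_shift: "coord (shift i s f) \<beta> =
    (if \<beta> \<in> F \<and> \<beta> i \<noteq> [] \<and> hd (\<beta> i) = s then model_coeff lam i s \<beta> *\<^sub>C coord f (\<beta>(i := tl (\<beta> i))) else 0)"
  unfolding shift_def
  by (subst coord_weighted_comp)
    (use bij_betw_imp_inj_on[OF bij_betw_tail] cmod_model_coeff i s in auto)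

lemma coord_bshift: "coord (bshift i s f) \<beta> =
    (if \<beta> \<in> F then cnj (model_coeff lam i s \<beta>) *\<^sub>C coord f (\<beta>(i := s # \<beta> i)) else 0)"
  unfolding bshift_def
  by (subst coord_weighted_comp) (use inj_on_cons cmod_model_coeff i s in auto)

lemma bounded_op_shift: "hilbert E \<Longrightarrow> bounded_op (ell2_tensor F E) (ell2_tensor F E) (shift i s)"
  unfolding shift_def
  by (intro bounded_op_weighted_comp bij_betw_imp_inj_on[OF bij_betw_tail] cmod_model_coeff i s)
    (use bij_betw_imp_surj_on[OF bij_betw_tail] in auto)

lemma bounded_op_bshift: "hilbert E \<Longrightarrow> bounded_op (ell2_tensor F E) (ell2_tensor F E) (bshift i s)"
  unfolding bshift_def
  by (intro bounded_op_weighted_comp inj_on_cons) (use cmod_model_coeff i s cons_mem in auto)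

lemma cinner_shift: "cinner (shift i s f) g = cinner f (bshift i s g)"
  unfolding shift_def bshift_def
  by (rule cinner_weighted_comp[OF bij_betw_tail])
    (use cmod_model_coeff i s in \<open>auto simp: model_coeff_update\<close>)

lemma model_eq_shift: "model k n lam i s = shift i s"
proof
  fix f
  have "coord (shift i s f) = (\<lambda>\<beta>. if \<beta> \<in> F \<and> \<beta> i \<noteq> [] \<and> hd (\<beta> i) = s
     then model_coeff lam i s \<beta> * coord f (\<beta>(i := tl (\<beta> i))) else 0)"
    by (rule ext) (simp add: coord_shift scaleC_complex_def)
  then show "model k n lam i s f = shift i s f" using coord_inverse[of "shift i s f"]
    by (simp add: model_def)
qed

lemma adj_model: "adj (ell2_tensor F UNIV) (model k n lam i s) = bshift i s"
proof
  have C: "hilbert (UNIV :: complex set)" by (simp add: hilbert_def)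
  fix f :: "complex fock"
  have mem: "bshift i s f \<in> ell2_tensor F UNIV" by (simp add: ell2_tensor_def coord_bshift)
  show "adj (ell2_tensor F UNIV) (model k n lam i s) f = bshift i s f"
    by (rule adj_eqI[OF hilbert_ell2_tensor[OF C] mem]) (simp add: model_eq_shift cinner_shift)
qed

lemma tensor_id_model: "tensor_id F (model k n lam i s) f = shift i s f" if f: "f \<in> ell2_tensor F E"
proof -
  have "(\<Sum>\<^sub>\<infinity>x\<in>F. coord (model k n lam i s (chi x)) y *\<^sub>C coord f x) = coord (shift i s f) y" for y
  proof -
    \<comment> \<open>Row y of the matrix has at most one nonzero entry, in the column obtained by
      deleting the first letter.\<close>
    let ?y = "y(i := tl (y i))"
    have "(\<Sum>\<^sub>\<infinity>x\<in>F. coord (model k n lam i s (chi x)) y *\<^sub>C coord f x) =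
        (\<Sum>\<^sub>\<infinity>x\<in>{?y} \<inter> F. coord (model k n lam i s (chi x)) y *\<^sub>C coord f x)"
      by (rule infsum_cong_neutral)
        (auto simp: model_eq_shift coord_shift coord_chi scaleC_zero_left scaleC_complex_def split: if_splits)
    also have "\<dots> = coord (shift i s f) y"
      using ell2_tensor_coord_zero[OF f, of ?y]
      by (cases "?y \<in> F")
        (auto simp: model_eq_shift coord_shift coord_chi scaleC_zero_left scaleC_zero_right
          scaleC_complex_def)
    finally show ?thesis .
  qed
  then show ?thesis by (simp add: tensor_id_def coord_inverse)
qed

lemma model_adj_tensor_id: "model_adj_tensor_id k n lam i s f = bshift i s f"
proof -
  have "(\<Sum>\<^sub>\<infinity>x\<in>F. coord (bshift i s (chi x)) y *\<^sub>C coord f x) = coord (bshift i s f) y" for y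
  proof (cases "y \<in> F")
    case True
    \<comment> \<open>For the adjoint, the only contributing column is the one with s put in
      front.\<close>
    let ?y = "y(i := s # y i)"
    have "(\<Sum>\<^sub>\<infinity>x\<in>F. coord (bshift i s (chi x)) y *\<^sub>C coord f x) =
        (\<Sum>\<^sub>\<infinity>x\<in>{?y}. coord (bshift i s (chi x)) y *\<^sub>C coord f x)"
      by (rule infsum_cong_neutral)
        (use cons_mem[OF True] in \<open>auto simp: coord_bshift coord_chi scaleC_zero_left scaleC_complex_def\<close>)
    then show ?thesis by (simp add: coord_bshift coord_chi scaleC_complex_def True)
  qed (simp add: coord_bshift scaleC_zero_left)
  then show ?thesis by (simp add: model_adj_tensor_id_def tensor_id_def adj_model coord_inverse)
qed

end

end

section \<open>Defect forms\<close>

text \<open>If q is the quadratic form of Q and \<open>A s\<close> is the adjoint of the s-th row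
  entry, this is the form of Phi(Q), since <X Q X* h, h> = <Q X* h, X* h>.
  \<open>defect_form\<close> and \<open>defect_pow_form\<close> repeat the recursion of the operator
  defects on forms.\<close>

definition row_form :: "nat \<Rightarrow> (nat \<Rightarrow> 'a \<Rightarrow> 'a) \<Rightarrow> ('a \<Rightarrow> real) \<Rightarrow> 'a \<Rightarrow> real" where
  "row_form m A q h = (\<Sum>s=1..m. q (A s h))"

fun defect_form ::
  "(nat \<Rightarrow> nat) \<Rightarrow> (nat \<Rightarrow> nat \<Rightarrow> 'a \<Rightarrow> 'a) \<Rightarrow> nat \<Rightarrow> 'a::complex_hilbert \<Rightarrow> real" where
  "defect_form n A 0 h = (norm h)\<^sup>2"
| "defect_form n A (Suc j) h =
     defect_form n A j h - row_form (n (Suc j)) (A (Suc j)) (defect_form n A j) h"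

fun defect_pow_form ::
  "(nat \<Rightarrow> nat) \<Rightarrow> (nat \<Rightarrow> nat \<Rightarrow> 'a \<Rightarrow> 'a) \<Rightarrow> (nat \<Rightarrow> nat) \<Rightarrow> nat \<Rightarrow> 'a::complex_hilbert \<Rightarrow> real" where
  "defect_pow_form n A p 0 h = (norm h)\<^sup>2"
| "defect_pow_form n A p (Suc j) h = defect_pow_form n A p j h -
     (row_form (n (Suc j)) (A (Suc j)) ^^ p (Suc j)) (defect_pow_form n A p j) h"

text \<open>Passing from operators to real forms turns operator inequalities into pointwise real
  ones and makes unimodular factors disappear.\<close>

definition has_form :: "'a::complex_hilbert set \<Rightarrow> ('a \<Rightarrow> 'a) \<Rightarrow> ('a \<Rightarrow> real) \<Rightarrow> bool" where
  "has_form H Q q \<longleftrightarrow> bounded_op H H Q \<and> (\<forall>h\<in>H. cinner (Q h) h = of_real (q h))"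

lemma has_form_id: "has_form H (\<lambda>h. h) (\<lambda>h. (norm h)\<^sup>2)"
  by (simp add: has_form_def bounded_op_id cinner_self)

lemma has_form_diff: "hilbert H \<Longrightarrow> has_form H Q q \<Longrightarrow> has_form H R r \<Longrightarrow>
    has_form H (\<lambda>h. Q h - R h) (\<lambda>h. q h - r h)"
  by (simp add: has_form_def bounded_op_minus cinner_diff_left)

lemma has_form_cp_map:
  assumes H: "hilbert H" and X: "\<And>s. s \<in> {1..m} \<Longrightarrow> bounded_op H H (X s)" and Q: "has_form H Q q"
  shows "has_form H (cp_map H m X Q) (row_form m (\<lambda>s. adj H (X s)) q)"
proof -
  have bQ: "bounded_op H H Q" using Q by (simp add: has_form_def)
  have b: "bounded_op H H (\<lambda>h. X s (Q (adj H (X s) h)))" if "s \<in> {1..m}" for s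
    by (intro bounded_op_compose[OF bounded_op_compose[OF bounded_op_adj[OF H X[OF that]] bQ]
        X[OF that]])
  have "bounded_op H H (\<lambda>h. \<Sum>s=1..m. X s (Q (adj H (X s) h)))"
    by (rule bounded_op_setsum[OF H b])
  then have "bounded_op H H (cp_map H m X Q)" by (simp add: cp_map_def[abs_def])
  moreover have "cinner (cp_map H m X Q h) h = of_real (row_form m (\<lambda>s. adj H (X s)) q h)"
    if h: "h \<in> H" for h
  proof -
    have "cinner (X s (Q (adj H (X s) h))) h = of_real (q (adj H (X s) h))" if s: "s \<in> {1..m}" for s
      using cinner_adj[OF H X[OF s] bounded_op_mem[OF bQ adj_mem[OF H X[OF s], of h]], of h] Q
        adj_mem[OF H X[OF s], of h] by (simp add: has_form_def)
    then show ?thesis by (simp add: cp_map_def cinner_sum_left row_form_def)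
  qed
  ultimately show ?thesis by (simp add: has_form_def)
qed

lemma has_form_cp_map_pow:
  assumes H: "hilbert H" and X: "\<And>s. s \<in> {1..m} \<Longrightarrow> bounded_op H H (X s)" and Q: "has_form H Q q"
  shows "has_form H ((cp_map H m X ^^ p) Q) ((row_form m (\<lambda>s. adj H (X s)) ^^ p) q)"
  by (induction p) (use has_form_cp_map[OF H X] Q in auto)

lemma has_form_defect:
  assumes H: "hilbert H" and T: "\<And>i s. i \<in> {1..k} \<Longrightarrow> s \<in> {1..n i} \<Longrightarrow> bounded_op H H (T i s)"
  shows "has_form H (defect k n H T) (defect_form n (\<lambda>i s. adj H (T i s)) k)"
  using T
proof (induction k)
  case 0
  then show ?case by (simp add: defect_def has_form_id)
next
  case (Suc j)
  have "has_form H (defect j n H T) (defect_form n (\<lambda>i s. adj H (T i s)) j)"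
    using Suc.prems by (intro Suc.IH) auto
  from has_form_diff[OF H this has_form_cp_map[OF H Suc.prems this]]
  show ?case by (simp add: defect_def)
qed

lemma has_form_defect_pow:
  assumes H: "hilbert H" and T: "\<And>i s. i \<in> {1..k} \<Longrightarrow> s \<in> {1..n i} \<Longrightarrow> bounded_op H H (T i s)"
  shows "has_form H (defect_pow k n H T p) (defect_pow_form n (\<lambda>i s. adj H (T i s)) p k)"
  using T
proof (induction k)
  case 0
  then show ?case by (simp add: defect_pow_def has_form_id)
next
  case (Suc j)
  have "has_form H (defect_pow j n H T p) (defect_pow_form n (\<lambda>i s. adj H (T i s)) p j)"
    using Suc.prems by (intro Suc.IH) auto
  from has_form_diff[OF H this has_form_cp_map_pow[OF H Suc.prems this]]
  show ?case by (simp add: defect_pow_def)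
qed

lemma pos_op_iff_form: "has_form H Q q \<Longrightarrow> pos_op H Q \<longleftrightarrow> (\<forall>h\<in>H. 0 \<le> q h)"
  by (auto simp: has_form_def pos_op_def)

section \<open>Adjoints along multiwords and the Berezin kernel\<close>

definition word_fold :: "(nat \<Rightarrow> nat \<Rightarrow> 'a \<Rightarrow> 'a) \<Rightarrow> nat \<Rightarrow> (nat \<Rightarrow> nat list) \<Rightarrow> 'a \<Rightarrow> 'a" where
  "word_fold A j \<beta> h = fold (\<lambda>i. fold (A i) (\<beta> i)) [1..<Suc j] h"

lemma word_fold_0 [simp]: "word_fold A 0 \<beta> h = h"
  by (simp add: word_fold_def)

lemma word_fold_Suc [simp]: "word_fold A (Suc j) \<beta> h =
    fold (A (Suc j)) (\<beta> (Suc j)) (word_fold A j \<beta> h)"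
  by (simp add: word_fold_def)

lemma word_fold_cong: "(\<And>i. i \<in> {1..j} \<Longrightarrow> \<beta> i = \<gamma> i) \<Longrightarrow> word_fold A j \<beta> h = word_fold A j \<gamma> h"
  by (induction j) auto

lemma fold_invariant:
  assumes "\<And>s x. s \<in> set w \<Longrightarrow> x \<in> H \<Longrightarrow> A s x \<in> H" "h \<in> H"
  shows "fold A w h \<in> H"
  using assms by (induction w arbitrary: h) auto

text \<open>Only boundedness is assumed, so that the construction of the kernel serves both T and
  M_T.\<close>

locale op_tuple =
  fixes k :: nat and n :: "nat \<Rightarrow> nat" and H :: "'a::complex_hilbert set" and T :: "nat \<Rightarrow> nat \<Rightarrow> 'a \<Rightarrow> 'a"
  assumes H: "hilbert H" and T: "\<And>i s. i \<in> {1..k} \<Longrightarrow> s \<in> {1..n i} \<Longrightarrow> bounded_op H H (T i s)"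
begin

definition A :: "nat \<Rightarrow> nat \<Rightarrow> 'a \<Rightarrow> 'a" where "A i s = adj H (T i s)"

abbreviation "D \<equiv> defect_form n A"

lemma bounded_op_A: "i \<in> {1..k} \<Longrightarrow> s \<in> {1..n i} \<Longrightarrow> bounded_op H H (A i s)"
  unfolding A_def by (rule bounded_op_adj[OF H T])

lemma A_mem: "i \<in> {1..k} \<Longrightarrow> s \<in> {1..n i} \<Longrightarrow> A i s h \<in> H"
  unfolding A_def by (rule adj_mem[OF H T])

lemma has_form_D: "has_form H (defect k n H T) (D k)"
  unfolding A_def[abs_def] by (rule has_form_defect[OF H T])

lemma word_fold_mem:
  assumes "\<And>i. i \<in> {1..j} \<Longrightarrow> set (\<beta> i) \<subseteq> {1..n i}" "j \<le> k" "h \<in> H"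
  shows "word_fold A j \<beta> h \<in> H"
  using assms
proof (induction j)
  case (Suc j)
  have "word_fold A j \<beta> h \<in> H" using Suc.prems by (intro Suc.IH) auto
  moreover have "set (\<beta> (Suc j)) \<subseteq> {1..n (Suc j)}" using Suc.prems(1)[of "Suc j"] by simp
  then have "A (Suc j) s x \<in> H" if "s \<in> set (\<beta> (Suc j))" for s x
    using that Suc.prems(2) by (intro A_mem) auto
  ultimately show ?case by (simp add: fold_invariant)
qed auto

lemma bounded_op_fold:
  assumes "i \<in> {1..k}" "set w \<subseteq> {1..n i}"
  shows "bounded_op H H (fold (A i) w)"
  using assms(2)
proof (induction w)
  case (Cons s w)
  then show ?case using bounded_op_compose[OF bounded_op_A[OF assms(1)], of s H "fold (A i) w"]
    by (simp add: comp_def)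
qed (simp add: id_def bounded_op_id)

lemma bounded_op_word_fold:
  assumes "\<beta> \<in> multiwords k n" "j \<le> k"
  shows "bounded_op H H (word_fold A j \<beta>)"
  using assms(2)
proof (induction j)
  case 0
  show ?case by (rule bounded_op_cong[OF bounded_op_id]) (auto simp: H)
next
  case (Suc j)
  have "bounded_op H H (\<lambda>h. fold (A (Suc j)) (\<beta> (Suc j)) (word_fold A j \<beta> h))"
    using Suc assms(1)
      by (intro bounded_op_compose[OF Suc.IH] bounded_op_fold) (auto simp: multiwords_def)
  then show ?case by (rule bounded_op_cong) (auto simp: H)
qed

lemma bounded_op_word_op:
  assumes "i \<in> {1..k}" "set w \<subseteq> {1..n i}"
  shows "bounded_op H H (word_op (T i) w)"
  using assms(2)
proof (induction w)
  case (Cons s w)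
  then show ?case using bounded_op_compose[OF _ T[OF assms(1)], of H "word_op (T i) w" s]
    by (simp add: comp_def word_op_def)
qed (simp add: word_op_def id_def bounded_op_id)

text \<open>Adjunction reverses products: the adjoint of the first letter acts first, which is the
  order of \<open>fold\<close>.\<close>

lemma adj_word_op:
  assumes i: "i \<in> {1..k}" and w: "set w \<subseteq> {1..n i}" and h: "h \<in> H"
  shows "adj H (word_op (T i) w) h = fold (A i) w h"
  using w h
proof (induction w arbitrary: h)
  case Nil
  then show ?case by (intro adj_eqI H) (auto simp: word_op_def)
next
  case (Cons s w)
  have "adj H (word_op (T i) (s # w)) h = adj H (\<lambda>x. T i s (word_op (T i) w x)) h"
    by (simp add: word_op_def comp_def)
  also have "\<dots> = adj H (word_op (T i) w) (A i s h)"
    unfolding A_def using Cons.prems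
      by (intro adj_compose[OF H H bounded_op_word_op[OF i] T[OF i]]) auto
  also have "\<dots> = fold (A i) w (A i s h)" using Cons.prems by (intro Cons.IH A_mem i) auto
  finally show ?case by simp
qed

lemma fold_adj_word_op:
  assumes "\<beta> \<in> multiwords k n" "h \<in> H" "j \<le> k"
  shows "fold (\<lambda>i. adj H (word_op (T i) (\<beta> i))) [1..<Suc j] h = word_fold A j \<beta> h"
  using assms(3)
proof (induction j)
  case (Suc j)
  have "fold (\<lambda>i. adj H (word_op (T i) (\<beta> i))) [1..<Suc (Suc j)] h =
      adj H (word_op (T (Suc j)) (\<beta> (Suc j))) (word_fold A j \<beta> h)"
    using Suc by simp
  also have "\<dots> = word_fold A (Suc j) \<beta> h"
    using Suc.prems assms
    by (simp, intro adj_word_op word_fold_mem) (auto simp: multiwords_def)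
  finally show ?case .
qed simp

context
  assumes D_nonneg: "\<And>h. h \<in> H \<Longrightarrow> 0 \<le> D k h"
    and D_sum: "\<And>B h. finite B \<Longrightarrow> B \<subseteq> multiwords k n \<Longrightarrow> h \<in> H \<Longrightarrow>
      (\<Sum>\<beta>\<in>B. D k (word_fold A k \<beta> h)) \<le> (norm h)\<^sup>2"
begin

abbreviation "K \<equiv> berezin k n H T"
abbreviation "R \<equiv> sqrt_op H (defect k n H T)"

lemma defect_bounded: "bounded_op H H (defect k n H T)"
  using has_form_D by (simp add: has_form_def)

lemma defect_pos: "pos_op H (defect k n H T)"
  using pos_op_iff_form[OF has_form_D] D_nonneg by blast

lemma norm_R: "h \<in> H \<Longrightarrow> (norm (R h))\<^sup>2 = D k h"
  using norm_sqrt_op[OF H defect_bounded defect_pos] has_form_D by (simp add: has_form_def)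

lemma R_mem: "h \<in> H \<Longrightarrow> R h \<in> defect_space k n H T"
  unfolding defect_space_def closure_range_sqrt_op[OF H defect_bounded defect_pos, symmetric]
  by (rule subsetD[OF closure_subset]) blast

lemma hilbert_defect_space: "hilbert (defect_space k n H T)"
  unfolding defect_space_def by (rule hilbert_closure_range[OF H defect_bounded])

lemma word_fold_mem': "\<beta> \<in> multiwords k n \<Longrightarrow> h \<in> H \<Longrightarrow> word_fold A k \<beta> h \<in> H"
  by (rule word_fold_mem) (auto simp: multiwords_def)

text \<open>\<open>D_sum\<close> bounds all finite partial sums, so the family defining the kernel
  is square summable. For T the two context assumptions will come from the polyball, for M_T from
  density of the range of Y^(1/2).\<close>

lemma coord_K:
  assumes h: "h \<in> H"
  shows "coord (K h) \<beta> = (if \<beta> \<in> multiwords k n then R (word_fold A k \<beta> h) else 0)"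
proof -
  let ?f = "\<lambda>\<beta>. if \<beta> \<in> multiwords k n
     then R (fold (\<lambda>i. adj H (word_op (T i) (\<beta> i))) [1..<Suc k] h) else 0"
  have f: "?f \<beta> = (if \<beta> \<in> multiwords k n then R (word_fold A k \<beta> h) else 0)" for \<beta>
    using fold_adj_word_op[OF _ h order_refl] by simp
  have "coord (ell2_of ?f) = ?f"
  proof (rule coord_ell2_of_bounded)
    fix B :: "(nat \<Rightarrow> nat list) set" assume B: "finite B"
    have "(\<Sum>\<beta>\<in>B. (norm (?f \<beta>))\<^sup>2) = (\<Sum>\<beta>\<in>B \<inter> multiwords k n. D k (word_fold A k \<beta> h))"
      unfolding f using B h
      by (intro sum.mono_neutral_cong_right) (auto simp: norm_R word_fold_mem')
    also have "\<dots> \<le> (norm h)\<^sup>2" using B h by (intro D_sum) auto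
    finally show "(\<Sum>\<beta>\<in>B. (norm (?f \<beta>))\<^sup>2) \<le> (norm h)\<^sup>2" .
  qed
  then have "coord (K h) = ?f" by (simp add: berezin_def)
  then show ?thesis using f by simp
qed

lemma norm_coord_K:
  "h \<in> H \<Longrightarrow> \<beta> \<in> multiwords k n \<Longrightarrow> (norm (coord (K h) \<beta>))\<^sup>2 = D k (word_fold A k \<beta> h)"
  by (simp add: coord_K norm_R word_fold_mem')

lemma norm_K_le:
  assumes h: "h \<in> H"
  shows "norm (K h) \<le> norm h"
proof (rule norm_ell2_le)
  fix B :: "(nat \<Rightarrow> nat list) set" assume B: "finite B"
  have "(\<Sum>\<beta>\<in>B. (norm (coord (K h) \<beta>))\<^sup>2) = (\<Sum>\<beta>\<in>B \<inter> multiwords k n. D k (word_fold A k \<beta> h))"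
    using B h by (intro sum.mono_neutral_cong_right) (auto simp: coord_K norm_R word_fold_mem')
  also have "\<dots> \<le> (norm h)\<^sup>2" using B h by (intro D_sum) auto
  finally show "(\<Sum>\<beta>\<in>B. (norm (coord (K h) \<beta>))\<^sup>2) \<le> (norm h)\<^sup>2" .
qed simp

lemma bounded_op_K: "bounded_op H (ell2_tensor (multiwords k n) (defect_space k n H T)) K"
proof (rule bounded_opI[where C = 1])
  have b: "bounded_op H H (\<lambda>h. R (word_fold A k \<beta> h))" if "\<beta> \<in> multiwords k n" for \<beta>
    by (intro bounded_op_compose[OF bounded_op_word_fold[OF that order_refl]]
        sqrt_op(1)[OF H defect_bounded defect_pos])
  fix h assume h: "h \<in> H"
  show "K h \<in> ell2_tensor (multiwords k n) (defect_space k n H T)"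
    using h by (auto simp: ell2_tensor_def coord_K intro!: R_mem word_fold_mem')
  show "norm (K h) \<le> 1 * norm h" using norm_K_le[OF h] by simp
  show "K (h + h') = K h + K h'" if h': "h' \<in> H" for h'
    by (rule ell2_eqI)
      (use h h' bounded_op_add[OF b] in \<open>simp add: coord_K coord_add hilbert_add[OF H]\<close>)
  show "K (a *\<^sub>C h) = a *\<^sub>C K h" for a
    by (rule ell2_eqI)
      (use h bounded_op_scaleC[OF b] in \<open>simp add: coord_K coord_scaleC hilbert_scaleC[OF H] scaleC_zero_right\<close>)
qed

end

end

section \<open>Positivity of the partial defects\<close>

locale polyball_tuple = unimodular k n lam + op_tuple k n H T
  for k n lam and H :: "'a::complex_hilbert set" and T +
  assumes polyball: "T \<in> polyball k n lam H"
begin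

lemma row_contraction:
  assumes i: "i \<in> {1..k}" and h: "h \<in> H"
  shows "row_form (n i) (A i) (\<lambda>h. (norm h)\<^sup>2) h \<le> (norm h)\<^sup>2"
proof -
  have "has_form H (\<lambda>h. h - cp_map H (n i) (T i) (\<lambda>x. x) h)
      (\<lambda>h. (norm h)\<^sup>2 - row_form (n i) (A i) (\<lambda>h. (norm h)\<^sup>2) h)"
    unfolding A_def[abs_def] by (intro has_form_diff has_form_cp_map has_form_id H T i)
  from pos_op_iff_form[OF this] show ?thesis using polyball i h by (auto simp: polyball_def)
qed

lemma A_commute:
  assumes "i \<in> {1..k}" "j \<in> {1..k}" "i \<noteq> j" "s \<in> {1..n i}" "t \<in> {1..n j}"
  shows "A j t (A i s h) = cnj (lam i j s t) *\<^sub>C A i s (A j t h)"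
proof (rule hilbert_ext[OF H])
  show "A j t (A i s h) \<in> H" "cnj (lam i j s t) *\<^sub>C A i s (A j t h) \<in> H"
    using assms by (auto intro!: A_mem hilbert_scaleC H)
  fix z assume z: "z \<in> H"
  have "cinner z (A j t (A i s h)) = cinner (T i s (T j t z)) h"
    unfolding A_def using assms z by (simp add: cinner_adj[OF H T] bounded_op_mem[OF T])
  also have "T i s (T j t z) = lam i j s t *\<^sub>C T j t (T i s z)"
    using polyball assms z unfolding polyball_def mem_Collect_eq by blast
  also have "cinner \<dots> h = cinner z (cnj (lam i j s t) *\<^sub>C A i s (A j t h))"
    unfolding A_def using assms z
    by (simp add: cinner_adj[OF H T] bounded_op_mem[OF T] cinner_scaleC_left cinner_scaleC_right)
  finally show "cinner z (A j t (A i s h)) = cinner z (cnj (lam i j s t) *\<^sub>C A i s (A j t h))" .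
qed

lemma contraction_scaled:
  assumes i: "i \<in> {1..k}" and h: "h \<in> H"
  shows "(\<Sum>s=1..n i. (norm (r *\<^sub>R A i s h))\<^sup>2) \<le> r\<^sup>2 * (norm h)\<^sup>2"
  using mult_left_mono[OF row_contraction[OF i h], of "r\<^sup>2"]
  by (simp add: row_form_def power_mult_distrib sum_distrib_left)

text \<open>The subtracted row form obeys the same bound as the form before it, so each row at most
  doubles the constant. This starts the iteration in
  \<open>defect_form_scaled_nonneg\<close>.\<close>

lemma defect_form_bound:
  assumes "j \<le> k" "h \<in> H" "0 \<le> r" "r \<le> 1"
  shows "\<bar>defect_form n (\<lambda>i s h. r *\<^sub>R A i s h) j h\<bar> \<le> 2 ^ j * (norm h)\<^sup>2"
  using assms(1,2)
proof (induction j arbitrary: h)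
  case (Suc j)
  let ?q = "defect_form n (\<lambda>i s h. r *\<^sub>R A i s h) j"
  have IH: "\<bar>?q h\<bar> \<le> 2 ^ j * (norm h)\<^sup>2" if "h \<in> H" for h using Suc that by simp
  have "\<bar>\<Sum>s=1..n (Suc j). ?q (r *\<^sub>R A (Suc j) s h)\<bar> \<le>
      (\<Sum>s=1..n (Suc j). 2 ^ j * (norm (r *\<^sub>R A (Suc j) s h))\<^sup>2)"
    using Suc.prems
    by (intro order_trans[OF sum_abs] sum_mono IH hilbert_scaleR H A_mem) auto
  also have "\<dots> \<le> 2 ^ j * (r\<^sup>2 * (norm h)\<^sup>2)"
    using contraction_scaled[of "Suc j" h r] Suc.prems by (simp flip: sum_distrib_left)
  also have "\<dots> \<le> 2 ^ j * (norm h)\<^sup>2"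
    using assms(3,4) by (intro mult_left_mono mult_left_le_one_le power_le_one) auto
  finally show ?case using IH[OF Suc.prems(2)] by (simp add: row_form_def)
qed simp

text \<open>Downward induction from j = k, where the claim is the regularity hypothesis read through
  scaled adjoints. If q - Phi(q) \<ge> 0 then q dominates every iterate Phi^m(q), and strictness of
  r < 1 makes the lower bounds of these iterates tend to 0.\<close>

lemma defect_form_scaled_nonneg:
  assumes r: "0 \<le> r" "r < 1" and "j \<le> k" "h \<in> H"
  shows "0 \<le> defect_form n (\<lambda>i s h. r *\<^sub>R A i s h) j h"
  using assms(3,4)
proof (induction j arbitrary: h rule: inc_induct)
  case base
  have "op_tuple k n H (\<lambda>i s h. r *\<^sub>R T i s h)"
    by standard (use H T in \<open>auto simp: scaleR_scaleC bounded_op_scale\<close>)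
  then interpret r: op_tuple k n H "\<lambda>i s h. r *\<^sub>R T i s h" .
  have rA: "r.A i s = (\<lambda>h. r *\<^sub>R A i s h)" if "i \<in> {1..k}" "s \<in> {1..n i}" for i s
  proof
    fix h
    show "r.A i s h = r *\<^sub>R A i s h"
      unfolding r.A_def
      by (rule adj_eqI[OF H])
        (use that in \<open>auto intro!: hilbert_scaleC[OF H] adj_mem[OF H T] simp: scaleR_scaleC
          cinner_scaleC_left cinner_scaleC_right A_def cinner_adj[OF H T]\<close>)
  qed
  have "defect_form n r.A j h = defect_form n (\<lambda>i s h. r *\<^sub>R A i s h) j h" if "j \<le> k" for j h
    using that by (induction j arbitrary: h) (auto simp: row_form_def rA)
  then show ?case
    using pos_op_iff_form[OF r.has_form_D] polyball r base by (auto simp: polyball_def)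
next
  case (step j)
  let ?q = "defect_form n (\<lambda>i s h. r *\<^sub>R A i s h) j"
  have ge: "row_form (n (Suc j)) (\<lambda>s h. r *\<^sub>R A (Suc j) s h) ?q h \<le> ?q h" if "h \<in> H" for h
    using step.IH[OF that] by simp
  \<comment> \<open>Each application of q \<ge> Phi(q) gains a factor r^2 from the row
    contraction.\<close>
  have iter: "- (2 ^ j * (r\<^sup>2) ^ m * (norm h)\<^sup>2) \<le> ?q h" if "h \<in> H" for h m
    using that
  proof (induction m arbitrary: h)
    case 0
    then show ?case using defect_form_bound[of j h r] step.hyps r by auto
  next
    case (Suc m)
    have j: "Suc j \<in> {1..k}" using step.hyps by simp
    have "- (2 ^ j * (r\<^sup>2) ^ Suc m * (norm h)\<^sup>2) = - (2 ^ j * (r\<^sup>2) ^ m) * (r\<^sup>2 * (norm h)\<^sup>2)"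
      by (simp add: algebra_simps)
    also have "\<dots> \<le> - (2 ^ j * (r\<^sup>2) ^ m) * (\<Sum>s=1..n (Suc j). (norm (r *\<^sub>R A (Suc j) s h))\<^sup>2)"
      by (rule mult_left_mono_neg[OF contraction_scaled[OF j Suc.prems]]) simp
    also have "\<dots> = (\<Sum>s=1..n (Suc j). - (2 ^ j * (r\<^sup>2) ^ m * (norm (r *\<^sub>R A (Suc j) s h))\<^sup>2))"
      by (simp add: sum_distrib_left sum_negf mult.assoc)
    also have "\<dots> \<le> row_form (n (Suc j)) (\<lambda>s h. r *\<^sub>R A (Suc j) s h) ?q h"
      unfolding row_form_def by (intro sum_mono Suc.IH hilbert_scaleR H A_mem j) auto
    also have "\<dots> \<le> ?q h" by (rule ge[OF Suc.prems])
    finally show ?case .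
  qed
  have "(\<lambda>m. - (2 ^ j * (r\<^sup>2) ^ m * (norm h)\<^sup>2)) \<longlonglongrightarrow> - (2 ^ j * 0 * (norm h)\<^sup>2)"
    using r by (intro tendsto_intros LIMSEQ_realpow_zero)
        (auto simp: power_less_one_iff abs_square_less_1)
  then show ?case using iter[OF step.prems] by (intro LIMSEQ_le_const2) auto
qed

text \<open>The adjoint is continuous on the whole ambient type, so sequences there are
  allowed.\<close>

lemma tendsto_A:
  assumes "i \<in> {1..k}" "s \<in> {1..n i}" "X \<longlonglongrightarrow> x"
  shows "(\<lambda>m. A i s (X m)) \<longlonglongrightarrow> A i s x"
  unfolding A_def
  by (rule tendsto_bounded_op[where M = UNIV, OF _ bounded_op_adj[OF H T[OF assms(1,2)]] _ _
      assms(3)])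
    (simp_all add: hilbert_def)

text \<open>Scalar and vector vary together because the recursion evaluates the form at vectors that
  already contain the scalar.\<close>

lemma tendsto_defect_form:
  assumes "r \<longlonglongrightarrow> 1" "j \<le> k" "X \<longlonglongrightarrow> x"
  shows "(\<lambda>m. defect_form n (\<lambda>i s h. r m *\<^sub>R A i s h) j (X m)) \<longlonglongrightarrow> D j x"
  using assms(2,3)
proof (induction j arbitrary: X x)
  case (Suc j)
  have "(\<lambda>m. \<Sum>s=1..n (Suc j). defect_form n (\<lambda>i s h. r m *\<^sub>R A i s h) j (r m *\<^sub>R A (Suc j) s (X m)))
      \<longlonglongrightarrow> (\<Sum>s=1..n (Suc j). D j (1 *\<^sub>R A (Suc j) s x))"
    by (intro tendsto_sum Suc.IH tendsto_scaleR assms(1) tendsto_A) (use Suc.prems in auto)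
  with Suc show ?case by (auto simp: row_form_def intro!: tendsto_diff)
qed (auto intro!: tendsto_intros)

lemma D_nonneg:
  assumes "j \<le> k" "h \<in> H"
  shows "0 \<le> D j h"
proof (rule LIMSEQ_le_const)
  show "(\<lambda>m. defect_form n (\<lambda>i s h. (1 - inverse (real (Suc m))) *\<^sub>R A i s h) j h) \<longlonglongrightarrow> D j h"
  proof (rule tendsto_defect_form[OF _ assms(1) tendsto_const])
    show "(\<lambda>m. 1 - inverse (real (Suc m))) \<longlonglongrightarrow> 1"
      using tendsto_diff[OF tendsto_const LIMSEQ_inverse_real_of_nat, of 1] by simp
  qed
  show "\<exists>N. \<forall>m\<ge>N. 0 \<le> defect_form n (\<lambda>i s h. (1 - inverse (real (Suc m))) *\<^sub>R A i s h) j h"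
    by (intro exI allI impI defect_form_scaled_nonneg assms) (auto simp: field_simps)
qed

end

section \<open>The Berezin kernel of a tuple in the polyball\<close>

text \<open>The form of q + Phi(q) + ... + Phi^(p-1)(q), that is, q summed along all words of length
  less than p, see \<open>word_sum_eq\<close>.\<close>

fun word_sum :: "nat \<Rightarrow> (nat \<Rightarrow> 'a \<Rightarrow> 'a) \<Rightarrow> nat \<Rightarrow> ('a \<Rightarrow> real) \<Rightarrow> 'a \<Rightarrow> real" where
  "word_sum m A 0 q h = 0"
| "word_sum m A (Suc p) q h = q h + (\<Sum>s=1..m. word_sum m A p q (A s h))"

definition words :: "nat \<Rightarrow> nat \<Rightarrow> nat list set" where
  "words m p = {w. set w \<subseteq> {1..m} \<and> length w < p}"

lemma words_Suc: "words m (Suc p) = insert [] ((\<lambda>(s, w). s # w) ` ({1..m} \<times> words m p))"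
proof (rule set_eqI)
  fix w
  show "w \<in> words m (Suc p) \<longleftrightarrow> w \<in> insert [] ((\<lambda>(s, w). s # w) ` ({1..m} \<times> words m p))"
    by (cases w) (auto simp: words_def)
qed

lemma finite_words: "finite (words m p)"
  by (induction p) (simp add: words_def, simp add: words_Suc)

lemma word_sum_eq: "word_sum m A p q h = (\<Sum>w\<in>words m p. q (fold A w h))"
proof (induction p arbitrary: h)
  case 0
  then show ?case by (simp add: words_def)
next
  case (Suc p)
  have "(\<Sum>w\<in>words m (Suc p). q (fold A w h)) =
      q h + (\<Sum>w\<in>(\<lambda>(s, w). s # w) ` ({1..m} \<times> words m p). q (fold A w h))"
    unfolding words_Suc by (subst sum.insert) (auto intro: finite_imageI finite_SigmaI finite_words)
  also have "(\<Sum>w\<in>(\<lambda>(s, w). s # w) ` ({1..m} \<times> words m p). q (fold A w h)) =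
      (\<Sum>(s, w)\<in>{1..m} \<times> words m p. q (fold A w (A s h)))"
    by (subst sum.reindex) (auto simp: inj_on_def case_prod_unfold)
  also have "\<dots> = (\<Sum>s=1..m. \<Sum>w\<in>words m p. q (fold A w (A s h)))"
    by (rule sum.cartesian_product[symmetric])
  finally show ?case by (simp add: Suc.IH)
qed

text \<open>Geometric series on forms: (id + Phi + ... + Phi^(p-1)) (id - Phi) = id - Phi^p.\<close>

lemma word_sum_telescope:
  "word_sum m A p (\<lambda>h. q h - row_form m A q h) h = q h - (row_form m A ^^ p) q h"
proof (induction p arbitrary: h)
  case (Suc p)
  have "word_sum m A (Suc p) (\<lambda>h. q h - row_form m A q h) h =
      q h - row_form m A q h + (\<Sum>s=1..m. q (A s h) - (row_form m A ^^ p) q (A s h))"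
    by (simp only: word_sum.simps Suc.IH)
  also have "\<dots> = q h - (row_form m A ^^ Suc p) q h"
    by (simp add: row_form_def sum_subtractf)
  finally show ?case .
qed simp

text \<open>The index j allows induction over components, the later ones staying empty. The strict
  bound \<open>p i\<close> matches the exponent of Phi_i in \<open>defect_pow\<close>.\<close>

definition bounded_multiwords :: "(nat \<Rightarrow> nat) \<Rightarrow> (nat \<Rightarrow> nat) \<Rightarrow> nat \<Rightarrow> (nat \<Rightarrow> nat list) set" where
  "bounded_multiwords n p j =
     {\<beta>. (\<forall>i\<in>{1..j}. \<beta> i \<in> words (n i) (p i)) \<and> (\<forall>i. i \<notin> {1..j} \<longrightarrow> \<beta> i = [])}"

lemma bounded_multiwords_0: "bounded_multiwords n p 0 = {\<lambda>_. []}"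
  by (auto simp: bounded_multiwords_def)

lemma bij_betw_bounded_multiwords:
  "bij_betw (\<lambda>(\<beta>, w). \<beta>(Suc j := w)) (bounded_multiwords n p j \<times> words (n (Suc j)) (p (Suc j)))
     (bounded_multiwords n p (Suc j))"
proof (rule bij_betw_byWitness[where f' = "\<lambda>\<beta>. (\<beta>(Suc j := []), \<beta> (Suc j))"])
  show "\<forall>a\<in>bounded_multiwords n p j \<times> words (n (Suc j)) (p (Suc j)).
      ((case a of (\<beta>, w) \<Rightarrow> \<beta>(Suc j := w))(Suc j := []), (case a of (\<beta>, w) \<Rightarrow> \<beta>(Suc j := w)) (Suc j)) = a"
    by (auto simp: bounded_multiwords_def fun_eq_iff)
qed (auto simp: bounded_multiwords_def)

lemma finite_bounded_multiwords: "finite (bounded_multiwords n p j)"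
proof (induction j)
  case (Suc j)
  then show ?case using bij_betw_finite[OF bij_betw_bounded_multiwords] finite_words by blast
qed (simp add: bounded_multiwords_0)

lemma sum_bounded_multiwords_Suc:
  "(\<Sum>\<beta>\<in>bounded_multiwords n p (Suc j). g \<beta>) =
   (\<Sum>\<beta>\<in>bounded_multiwords n p j. \<Sum>w\<in>words (n (Suc j)) (p (Suc j)). g (\<beta>(Suc j := w)))"
  unfolding sum.cartesian_product
  by (rule sum.reindex_bij_betw[OF bij_betw_bounded_multiwords, symmetric, THEN trans])
    (simp add: case_prod_unfold)

lemma bounded_multiwords_subset: "j \<le> k \<Longrightarrow> bounded_multiwords n p j \<subseteq> multiwords k n"
  by (auto simp: bounded_multiwords_def multiwords_def words_def)

section \<open>Contractivity, injectivity and intertwining of the kernel\<close>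

context polyball_tuple
begin

lemma fold_mem: "i \<in> {1..k} \<Longrightarrow> set w \<subseteq> {1..n i} \<Longrightarrow> h \<in> H \<Longrightarrow> fold (A i) w h \<in> H"
  by (rule bounded_op_mem[OF bounded_op_fold])

lemma fold_A_commute:
  assumes i: "i \<in> {1..k}" "s \<in> {1..n i}" and l: "l \<in> {1..k}" "set w \<subseteq> {1..n l}" "i \<noteq> l"
  shows "fold (A l) w (A i s h) = cnj (lambda_word lam i l s w) *\<^sub>C A i s (fold (A l) w h)"
  using l(2)
proof (induction w arbitrary: h)
  case Nil
  then show ?case by (simp add: lambda_word_def scaleC_one)
next
  case (Cons t w)
  have "fold (A l) (t # w) (A i s h) = fold (A l) w (cnj (lam i l s t) *\<^sub>C A i s (A l t h))"
    using A_commute[of i l s t h] i l Cons.prems by simp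
  also have "\<dots> = cnj (lam i l s t) *\<^sub>C fold (A l) w (A i s (A l t h))"
    using Cons.prems l i by (intro bounded_op_scaleC[OF bounded_op_fold] A_mem) auto
  also have "fold (A l) w (A i s (A l t h)) =
      cnj (lambda_word lam i l s w) *\<^sub>C A i s (fold (A l) w (A l t h))"
    using Cons by simp
  finally show ?case by (simp add: lambda_word_def scaleC_scaleC)
qed

text \<open>For j = i - 1 the scalar is the conjugate of the model coefficient; this is where the
  weights of the universal model meet the commutation relations of T.\<close>

lemma word_fold_A_commute:
  assumes i: "i \<in> {1..k}" "s \<in> {1..n i}" and \<beta>: "\<beta> \<in> multiwords k n" and j: "j < i" and h: "h \<in> H"
  shows "word_fold A j \<beta> (A i s h) =
    cnj (\<Prod>l\<in>{1..j}. lambda_word lam i l s (\<beta> l)) *\<^sub>C A i s (word_fold A j \<beta> h)"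
  using j
proof (induction j)
  case 0
  then show ?case by (simp add: scaleC_one)
next
  case (Suc j)
  let ?c = "\<lambda>j. cnj (\<Prod>l\<in>{1..j}. lambda_word lam i l s (\<beta> l))"
  have j: "Suc j \<in> {1..k}" "set (\<beta> (Suc j)) \<subseteq> {1..n (Suc j)}"
    using Suc.prems i multiwords_letters[OF \<beta>, of "Suc j"] by auto
  have "word_fold A (Suc j) \<beta> (A i s h) =
      fold (A (Suc j)) (\<beta> (Suc j)) (?c j *\<^sub>C A i s (word_fold A j \<beta> h))"
    using Suc by simp
  also have "\<dots> = ?c j *\<^sub>C fold (A (Suc j)) (\<beta> (Suc j)) (A i s (word_fold A j \<beta> h))"
    by (intro bounded_op_scaleC[OF bounded_op_fold[OF j]] A_mem i)
  also have "\<dots> = ?c j *\<^sub>C cnj (lambda_word lam i (Suc j) s (\<beta> (Suc j))) *\<^sub>C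
      A i s (word_fold A (Suc j) \<beta> h)"
    using fold_A_commute[OF i j] Suc.prems by simp
  finally show ?case by (simp add: scaleC_scaleC)
qed

text \<open>The factor is left unspecified: it enters only through \<open>D_unimodular\<close>,
  which discards it.\<close>

lemma word_fold_fold_commute:
  assumes i: "i \<in> {1..k}" "set w \<subseteq> {1..n i}" and \<beta>: "\<beta> \<in> multiwords k n" and j: "j < i" and h: "h \<in> H"
  shows "\<exists>c. cmod c = 1 \<and> word_fold A j \<beta> (fold (A i) w h) = c *\<^sub>C fold (A i) w (word_fold A j \<beta> h)"
  using i(2) h
proof (induction w arbitrary: h)
  case Nil
  show ?case by (rule exI[of _ 1]) (simp add: scaleC_one)
next
  case (Cons s w)
  have s: "s \<in> {1..n i}" and w: "set w \<subseteq> {1..n i}" using Cons.prems by auto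
  let ?d = "cnj (\<Prod>l\<in>{1..j}. lambda_word lam i l s (\<beta> l))"
  have d: "cmod ?d = 1"
  proof -
    \<comment> \<open>The product is a model coefficient of the multiword truncated after component
      j, since empty words contribute 1; hence its modulus is 1.\<close>
    have "model_coeff lam i s (\<lambda>l. if l \<in> {1..j} then \<beta> l else []) =
        (\<Prod>l\<in>{1..j}. lambda_word lam i l s (\<beta> l))"
      unfolding model_coeff_def
      by (rule prod.mono_neutral_cong_right) (use j in \<open>auto simp: lambda_word_def\<close>)
    moreover have "(\<lambda>l. if l \<in> {1..j} then \<beta> l else []) \<in> F" using \<beta> by (auto simp: multiwords_def)
    ultimately show ?thesis using cmod_model_coeff[OF _ i(1) s] by (metis complex_mod_cnj)
  qed
  have wf: "word_fold A j \<beta> x \<in> H" if "x \<in> H" for x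
    using bounded_op_mem[OF bounded_op_word_fold[OF \<beta>] that] i j by simp
  obtain c where c: "cmod c = 1"
    "word_fold A j \<beta> (fold (A i) w (A i s h)) = c *\<^sub>C fold (A i) w (word_fold A j \<beta> (A i s h))"
    using Cons.IH[OF w A_mem[OF i(1) s]] by blast
  have "fold (A i) w (word_fold A j \<beta> (A i s h)) = ?d *\<^sub>C fold (A i) w (A i s (word_fold A j \<beta> h))"
    unfolding word_fold_A_commute[OF i(1) s \<beta> j Cons.prems(2)]
    by (rule bounded_op_scaleC[OF bounded_op_fold[OF i(1) w] A_mem[OF i(1) s]])
  with c d show ?case
    by (intro exI[of _ "c * ?d"]) (simp add: norm_mult scaleC_scaleC)
qed

lemma D_unimodular:
  assumes "j \<le> k" "cmod c = 1" "h \<in> H"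
  shows "D j (c *\<^sub>C h) = D j h"
  using assms(1,3)
proof (induction j arbitrary: h)
  case 0
  then show ?case using assms(2) by (simp add: norm_scaleC)
next
  case (Suc j)
  have "A (Suc j) s (c *\<^sub>C h) = c *\<^sub>C A (Suc j) s h" if "s \<in> {1..n (Suc j)}" for s
    using Suc.prems that by (intro bounded_op_scaleC[OF bounded_op_A]) auto
  moreover have "D j (c *\<^sub>C A (Suc j) s h) = D j (A (Suc j) s h)" if "s \<in> {1..n (Suc j)}" for s
    using Suc.prems that by (intro Suc.IH A_mem) auto
  ultimately have "row_form (n (Suc j)) (A (Suc j)) (D j) (c *\<^sub>C h) =
      row_form (n (Suc j)) (A (Suc j)) (D j) h"
    unfolding row_form_def by (intro sum.cong) simp_all
  then show ?case using Suc by simp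
qed

text \<open>Induction over components. For the new row, id - Phi^p is the sum of Phi^l (id - Phi)
  over l < p. The words of the new row then become the next component of the multiword, after moving
  past the earlier components at the cost of a unimodular factor.\<close>

lemma defect_pow_form_eq:
  assumes "j \<le> k" "h \<in> H"
  shows "defect_pow_form n A p j h = (\<Sum>\<beta>\<in>bounded_multiwords n p j. D j (word_fold A j \<beta> h))"
  using assms
proof (induction j arbitrary: h)
  case 0
  then show ?case by (simp add: bounded_multiwords_0)
next
  case (Suc j)
  let ?m = "n (Suc j)" and ?B = "bounded_multiwords n p j" and ?W = "words (n (Suc j)) (p (Suc j))"
  let ?Z = "defect_pow_form n A p j"
  have i: "Suc j \<in> {1..k}" using Suc.prems by simp
  have B: "\<beta> \<in> multiwords k n" if "\<beta> \<in> ?B" for \<beta>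
    using that bounded_multiwords_subset[of j k n p] Suc.prems by auto
  have wf: "word_fold A j \<beta> x \<in> H" if "\<beta> \<in> ?B" "x \<in> H" for \<beta> x
    using bounded_op_mem[OF bounded_op_word_fold[OF B[OF that(1)]] that(2)] Suc.prems by simp
  have W: "set w \<subseteq> {1..?m}" if "w \<in> ?W" for w using that by (simp add: words_def)
  have IH: "?Z x = (\<Sum>\<beta>\<in>?B. D j (word_fold A j \<beta> x))" if "x \<in> H" for x
    using Suc.IH[OF _ that] Suc.prems by simp
  \<comment> \<open>Under the sum, id - Phi for row j + 1 passes through the words of earlier
    components and turns \<open>D j\<close> into \<open>D (Suc j)\<close>.\<close>
  have row: "?Z x - row_form ?m (A (Suc j)) ?Z x = (\<Sum>\<beta>\<in>?B. D (Suc j) (word_fold A j \<beta> x))"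
    if x: "x \<in> H" for x
  proof -
    have "D j (word_fold A j \<beta> (A (Suc j) s x)) = D j (A (Suc j) s (word_fold A j \<beta> x))"
      if \<beta>: "\<beta> \<in> ?B" and s: "s \<in> {1..?m}" for \<beta> s
    proof -
      obtain c where "cmod c = 1"
        "word_fold A j \<beta> (fold (A (Suc j)) [s] x) = c *\<^sub>C fold (A (Suc j)) [s] (word_fold A j \<beta> x)"
        using word_fold_fold_commute[OF i _ B[OF \<beta>] _ x, of "[s]" j] s by auto
      then show ?thesis
        using D_unimodular[of j c "A (Suc j) s (word_fold A j \<beta> x)"] Suc.prems A_mem[OF i s]
        by simp
    qed
    then have "row_form ?m (A (Suc j)) ?Z x =
        (\<Sum>s=1..?m. \<Sum>\<beta>\<in>?B. D j (A (Suc j) s (word_fold A j \<beta> x)))"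
      unfolding row_form_def by (intro sum.cong refl) (simp add: IH A_mem[OF i])
    also have "\<dots> = (\<Sum>\<beta>\<in>?B. row_form ?m (A (Suc j)) (D j) (word_fold A j \<beta> x))"
      unfolding row_form_def by (rule sum.swap)
    finally show ?thesis by (simp add: IH[OF x] sum_subtractf)
  qed
  have "defect_pow_form n A p (Suc j) h =
      word_sum ?m (A (Suc j)) (p (Suc j)) (\<lambda>x. ?Z x - row_form ?m (A (Suc j)) ?Z x) h"
    by (simp add: word_sum_telescope)
  also have "\<dots> = (\<Sum>w\<in>?W. \<Sum>\<beta>\<in>?B. D (Suc j) (word_fold A j \<beta> (fold (A (Suc j)) w h)))"
    unfolding word_sum_eq by (intro sum.cong refl row fold_mem i W Suc.prems)
  also have "\<dots> = (\<Sum>w\<in>?W. \<Sum>\<beta>\<in>?B. D (Suc j) (word_fold A (Suc j) (\<beta>(Suc j := w)) h))"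
  proof (intro sum.cong refl)
    fix w \<beta> assume w: "w \<in> ?W" and \<beta>: "\<beta> \<in> ?B"
    obtain c where c: "cmod c = 1"
      "word_fold A j \<beta> (fold (A (Suc j)) w h) = c *\<^sub>C fold (A (Suc j)) w (word_fold A j \<beta> h)"
      using word_fold_fold_commute[OF i W[OF w] B[OF \<beta>] _ Suc.prems(2), of j] by auto
    have "word_fold A j (\<beta>(Suc j := w)) h = word_fold A j \<beta> h" by (rule word_fold_cong) simp
    then show "D (Suc j) (word_fold A j \<beta> (fold (A (Suc j)) w h)) =
        D (Suc j) (word_fold A (Suc j) (\<beta>(Suc j := w)) h)"
      unfolding c(2)
        using D_unimodular[OF Suc.prems(1) c(1) fold_mem[OF i W[OF w] wf[OF \<beta> Suc.prems(2)]]]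
      by (simp del: defect_form.simps)
  qed
  also have "\<dots> = (\<Sum>\<beta>\<in>bounded_multiwords n p (Suc j). D (Suc j) (word_fold A (Suc j) \<beta> h))"
    unfolding sum_bounded_multiwords_Suc by (rule sum.swap)
  finally show ?case .
qed

lemma row_form_pow_nonneg:
  assumes "i \<in> {1..k}" "\<And>h. h \<in> H \<Longrightarrow> 0 \<le> q h" "h \<in> H"
  shows "0 \<le> (row_form (n i) (A i) ^^ p) q h"
  using assms(3)
proof (induction p arbitrary: h)
  case (Suc p)
  show ?case
    unfolding funpow.simps(2) comp_apply
        row_form_def[of "n i" "A i" "(row_form (n i) (A i) ^^ p) q"]
    by (intro sum_nonneg Suc.IH A_mem assms(1))
qed (simp add: assms(2))

text \<open>Each step subtracts a nonnegative quantity: by the previous lemma the earlier form is a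
  sum of partial defects \<open>D j\<close>, and \<open>D_nonneg\<close> covers these for every j
  \<le> k.\<close>

lemma defect_pow_form_le: "j \<le> k \<Longrightarrow> h \<in> H \<Longrightarrow> defect_pow_form n A p j h \<le> (norm h)\<^sup>2"
proof (induction j arbitrary: h)
  case (Suc j)
  have "0 \<le> defect_pow_form n A p j x" if "x \<in> H" for x
  proof -
    have "0 \<le> D j (word_fold A j \<beta> x)" if "\<beta> \<in> bounded_multiwords n p j" for \<beta>
      using that bounded_multiwords_subset[of j k n p] Suc.prems \<open>x \<in> H\<close>
      by (intro D_nonneg bounded_op_mem[OF bounded_op_word_fold]) auto
    then show ?thesis using defect_pow_form_eq[of j x p] Suc.prems that by (simp add: sum_nonneg)
  qed
  then have "0 \<le> (row_form (n (Suc j)) (A (Suc j)) ^^ p (Suc j)) (defect_pow_form n A p j) h"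
    using Suc.prems by (intro row_form_pow_nonneg) auto
  then show ?case using Suc by force
qed simp

lemma D_word_fold_nonneg: "\<beta> \<in> multiwords k n \<Longrightarrow> h \<in> H \<Longrightarrow> 0 \<le> D k (word_fold A k \<beta> h)"
  by (intro D_nonneg bounded_op_mem[OF bounded_op_word_fold]) auto

lemma D_sum:
  assumes B: "finite B" "B \<subseteq> multiwords k n" and h: "h \<in> H"
  shows "(\<Sum>\<beta>\<in>B. D k (word_fold A k \<beta> h)) \<le> (norm h)\<^sup>2"
proof -
  \<comment> \<open>One more than the total length strictly exceeds every single length, uniformly
    over \<open>B\<close>.\<close>
  define p where "p i = Suc (\<Sum>\<beta>\<in>B. length (\<beta> i))" for i
  have "length (\<beta> i) < p i" if "\<beta> \<in> B" for \<beta> i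
    using member_le_sum[OF that, of "\<lambda>\<beta>. length (\<beta> i)"] B(1) by (simp add: p_def)
  then have "B \<subseteq> bounded_multiwords n p k"
    using B(2) unfolding bounded_multiwords_def multiwords_def words_def by blast
  then have "(\<Sum>\<beta>\<in>B. D k (word_fold A k \<beta> h)) \<le>
      (\<Sum>\<beta>\<in>bounded_multiwords n p k. D k (word_fold A k \<beta> h))"
    using bounded_multiwords_subset[of k k n p] h
    by (intro sum_mono2 finite_bounded_multiwords D_word_fold_nonneg) auto
  also have "\<dots> = defect_pow_form n A p k h" using h by (simp add: defect_pow_form_eq)
  also have "\<dots> \<le> (norm h)\<^sup>2" using h by (simp add: defect_pow_form_le)
  finally show ?thesis .
qed

lemmas berezin_bounded = bounded_op_K[OF D_nonneg[OF order_refl] D_sum]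
  and coord_berezin = coord_K[OF D_nonneg[OF order_refl] D_sum]
  and norm_coord_berezin = norm_coord_K[OF D_nonneg[OF order_refl] D_sum]
  and hilbert_defect = hilbert_defect_space[OF D_nonneg[OF order_refl] D_sum]

text \<open>The form of \<open>defect_pow\<close> at h is a finite sum of squared coordinates of the
  kernel at h. If the kernel vanishes there, all these forms vanish, contradicting complete
  non-coisometry unless h = 0.\<close>

lemma berezin_injective:
  assumes cnc: "completely_non_coisometric k n H T" and h: "h \<in> H" and zero: "berezin k n H T h = 0"
  shows "h = 0"
proof -
  have "cinner (defect_pow k n H T p h) h = 0" for p
  proof -
    have "cinner (defect_pow k n H T p h) h = of_real (defect_pow_form n A p k h)"
      using has_form_defect_pow[OF H T, where p = p] h by (simp add: has_form_def A_def[abs_def])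
    also have "defect_pow_form n A p k h =
        (\<Sum>\<beta>\<in>bounded_multiwords n p k. (norm (coord (berezin k n H T h) \<beta>))\<^sup>2)"
      unfolding defect_pow_form_eq[OF order_refl h]
      using bounded_multiwords_subset[of k k n p] h
        by (intro sum.cong) (auto simp: norm_coord_berezin)
    finally show ?thesis by (simp add: zero coord_zero)
  qed
  then show ?thesis using cnc h unfolding completely_non_coisometric_def by blast
qed

text \<open>The relation $K T_{i,s}^* = (S_{i,s}^* \<otimes> I) K$. Moving the adjoint past the
  components below i produces the weight; component i absorbs it as a new first letter; later
  components act on both sides alike.\<close>

lemma berezin_intertwines:
  assumes i: "i \<in> {1..k}" "s \<in> {1..n i}" and h: "h \<in> H"
  shows "berezin k n H T (A i s h) = bshift i s (berezin k n H T h)"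
proof (rule ell2_eqI)
  fix \<beta>
  let ?R = "sqrt_op H (defect k n H T)" and ?\<gamma> = "\<beta>(i := s # \<beta> i)"
  let ?c = "cnj (model_coeff lam i s \<beta>)"
  have Ah: "A i s h \<in> H" by (rule A_mem[OF i])
  show "coord (berezin k n H T (A i s h)) \<beta> = coord (bshift i s (berezin k n H T h)) \<beta>"
  proof (cases "\<beta> \<in> F")
    case \<beta>: True
    have \<gamma>: "?\<gamma> \<in> F" by (rule cons_mem[OF i \<beta>])
    have wf: "word_fold A j \<alpha> x \<in> H" if "\<alpha> \<in> F" "x \<in> H" "j \<le> k" for \<alpha> x j
      using bounded_op_mem[OF bounded_op_word_fold] that by blast
    have "word_fold A j \<beta> (A i s h) = ?c *\<^sub>C word_fold A j ?\<gamma> h" if "i \<le> j" "j \<le> k" for j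
      using that
    proof (induction j rule: dec_induct)
      case base
      \<comment> \<open>With i = l + 1, the product over the components up to l is the one over j <
        i in \<open>model_coeff\<close>.\<close>
      obtain l where l: "i = Suc l" using i(1) by (cases i) auto
      have "word_fold A l \<beta> (A i s h) = ?c *\<^sub>C A i s (word_fold A l \<beta> h)"
        using word_fold_A_commute[OF i \<beta> _ h, of l]
          by (simp add: l model_coeff_def atLeastLessThanSuc_atLeastAtMost)
      moreover have "word_fold A l ?\<gamma> h = word_fold A l \<beta> h" by (rule word_fold_cong) (simp add: l)
      moreover have "word_fold A i \<alpha> x = fold (A i) (\<alpha> i) (word_fold A l \<alpha> x)" for \<alpha> x
        by (simp add: l)
      ultimately show ?case
        using bounded_op_scaleC[OF bounded_op_fold[OF i(1) multiwords_letters[OF \<beta> i(1)]]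
            A_mem[OF i]]
        by (simp del: word_fold_Suc fun_upd_apply add: fun_upd_same)
    next
      case (step j)
      have j: "Suc j \<in> {1..k}" using step by simp
      have "?\<gamma> (Suc j) = \<beta> (Suc j)" using step.hyps by simp
      then show ?case
        using step bounded_op_scaleC[OF bounded_op_fold[OF j multiwords_letters[OF \<beta> j]]
            wf[OF \<gamma> h, of j]]
        by (simp del: fun_upd_apply)
    qed
    from this[of k] have "word_fold A k \<beta> (A i s h) = ?c *\<^sub>C word_fold A k ?\<gamma> h" using i by simp
    then show ?thesis
      using bounded_op_scaleC[OF sqrt_op(1)[OF H] wf[OF \<gamma> h order_refl]] has_form_D
        pos_op_iff_form[OF has_form_D] D_nonneg[OF order_refl]
      by (simp add: coord_berezin Ah h \<beta> \<gamma> coord_bshift[OF i] has_form_def)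
  qed (simp add: coord_berezin Ah coord_bshift[OF i])
qed

end

section \<open>The characteristic function\<close>

context unimodular
begin

definition vacuum :: "nat \<Rightarrow> (nat \<Rightarrow> nat list) set" where
  "vacuum j = {\<beta> \<in> F. \<forall>l\<in>{1..j}. \<beta> l = []}"

text \<open>The form of the projection onto the coordinates in \<open>vacuum j\<close>. On families
  supported in \<open>F\<close> it is the defect form of S \<otimes> I over the first j rows:
  \<open>vacuum_form_0\<close> and \<open>vacuum_form_Suc\<close> reproduce the recursion of
  \<open>defect_form\<close>.\<close>

definition vacuum_form :: "nat \<Rightarrow> 'a::complex_hilbert fock \<Rightarrow> real" where
  "vacuum_form j g = (\<Sum>\<^sub>\<infinity>\<beta>\<in>vacuum j. (norm (coord g \<beta>))\<^sup>2)"

lemma coord_sq_summable_on: "(\<lambda>\<beta>. (norm (coord g \<beta>))\<^sup>2) summable_on B"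
  by (rule summable_on_subset_banach[OF coord_sq_summable subset_UNIV])

lemma vacuum_form_0:
  assumes "g \<in> ell2_tensor F E"
  shows "vacuum_form 0 g = (norm g)\<^sup>2"
  unfolding vacuum_form_def ell2_norm_sq
  by (rule infsum_cong_neutral) (use ell2_tensor_coord_zero[OF assms] in \<open>auto simp: vacuum_def\<close>)

lemma vacuum_form_k: "vacuum_form k g = (norm (coord g (\<lambda>_. [])))\<^sup>2"
proof -
  have "\<beta> = (\<lambda>_. [])" if "\<beta> \<in> vacuum k" for \<beta>
  proof
    fix l show "\<beta> l = []" using that by (cases "l \<in> {1..k}") (auto simp: vacuum_def multiwords_def)
  qed
  moreover have "(\<lambda>_. []) \<in> vacuum k" by (simp add: vacuum_def multiwords_def)
  ultimately have "vacuum k = {\<lambda>_. []}" by blast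
  then show ?thesis by (simp add: vacuum_form_def)
qed

text \<open>The indices lost from \<open>vacuum j\<close> to \<open>vacuum (Suc j)\<close> have a
  nonempty component j + 1. Sorting them by its first letter s gives the coordinates of the backward
  shifts, up to unimodular factors.\<close>

lemma vacuum_form_Suc:
  assumes "j < k"
  shows "vacuum_form j g - (\<Sum>s=1..n (Suc j). vacuum_form j (bshift (Suc j) s g)) =
      vacuum_form (Suc j) g"
proof -
  let ?i = "Suc j" and ?q = "\<lambda>\<beta>. (norm (coord g \<beta>))\<^sup>2"
  let ?S = "{1..n ?i} \<times> vacuum j" and ?c = "\<lambda>(s, \<beta>). \<beta>(?i := s # \<beta> ?i)"
  have i: "?i \<in> {1..k}" using assms by simp
  have V: "\<beta> \<in> F" if "\<beta> \<in> vacuum j" for \<beta> using that by (simp add: vacuum_def)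
  have bij: "bij_betw ?c ?S (vacuum j - vacuum ?i)"
  proof (rule bij_betw_byWitness[where f' = "\<lambda>\<beta>. (hd (\<beta> ?i), \<beta>(?i := tl (\<beta> ?i)))"])
    show "?c ` ?S \<subseteq> vacuum j - vacuum ?i"
    proof clarify
      fix s \<beta> assume s: "s \<in> {1..n ?i}" and \<beta>: "\<beta> \<in> vacuum j"
      have "\<beta>(?i := s # \<beta> ?i) \<in> F" by (rule cons_mem[OF i s V[OF \<beta>]])
      then show "\<beta>(?i := s # \<beta> ?i) \<in> vacuum j - vacuum ?i" using \<beta> by (auto simp: vacuum_def)
    qed
    have ne: "\<beta> ?i \<noteq> []" if "\<beta> \<in> vacuum j - vacuum ?i" for \<beta>
      using that by (auto simp: vacuum_def le_Suc_eq)
    show "(\<lambda>\<beta>. (hd (\<beta> ?i), \<beta>(?i := tl (\<beta> ?i)))) ` (vacuum j - vacuum ?i) \<subseteq> ?S"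
    proof clarify
      fix \<beta> assume \<beta>: "\<beta> \<in> vacuum j" "\<beta> \<notin> vacuum ?i"
      then have w: "\<beta> ?i \<noteq> []" "set (\<beta> ?i) \<subseteq> {1..n ?i}"
        using ne multiwords_letters[OF V i] by auto
      then have "set (tl (\<beta> ?i)) \<subseteq> {1..n ?i}" by (cases "\<beta> ?i") auto
      then have "\<beta>(?i := tl (\<beta> ?i)) \<in> F" using multiwords_update[OF V[OF \<beta>(1)] i] by blast
      moreover have "hd (\<beta> ?i) \<in> {1..n ?i}" using w hd_in_set[OF w(1)] by blast
      ultimately show "hd (\<beta> ?i) \<in> {1..n ?i} \<and> \<beta>(?i := tl (\<beta> ?i)) \<in> vacuum j"
        using \<beta>(1) by (auto simp: vacuum_def)
    qed
    show "\<forall>\<beta>\<in>vacuum j - vacuum ?i. ?c (hd (\<beta> ?i), \<beta>(?i := tl (\<beta> ?i))) = \<beta>"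
      using ne by (auto simp: fun_eq_iff)
  qed (auto simp: fun_eq_iff)
  have sub: "vacuum ?i \<subseteq> vacuum j" by (auto simp: vacuum_def)
  have summ: "(\<lambda>x. ?q (?c x)) summable_on ?S"
    using summable_on_reindex_bij_betw[OF bij, of ?q] coord_sq_summable_on by blast
  have "vacuum_form j g = vacuum_form ?i g + (\<Sum>\<^sub>\<infinity>\<beta>\<in>vacuum j - vacuum ?i. ?q \<beta>)"
    unfolding vacuum_form_def
    using infsum_Un_disjoint[OF coord_sq_summable_on[of g "vacuum ?i"]
        coord_sq_summable_on[of g "vacuum j - vacuum ?i"]] sub
    by (simp add: Un_absorb1)
  also have "(\<Sum>\<^sub>\<infinity>\<beta>\<in>vacuum j - vacuum ?i. ?q \<beta>) = (\<Sum>\<^sub>\<infinity>x\<in>?S. ?q (?c x))"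
    by (rule infsum_reindex_bij_betw[OF bij, symmetric])
  also have "\<dots> = (\<Sum>\<^sub>\<infinity>s\<in>{1..n ?i}. \<Sum>\<^sub>\<infinity>\<beta>\<in>vacuum j. ?q (?c (s, \<beta>)))"
    using infsum_Sigma_banach[OF summ] by simp
  also have "\<dots> = (\<Sum>s=1..n ?i. vacuum_form j (bshift ?i s g))"
    unfolding infsum_finite[OF finite_atLeastAtMost]
  proof (rule sum.cong[OF refl])
    fix s assume s: "s \<in> {1..n ?i}"
    show "(\<Sum>\<^sub>\<infinity>\<beta>\<in>vacuum j. ?q (?c (s, \<beta>))) = vacuum_form j (bshift ?i s g)"
      unfolding vacuum_form_def
      by (rule infsum_cong)
        (simp add: coord_bshift[OF i s] V norm_scaleC cmod_model_coeff[OF _ i s])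
  qed
  finally show ?thesis by simp
qed

text \<open>The weights vanish in the norm. The word is prefixed unreversed because
  \<open>fold\<close> applies its first letter first.\<close>

lemma norm_coord_fold_bshift:
  assumes i: "i \<in> {1..k}" and w: "set w \<subseteq> {1..n i}" and \<gamma>: "\<gamma> \<in> F"
  shows "norm (coord (fold (bshift i) w g) \<gamma>) = norm (coord g (\<gamma>(i := w @ \<gamma> i)))"
  using w
proof (induction w arbitrary: g)
  case (Cons s w)
  have "\<gamma>(i := w @ \<gamma> i) \<in> F"
    using multiwords_letters[OF \<gamma> i] Cons.prems by (intro multiwords_update[OF \<gamma> i]) auto
  with Cons have "norm (coord (fold (bshift i) (s # w) g) \<gamma>) =
      norm (coord g ((\<gamma>(i := w @ \<gamma> i))(i := s # (\<gamma>(i := w @ \<gamma> i)) i)))"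
    using i by (simp add: coord_bshift norm_scaleC cmod_model_coeff del: fun_upd_apply)
  then show ?case by (simp only: fun_upd_upd fun_upd_same append_Cons)
qed simp

lemma norm_coord_word_fold_bshift:
  assumes \<beta>: "\<beta> \<in> F" and "j \<le> k" "\<gamma> \<in> F"
  shows "norm (coord (word_fold bshift j \<beta> g) \<gamma>) =
    norm (coord g (\<lambda>l. if l \<in> {1..j} then \<beta> l @ \<gamma> l else \<gamma> l))"
  using assms(2,3)
proof (induction j arbitrary: \<gamma>)
  case (Suc j)
  let ?i = "Suc j"
  have i: "?i \<in> {1..k}" using Suc.prems by simp
  have \<gamma>: "\<gamma>(?i := \<beta> ?i @ \<gamma> ?i) \<in> F"
    using multiwords_letters[OF Suc.prems(2) i] multiwords_letters[OF \<beta> i]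
    by (intro multiwords_update[OF Suc.prems(2) i]) auto
  have "norm (coord (word_fold bshift ?i \<beta> g) \<gamma>) =
      norm (coord (word_fold bshift j \<beta> g) (\<gamma>(?i := \<beta> ?i @ \<gamma> ?i)))"
    using norm_coord_fold_bshift[OF i multiwords_letters[OF \<beta> i] Suc.prems(2)] by simp
  also have "\<dots> =
      norm (coord g (\<lambda>l.
        if l \<in> {1..j} then \<beta> l @ (\<gamma>(?i := \<beta> ?i @ \<gamma> ?i)) l else (\<gamma>(?i := \<beta> ?i @ \<gamma> ?i)) l))"
    using Suc.prems by (intro Suc.IH \<gamma>) auto
  also have "(\<lambda>l. if l \<in> {1..j} then \<beta> l @ (\<gamma>(?i := \<beta> ?i @ \<gamma> ?i)) l else (\<gamma>(?i := \<beta> ?i @ \<gamma> ?i)) l) =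
      (\<lambda>l. if l \<in> {1..?i} then \<beta> l @ \<gamma> l else \<gamma> l)"
    by (auto simp: fun_eq_iff le_Suc_eq)
  finally show ?case .
qed simp

text \<open>Shifting back along \<beta> moves coordinate \<beta> to the empty multiword, which the
  full defect form isolates.\<close>

lemma vacuum_form_word_fold:
  assumes \<beta>: "\<beta> \<in> F"
  shows "vacuum_form k (word_fold bshift k \<beta> g) = (norm (coord g \<beta>))\<^sup>2"
proof -
  have "(\<lambda>l. if l \<in> {1..k} then \<beta> l @ [] else []) = \<beta>"
    using \<beta> by (auto simp: multiwords_def fun_eq_iff)
  moreover have "(\<lambda>_. []) \<in> F" by (simp add: multiwords_def)
  ultimately show ?thesis
    using norm_coord_word_fold_bshift[OF \<beta> order_refl, of "\<lambda>_. []" g] by (simp add: vacuum_form_k)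
qed

end

section \<open>M_T and its kernel, computed through the factor Psi\<close>

locale char_fun_tuple = polyball_tuple k n lam H T
  for k n lam and H :: "'a::complex_hilbert set" and T +
  fixes E :: "'e::complex_hilbert set" and \<Psi> :: "'e fock \<Rightarrow> 'a fock"
  assumes E: "hilbert E" and \<Psi>: "multi_analytic k n lam E (defect_space k n H T) \<Psi>"
    and resolution: "\<And>f. f \<in> ell2_tensor (multiwords k n) (defect_space k n H T) \<Longrightarrow>
      berezin k n H T (adj H (berezin k n H T) f) +
      \<Psi> (adj (ell2_tensor (multiwords k n) E) \<Psi> f) = f"
begin

abbreviation "L \<equiv> ell2_tensor F (defect_space k n H T)"
abbreviation "L' \<equiv> ell2_tensor F E"
abbreviation "\<Psi>s \<equiv> adj L' \<Psi>"
abbreviation "Y \<equiv> char_Y k n H T"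
abbreviation "Q \<equiv> char_sqrt k n H T"
abbreviation "M \<equiv> char_space k n H T"

lemma L: "hilbert L"
  by (rule hilbert_ell2_tensor[OF hilbert_defect])

lemma L': "hilbert L'"
  by (rule hilbert_ell2_tensor[OF E])

lemma bounded_op_\<Psi>: "bounded_op L' L \<Psi>"
  using \<Psi> by (simp add: multi_analytic_def)

lemma bounded_op_\<Psi>s: "bounded_op L L' \<Psi>s"
  by (rule bounded_op_adj[OF L' bounded_op_\<Psi>])

text \<open>The adjoint form of multi-analyticity, obtained by pairing with z and moving the shift
  across.\<close>

lemma \<Psi>s_bshift:
  assumes i: "i \<in> {1..k}" "s \<in> {1..n i}" and f: "f \<in> L"
  shows "\<Psi>s (bshift i s f) = bshift i s (\<Psi>s f)"
proof (rule hilbert_ext[OF L'])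
  show "\<Psi>s (bshift i s f) \<in> L'" by (rule adj_mem[OF L' bounded_op_\<Psi>])
  show "bshift i s (\<Psi>s f) \<in> L'"
    by (rule bounded_op_mem[OF bounded_op_bshift[OF i E] adj_mem[OF L' bounded_op_\<Psi>]])
  fix z assume z: "z \<in> L'"
  have \<Psi>z: "\<Psi> z \<in> L" by (rule bounded_op_mem[OF bounded_op_\<Psi> z])
  have sz: "shift i s z \<in> L'" by (rule bounded_op_mem[OF bounded_op_shift[OF i E] z])
  have "\<Psi> (shift i s z) = shift i s (\<Psi> z)"
    using \<Psi> i z tensor_id_model[OF i z] tensor_id_model[OF i \<Psi>z] unfolding multi_analytic_def
      by metis
  then have "cinner z (\<Psi>s (bshift i s f)) = cinner (\<Psi> (shift i s z)) f"
    by (simp add: cinner_adj[OF L' bounded_op_\<Psi> z] cinner_shift[OF i])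
  also have "\<dots> = cinner z (bshift i s (\<Psi>s f))"
    by (simp add: cinner_adj[OF L' bounded_op_\<Psi> sz, symmetric] cinner_shift[OF i])
  finally show "cinner z (\<Psi>s (bshift i s f)) = cinner z (bshift i s (\<Psi>s f))" .
qed

lemma Y_eq: "f \<in> L \<Longrightarrow> Y f = \<Psi> (\<Psi>s f)"
  using resolution[of f] by (simp add: char_Y_def algebra_simps)

lemma bounded_op_Y: "bounded_op L L Y"
  by (rule bounded_op_cong[OF bounded_op_compose[OF bounded_op_\<Psi>s bounded_op_\<Psi>] L]) (simp add: Y_eq)

lemma cinner_Y: "f \<in> L \<Longrightarrow> cinner (Y f) g = cinner (\<Psi>s f) (\<Psi>s g)"
  by (simp add: Y_eq cinner_adj[OF L' bounded_op_\<Psi> adj_mem[OF L' bounded_op_\<Psi>]])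

lemma pos_op_Y: "pos_op L Y"
  by (rule pos_opI) (auto simp: cinner_Y cinner_self intro!: exI[of _ "(norm _)\<^sup>2"])

lemma bounded_op_Q: "bounded_op L L Q"
  unfolding char_sqrt_def by (rule sqrt_op(1)[OF L bounded_op_Y pos_op_Y])

lemma Q_Q: "f \<in> L \<Longrightarrow> Q (Q f) = Y f"
  unfolding char_sqrt_def by (rule sqrt_op(3)[OF L bounded_op_Y pos_op_Y])

lemma Q_symmetric: "f \<in> L \<Longrightarrow> g \<in> L \<Longrightarrow> cinner (Q f) g = cinner f (Q g)"
  unfolding char_sqrt_def by (rule sqrt_op_symmetric[OF L bounded_op_Y pos_op_Y])

text \<open>Both squares equal <Y f, f>. So Q f \<mapsto> Psi* f is isometric, and computations with
  M_T on the range of Q become computations with backward shifts on \<open>L'\<close>.\<close>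

lemma norm_Q: "f \<in> L \<Longrightarrow> norm (Q f) = norm (\<Psi>s f)"
proof -
  assume f: "f \<in> L"
  have "(norm (Q f))\<^sup>2 = (norm (\<Psi>s f))\<^sup>2"
    unfolding char_sqrt_def norm_sqrt_op[OF L bounded_op_Y pos_op_Y f] cinner_Y[OF f] cinner_self
      by simp
  then show ?thesis by simp
qed

lemma M_eq: "M = closure (Q ` L)"
  unfolding char_space_def char_sqrt_def
    by (rule closure_range_sqrt_op[OF L bounded_op_Y pos_op_Y, symmetric])

lemma M: "hilbert M"
  unfolding M_eq by (rule hilbert_closure_range[OF L bounded_op_Q])

lemma M_subset: "M \<subseteq> L"
  unfolding M_eq using bounded_op_mem[OF bounded_op_Q]
    by (intro closure_minimal hilbert_closed[OF L]) auto

lemma Q_mem: "f \<in> L \<Longrightarrow> Q f \<in> M"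
  unfolding M_eq by (rule subsetD[OF closure_subset imageI])

lemma bounded_op_Q_M: "bounded_op L M Q"
  using bounded_op_Q Q_mem unfolding bounded_op_def by blast

lemma bshift_mem: "i \<in> {1..k} \<Longrightarrow> s \<in> {1..n i} \<Longrightarrow> f \<in> L \<Longrightarrow> bshift i s f \<in> L"
  by (rule bounded_op_mem[OF bounded_op_bshift[OF _ _ hilbert_defect]])

lemma norm_bshift: "i \<in> {1..k} \<Longrightarrow> s \<in> {1..n i} \<Longrightarrow> norm (bshift i s f) \<le> norm f"
  unfolding bshift_def by (intro norm_weighted_comp inj_on_cons) (auto simp: cmod_model_coeff)

text \<open>By \<open>norm_Q\<close> and the intertwining, |Q S* f| = |S* Psi* f| \<le> |Psi* f| =
  |Q f|. Hence Q f \<mapsto> Q S* f is well defined and contractive on a dense subspace.\<close>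

lemma char_tuple_exists:
  assumes i: "i \<in> {1..k}" "s \<in> {1..n i}"
  shows "\<exists>B. bounded_op M M B \<and> (\<forall>f\<in>L. B (Q f) = Q (model_adj_tensor_id k n lam i s f))"
proof -
  have "bounded_op L M (\<lambda>f. Q (bshift i s f))"
    by (rule bounded_op_compose[OF bounded_op_bshift[OF i hilbert_defect] bounded_op_Q_M])
  moreover have "norm (Q (bshift i s f)) \<le> 1 * norm (Q f)" if "f \<in> L" for f
    using norm_bshift[OF i, of "\<Psi>s f"] that by (simp add: norm_Q bshift_mem[OF i] \<Psi>s_bshift[OF i])
  ultimately show ?thesis
    using bounded_extension[OF L M M bounded_op_Q_M _ M_eq[symmetric]]
      unfolding model_adj_tensor_id[OF i]
    by blast
qed

text \<open>The choice term inside \<open>char_tuple\<close>, named so that M_T consists of the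
  adjoints of \<open>B i s\<close>; taking adjoints again recovers \<open>B i s\<close> on
  \<open>M\<close>.\<close>

definition B :: "nat \<Rightarrow> nat \<Rightarrow> 'a fock \<Rightarrow> 'a fock" where
  "B i s = (SOME A. bounded_op M M A \<and> (\<forall>f\<in>L. A (Q f) = Q (model_adj_tensor_id k n lam i s f)))"

lemma B:
  assumes i: "i \<in> {1..k}" "s \<in> {1..n i}"
  shows "bounded_op M M (B i s)" "f \<in> L \<Longrightarrow> B i s (Q f) = Q (bshift i s f)"
  using someI_ex[OF char_tuple_exists[OF i]] unfolding B_def model_adj_tensor_id[OF i] by auto

lemma char_tuple_eq: "char_tuple k n lam H T i s = adj M (B i s)"
  by (simp add: char_tuple_def B_def)

sublocale m: op_tuple k n M "char_tuple k n lam H T"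
  by standard (use M B(1) in \<open>auto simp: char_tuple_eq intro!: bounded_op_adj\<close>)

lemma m_A_Q:
  assumes i: "i \<in> {1..k}" "s \<in> {1..n i}" and f: "f \<in> L"
  shows "m.A i s (Q f) = Q (bshift i s f)"
  unfolding m.A_def char_tuple_eq using adj_adj[OF M M B(1)[OF i] Q_mem[OF f]] B(2)[OF i f] by simp

text \<open>\<open>defect_form\<close> for M_T and \<open>vacuum_form\<close> satisfy the same
  recursion once Q f is replaced by Psi* f.\<close>

lemma m_D_Q: "j \<le> k \<Longrightarrow> f \<in> L \<Longrightarrow> m.D j (Q f) = vacuum_form j (\<Psi>s f)"
proof (induction j arbitrary: f)
  case 0
  then show ?case by (simp add: norm_Q vacuum_form_0[OF bounded_op_mem[OF bounded_op_\<Psi>s]])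
next
  case (Suc j)
  have i: "Suc j \<in> {1..k}" using Suc.prems by simp
  have "row_form (n (Suc j)) (m.A (Suc j)) (m.D j) (Q f) =
      (\<Sum>s=1..n (Suc j). vacuum_form j (bshift (Suc j) s (\<Psi>s f)))"
    unfolding row_form_def
    by (rule sum.cong[OF refl])
      (use Suc in \<open>simp add: m_A_Q[OF i] bshift_mem[OF i] \<Psi>s_bshift[OF i]\<close>)
  then show ?case using Suc vacuum_form_Suc[of j "\<Psi>s f"] by simp
qed

lemma word_fold_bshift_mem:
  "\<beta> \<in> F \<Longrightarrow> j \<le> k \<Longrightarrow> f \<in> L \<Longrightarrow> word_fold bshift j \<beta> f \<in> L"
proof (induction j)
  case (Suc j)
  have i: "Suc j \<in> {1..k}" using Suc.prems by simp
  show ?case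
    unfolding word_fold_Suc
    by (rule fold_invariant)
      (use Suc multiwords_letters[OF Suc.prems(1) i] i in \<open>auto intro!: bshift_mem\<close>)
qed simp

lemma word_fold_Q: "\<beta> \<in> F \<Longrightarrow> j \<le> k \<Longrightarrow> f \<in> L \<Longrightarrow> word_fold m.A j \<beta> (Q f) = Q (word_fold bshift j \<beta> f)"
proof (induction j)
  case (Suc j)
  have i: "Suc j \<in> {1..k}" using Suc.prems by simp
  have "fold (m.A (Suc j)) w (Q g) = Q (fold (bshift (Suc j)) w g)"
    if "set w \<subseteq> {1..n (Suc j)}" "g \<in> L" for w g
    using that by (induction w arbitrary: g) (simp_all add: m_A_Q[OF i] bshift_mem[OF i])
  then show ?case using Suc multiwords_letters[OF Suc.prems(1) i]
    by (simp add: word_fold_bshift_mem)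
qed simp

lemma word_fold_\<Psi>s: "\<beta> \<in> F \<Longrightarrow> j \<le> k \<Longrightarrow> f \<in> L \<Longrightarrow>
    \<Psi>s (word_fold bshift j \<beta> f) = word_fold bshift j \<beta> (\<Psi>s f)"
proof (induction j)
  case (Suc j)
  have i: "Suc j \<in> {1..k}" using Suc.prems by simp
  have "\<Psi>s (fold (bshift (Suc j)) w g) = fold (bshift (Suc j)) w (\<Psi>s g)"
    if "set w \<subseteq> {1..n (Suc j)}" "g \<in> L" for w g
    using that by (induction w arbitrary: g) (simp_all add: \<Psi>s_bshift[OF i] bshift_mem[OF i])
  then show ?case using Suc multiwords_letters[OF Suc.prems(1) i]
    by (simp add: word_fold_bshift_mem)
qed simp

lemma m_D_word_fold_Q:
  assumes "\<beta> \<in> F" "f \<in> L"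
  shows "m.D k (word_fold m.A k \<beta> (Q f)) = (norm (coord (\<Psi>s f) \<beta>))\<^sup>2"
  using assms
  by (simp add: word_fold_Q m_D_Q word_fold_bshift_mem word_fold_\<Psi>s vacuum_form_word_fold)

lemma tendsto_m_D:
  assumes "\<And>m. X m \<in> M" "x \<in> M" "X \<longlonglongrightarrow> x"
  shows "(\<lambda>i. m.D k (X i)) \<longlonglongrightarrow> m.D k x"
proof -
  let ?D = "defect k n M (char_tuple k n lam H T)"
  have D: "bounded_op M M ?D" "\<And>h. h \<in> M \<Longrightarrow> m.D k h = inner (?D h) h"
    using m.has_form_D by (simp_all add: has_form_def inner_Re_cinner)
  have "(\<lambda>i. inner (?D (X i)) (X i)) \<longlonglongrightarrow> inner (?D x) x"
    by (intro tendsto_inner tendsto_bounded_op[OF M D(1)] assms)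
  then show ?thesis by (simp add: D(2) assms(1,2))
qed

lemma M_sequence:
  assumes "x \<in> M"
  obtains X where "\<And>i. X i \<in> L" "(\<lambda>i. Q (X i)) \<longlonglongrightarrow> x"
  using closure_range_sequence[OF assms[unfolded M_eq]] by blast

text \<open>On the dense range of Q the form is the squared norm of one coordinate of Psi* f; its
  continuity does the rest. This and \<open>m_D_sum\<close> are the two assumptions under which the
  kernel was constructed.\<close>

lemma m_D_nonneg:
  assumes x: "x \<in> M"
  shows "0 \<le> m.D k x"
proof -
  obtain X where X: "\<And>i. X i \<in> L" "(\<lambda>i. Q (X i)) \<longlonglongrightarrow> x" using M_sequence[OF x] by blast
  have "(\<lambda>i. m.D k (Q (X i))) \<longlonglongrightarrow> m.D k x" by (rule tendsto_m_D[OF Q_mem[OF X(1)] x X(2)])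
  then show ?thesis by (rule LIMSEQ_le_const) (simp add: m_D_Q X(1) vacuum_form_k)
qed

text \<open>At x = Q f the left side is a finite part of the coordinate sum of |Psi* f|^2 = |Q f|^2;
  both sides are continuous in x.\<close>

lemma m_D_sum:
  assumes S: "finite S" "S \<subseteq> F" and x: "x \<in> M"
  shows "(\<Sum>\<beta>\<in>S. m.D k (word_fold m.A k \<beta> x)) \<le> (norm x)\<^sup>2"
proof -
  obtain X where X: "\<And>i. X i \<in> L" "(\<lambda>i. Q (X i)) \<longlonglongrightarrow> x" using M_sequence[OF x] by blast
  show ?thesis
  proof (rule LIMSEQ_le)
    show "(\<lambda>i. \<Sum>\<beta>\<in>S. m.D k (word_fold m.A k \<beta> (Q (X i)))) \<longlonglongrightarrow> (\<Sum>\<beta>\<in>S. m.D k (word_fold m.A k \<beta> x))"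
    proof (rule tendsto_sum)
      fix \<beta> assume "\<beta> \<in> S"
      then have wf: "bounded_op M M (word_fold m.A k \<beta>)" using S
        by (intro m.bounded_op_word_fold) auto
      show "(\<lambda>i. m.D k (word_fold m.A k \<beta> (Q (X i)))) \<longlonglongrightarrow> m.D k (word_fold m.A k \<beta> x)"
        by (intro tendsto_m_D bounded_op_mem[OF wf] tendsto_bounded_op[OF M wf] Q_mem X x)
    qed
    show "(\<lambda>i. (norm (Q (X i)))\<^sup>2) \<longlonglongrightarrow> (norm x)\<^sup>2" by (intro tendsto_intros X)
    have "(\<Sum>\<beta>\<in>S. m.D k (word_fold m.A k \<beta> (Q (X i)))) \<le> (norm (Q (X i)))\<^sup>2" for i
    proof -
      have "(\<Sum>\<beta>\<in>S. m.D k (word_fold m.A k \<beta> (Q (X i)))) = (\<Sum>\<beta>\<in>S. (norm (coord (\<Psi>s (X i)) \<beta>))\<^sup>2)"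
        by (intro sum.cong refl m_D_word_fold_Q X) (use S in auto)
      then show ?thesis using ell2_finite_sum_le[OF S(1), of "\<Psi>s (X i)"] by (simp add: norm_Q X(1))
    qed
    then show "\<exists>N. \<forall>i\<ge>N. (\<Sum>\<beta>\<in>S. m.D k (word_fold m.A k \<beta> (Q (X i)))) \<le> (norm (Q (X i)))\<^sup>2" by blast
  qed
qed

abbreviation "K' \<equiv> berezin k n M (char_tuple k n lam H T)"
abbreviation "N \<equiv> ell2_tensor F (char_defect_space k n lam H T)"
abbreviation "\<Theta> \<equiv> char_fun k n lam H T"

lemma bounded_op_K': "bounded_op M N K'"
  unfolding char_defect_space_def by (rule m.bounded_op_K[OF m_D_nonneg m_D_sum])

lemma N: "hilbert N"
  unfolding char_defect_space_def
  by (rule hilbert_ell2_tensor[OF m.hilbert_defect_space[OF m_D_nonneg m_D_sum]])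

text \<open>Coordinatewise, the kernel of M_T at Q f has the norms of Psi* f, so the total norms
  agree. Density then gives the isometry \<open>norm_K'\<close>.\<close>

lemma norm_K'_Q:
  assumes f: "f \<in> L"
  shows "norm (K' (Q f)) = norm (Q f)"
proof -
  have "(norm (coord (K' (Q f)) \<beta>))\<^sup>2 = (norm (coord (\<Psi>s f) \<beta>))\<^sup>2" for \<beta>
  proof (cases "\<beta> \<in> F")
    case True
    then show ?thesis
      using m.norm_coord_K[OF m_D_nonneg m_D_sum Q_mem[OF f] True] m_D_word_fold_Q[OF True f]
        by simp
  next
    case False
    then show ?thesis
      using ell2_tensor_coord_zero[OF bounded_op_mem[OF bounded_op_K' Q_mem[OF f]] False]
        ell2_tensor_coord_zero[OF bounded_op_mem[OF bounded_op_\<Psi>s f] False] by simp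
  qed
  then have "(norm (K' (Q f)))\<^sup>2 = (norm (\<Psi>s f))\<^sup>2" by (simp only: ell2_norm_sq)
  then show ?thesis by (simp add: norm_Q[OF f])
qed

lemma norm_K':
  assumes x: "x \<in> M"
  shows "norm (K' x) = norm x"
proof -
  obtain X where X: "\<And>i. X i \<in> L" "(\<lambda>i. Q (X i)) \<longlonglongrightarrow> x" using M_sequence[OF x] by blast
  have "(\<lambda>i. norm (K' (Q (X i)))) \<longlonglongrightarrow> norm (K' x)"
    by (intro tendsto_norm tendsto_bounded_op[OF M bounded_op_K'] Q_mem X x)
  moreover have "(\<lambda>i. norm (K' (Q (X i)))) \<longlonglongrightarrow> norm x"
    using tendsto_norm[OF X(2)] by (simp add: norm_K'_Q X(1))
  ultimately show ?thesis by (rule LIMSEQ_unique)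
qed

lemma adj_K'_K': "x \<in> M \<Longrightarrow> adj M K' (K' x) = x"
  by (rule adj_eqI[OF M]) (auto simp: isometry_cinner[OF M bounded_op_K' norm_K'])

lemma bounded_op_\<Theta>: "bounded_op N L \<Theta>"
proof -
  have "bounded_op M L Q" using bounded_op_Q M_subset unfolding bounded_op_def by blast
  from bounded_op_compose[OF bounded_op_adj[OF M bounded_op_K'] this]
  show ?thesis by (simp add: char_fun_def[abs_def])
qed

lemma adj_\<Theta>:
  assumes x: "x \<in> L"
  shows "adj N \<Theta> x = K' (Q x)"
proof (rule adj_eqI[OF N])
  show "K' (Q x) \<in> N" by (rule bounded_op_mem[OF bounded_op_K' Q_mem[OF x]])
  fix z assume z: "z \<in> N"
  have m: "adj M K' z \<in> M" by (rule adj_mem[OF M bounded_op_K'])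
  show "cinner (\<Theta> z) x = cinner z (K' (Q x))"
    using Q_symmetric[OF subsetD[OF M_subset m] x] cinner_adj_left[OF M bounded_op_K' Q_mem[OF x]]
    by (simp add: char_fun_def)
qed

text \<open>Theta = Q K'* and Theta* = K' Q, and K' is isometric, so the product collapses to Q Q =
  Y.\<close>

lemma \<Theta>_adj_\<Theta>: "x \<in> L \<Longrightarrow> \<Theta> (adj N \<Theta> x) = x - K (adj H K x)"
  by (simp add: adj_\<Theta> char_fun_def[of k n lam H T "K' _"] adj_K'_K' Q_mem Q_Q char_Y_def)

text \<open>Contractivity is clear for the adjoint: |Theta* x|^2 = <Y x, x> = |x|^2 - |K* x|^2. It
  returns to Theta as the adjoint of Theta*.\<close>

lemma norm_\<Theta>:
  assumes "\<phi> \<in> N"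
  shows "norm (\<Theta> \<phi>) \<le> norm \<phi>"
proof -
  have le: "norm (adj N \<Theta> x) \<le> 1 * norm x" if x: "x \<in> L" for x
  proof -
    have "(norm (adj N \<Theta> x))\<^sup>2 = (norm (\<Psi>s x))\<^sup>2"
      by (simp add: adj_\<Theta>[OF x] norm_K' Q_mem[OF x] norm_Q[OF x])
    also have "\<dots> = Re (cinner (Y x) x)" by (simp add: cinner_Y[OF x] cinner_self)
    also have "\<dots> = (norm x)\<^sup>2 - (norm (adj H K x))\<^sup>2"
      using cinner_adj[OF H berezin_bounded adj_mem[OF H berezin_bounded], of x x]
      by (simp add: char_Y_def cinner_diff_left cinner_self flip:
          cinner_adj[OF H berezin_bounded adj_mem[OF H berezin_bounded]])
    also have "\<dots> \<le> (norm x)\<^sup>2" by simp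
    finally have "norm (adj N \<Theta> x) \<le> norm x" by (rule power2_le_imp_le) simp
    then show ?thesis by simp
  qed
  have "norm (adj L (adj N \<Theta>) \<phi>) \<le> 1 * norm \<phi>"
    by (rule adj_norm_le[OF L bounded_op_adj[OF N bounded_op_\<Theta>] _ le]) simp
  then show ?thesis using adj_adj[OF N L bounded_op_\<Theta> assms] by simp
qed

end

section \<open>The functional model\<close>

lemma hilbert_Times:
  assumes "hilbert M" "hilbert N"
  shows "hilbert (M \<times> N)"
  using assms unfolding hilbert_def by (auto simp: closed_Times scaleC_prod_def zero_prod_def)

lemma hilbert_ortho_diff:
  assumes M: "hilbert M"
  shows "hilbert (ortho_diff M S)"
proof -
  have eq: "ortho_diff M S = M \<inter> (\<Inter>y\<in>S. {x. cinner x y = 0})"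
    by (auto simp: ortho_diff_def)
  have "closed (ortho_diff M S)"
    unfolding eq by (intro closed_Int closed_INT ballI hilbert_closed[OF M] closed_orthogonal)
  then show ?thesis
    using M by (auto simp: hilbert_def ortho_diff_def cinner_add_left cinner_scaleC_left)
qed

text \<open>The Hilbert space part of the argument, with no tuple involved: an injective K and a
  contraction Theta with Theta Theta* = I - K K*.\<close>

locale functional_model =
  fixes H :: "'a::complex_hilbert set" and L :: "'b::complex_hilbert set" and N :: "'c::complex_hilbert set"
    and K :: "'a \<Rightarrow> 'b" and \<Theta> :: "'c \<Rightarrow> 'b"
  assumes H: "hilbert H" and L: "hilbert L" and N: "hilbert N"
    and K: "bounded_op H L K" and K_inj: "\<And>h. h \<in> H \<Longrightarrow> K h = 0 \<Longrightarrow> h = 0"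
    and \<Theta>: "bounded_op N L \<Theta>" and norm_\<Theta>: "\<And>\<phi>. \<phi> \<in> N \<Longrightarrow> norm (\<Theta> \<phi>) \<le> norm \<phi>"
    and \<Theta>_adj: "\<And>x. x \<in> L \<Longrightarrow> \<Theta> (adj N \<Theta> x) = x - K (adj H K x)"
begin

abbreviation "Ks \<equiv> adj H K"
abbreviation "\<Theta>s \<equiv> adj N \<Theta>"

definition C :: "'c \<Rightarrow> 'c" where "C \<phi> = \<phi> - \<Theta>s (\<Theta> \<phi>)"
text \<open>The operator D_Theta; the letter does not refer to the defect of T here.\<close>

definition \<Delta> :: "'c \<Rightarrow> 'c" where "\<Delta> = sqrt_op N C"
definition \<K> :: "('b \<times> 'c) set" where "\<K> = L \<times> closure (\<Delta> ` N)"
definition \<H> :: "('b \<times> 'c) set" where "\<H> = ortho_diff \<K> {(\<Theta> \<phi>, \<Delta> \<phi>) | \<phi>. \<phi> \<in> N}"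

lemma bounded_op_\<Theta>s: "bounded_op L N \<Theta>s"
  by (rule bounded_op_adj[OF N \<Theta>])

lemma bounded_op_Ks: "bounded_op L H Ks"
  by (rule bounded_op_adj[OF H K])

lemma \<Theta>s_mem: "\<Theta>s x \<in> N"
  by (rule adj_mem[OF N \<Theta>])

lemma Ks_mem: "Ks x \<in> H"
  by (rule adj_mem[OF H K])

lemma bounded_op_C: "bounded_op N N C"
  unfolding C_def by (intro bounded_op_minus N bounded_op_id bounded_op_compose[OF \<Theta> bounded_op_\<Theta>s])

lemma cinner_C: "\<phi> \<in> N \<Longrightarrow> \<psi> \<in> N \<Longrightarrow> cinner (C \<phi>) \<psi> = cinner \<phi> \<psi> - cinner (\<Theta> \<phi>) (\<Theta> \<psi>)"
  by (simp add: C_def cinner_diff_left cinner_adj_left[OF N \<Theta>])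

lemma pos_op_C: "pos_op N C"
proof (rule pos_opI)
  fix \<phi> assume "\<phi> \<in> N"
  then show "\<exists>r\<ge>0. cinner (C \<phi>) \<phi> = of_real r"
    using norm_\<Theta>[of \<phi>]
      by (intro exI[of _ "(norm \<phi>)\<^sup>2 - (norm (\<Theta> \<phi>))\<^sup>2"]) (simp add: cinner_C cinner_self)
qed

lemma bounded_op_\<Delta>: "bounded_op N N \<Delta>"
  unfolding \<Delta>_def by (rule sqrt_op(1)[OF N bounded_op_C pos_op_C])

lemma cinner_\<Delta>: "\<phi> \<in> N \<Longrightarrow> \<psi> \<in> N \<Longrightarrow> cinner (\<Delta> \<phi>) (\<Delta> \<psi>) = cinner \<phi> \<psi> - cinner (\<Theta> \<phi>) (\<Theta> \<psi>)"
  unfolding \<Delta>_def by (simp add: cinner_sqrt_op[OF N bounded_op_C pos_op_C] cinner_C)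

lemma \<Delta>_mem: "\<phi> \<in> N \<Longrightarrow> \<Delta> \<phi> \<in> closure (\<Delta> ` N)"
  by (rule subsetD[OF closure_subset imageI])

lemma hilbert_\<H>: "hilbert \<H>"
  unfolding \<H>_def \<K>_def
  by (intro hilbert_ortho_diff hilbert_Times L hilbert_closure_range[OF N bounded_op_\<Delta>])

lemma \<H>_iff:
  "(u, v) \<in> \<H> \<longleftrightarrow> u \<in> L \<and> v \<in> closure (\<Delta> ` N) \<and> (\<forall>\<phi>\<in>N. cinner u (\<Theta> \<phi>) + cinner v (\<Delta> \<phi>) = 0)"
  by (auto simp: \<H>_def \<K>_def ortho_diff_def cinner_prod_def)

text \<open>With first component 0, orthogonality to all (Theta \<phi>, D_Theta \<phi>) says that v
  is orthogonal to the range of D_Theta, in whose closure it lies.\<close>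

lemma fst_zero:
  assumes "(0, v) \<in> \<H>"
  shows "v = 0"
proof (rule closure_orthogonal_zero)
  show "v \<in> closure (\<Delta> ` N)" using assms by (simp add: \<H>_iff)
  fix z assume "z \<in> \<Delta> ` N"
  then have "cinner v z = 0" using assms by (auto simp: \<H>_iff)
  then show "cinner z v = 0" using cinner_commute[of z v] by simp
qed

lemma inj_on_fst: "inj_on fst \<H>"
proof (rule inj_onI)
  fix x y assume xy: "x \<in> \<H>" "y \<in> \<H>" "fst x = fst y"
  then have "(0, snd x - snd y) \<in> \<H>" using hilbert_diff[OF hilbert_\<H> xy(1,2)]
    by (simp add: minus_prod_def)
  then have "snd x = snd y" using fst_zero[of "snd x - snd y"] by simp
  with xy(3) show "x = y" by (rule prod_eqI)
qed

text \<open>This is the orthogonal projection of \<open>(x, 0)\<close> onto \<open>\<H>\<close>.\<close>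

definition p :: "'b \<Rightarrow> 'b \<times> 'c" where "p x = (K (Ks x), - \<Delta> (\<Theta>s x))"

lemma p_orth:
  assumes x: "x \<in> L" and \<phi>: "\<phi> \<in> N"
  shows "cinner (K (Ks x)) (\<Theta> \<phi>) + cinner (- \<Delta> (\<Theta>s x)) (\<Delta> \<phi>) = 0"
proof -
  have "K (Ks x) = x - \<Theta> (\<Theta>s x)" using \<Theta>_adj[OF x] by simp
  then show ?thesis
    using cinner_adj_left[OF N \<Theta> \<phi>, of x]
    by (simp add: cinner_minus_left cinner_diff_left cinner_\<Delta>[OF \<Theta>s_mem \<phi>])
qed

lemma p_mem: "x \<in> L \<Longrightarrow> p x \<in> \<H>"
  unfolding p_def \<H>_iff
  using p_orth bounded_op_mem[OF K Ks_mem]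
    hilbert_uminus[OF hilbert_closure_range[OF N bounded_op_\<Delta>] \<Delta>_mem[OF \<Theta>s_mem]] by blast

lemma norm_p:
  assumes x: "x \<in> L"
  shows "norm (Ks x) = norm (p x)"
proof -
  let ?y = "K (Ks x)"
  have \<Theta>\<Theta>: "\<Theta> (\<Theta>s x) = x - ?y" by (rule \<Theta>_adj[OF x])
  have yx: "cinner ?y x = of_real ((norm (Ks x))\<^sup>2)"
    using cinner_adj[OF H K Ks_mem, of x x] by (simp add: cinner_self)
  then have xy: "cinner x ?y = of_real ((norm (Ks x))\<^sup>2)" using cinner_commute[of x ?y] by simp
  have "cinner (p x) (p x) = cinner ?y ?y + cinner (\<Delta> (\<Theta>s x)) (\<Delta> (\<Theta>s x))"
    by (simp add: p_def cinner_prod_def cinner_minus_left cinner_minus_right)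
  also have "cinner (\<Delta> (\<Theta>s x)) (\<Delta> (\<Theta>s x)) = cinner (\<Theta> (\<Theta>s x)) x - cinner (x - ?y) (x - ?y)"
    by (simp add: cinner_\<Delta> \<Theta>s_mem \<Theta>\<Theta> cinner_adj[OF N \<Theta> \<Theta>s_mem])
  also have "cinner ?y ?y + \<dots> = of_real ((norm (Ks x))\<^sup>2)"
    by (simp add: \<Theta>\<Theta> cinner_diff_left cinner_diff_right yx xy)
  finally have "(norm (p x))\<^sup>2 = (norm (Ks x))\<^sup>2" unfolding cinner_self of_real_eq_iff .
  then show ?thesis by simp
qed

lemma bounded_op_p: "bounded_op L \<H> p"
proof -
  have 1: "bounded_op L L (\<lambda>x. K (Ks x))" by (rule bounded_op_compose[OF bounded_op_Ks K])
  have 2: "bounded_op L N (\<lambda>x. \<Delta> (\<Theta>s x))"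
    by (rule bounded_op_compose[OF bounded_op_\<Theta>s bounded_op_\<Delta>])
  obtain c where c: "\<And>x. x \<in> L \<Longrightarrow> norm (Ks x) \<le> c * norm x"
    using bounded_op_bound[OF bounded_op_Ks] by blast
  show ?thesis
  proof (rule bounded_opI[where C = c])
    fix x assume x: "x \<in> L"
    show "p (x + y) = p x + p y" if y: "y \<in> L" for y
      unfolding p_def by (simp add: bounded_op_add[OF 1 x y] bounded_op_add[OF 2 x y])
    show "p (a *\<^sub>C x) = a *\<^sub>C p x" for a
      unfolding p_def
      by (simp add: bounded_op_scaleC[OF 1 x] bounded_op_scaleC[OF 2 x] scaleC_prod_def
          scaleC_minus_right)
    show "norm (p x) \<le> c * norm x" using c[OF x] norm_p[OF x] by simp
  qed (rule p_mem)
qed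

lemma dense_p: "closure (p ` L) = \<H>"
proof (rule dense_rangeI[OF hilbert_\<H> L bounded_op_p])
  fix w assume w: "w \<in> \<H>" and orth: "\<And>z. z \<in> L \<Longrightarrow> cinner (p z) w = 0"
  obtain u v where uv: "w = (u, v)" by (cases w)
  have u: "u \<in> L" using w by (simp add: uv \<H>_iff)
  \<comment> \<open>Membership in \<open>\<H>\<close> is tested with \<phi> = Theta* u,
    orthogonality to the range of \<open>p\<close> with z = u. In the sum the terms in v cancel, and
    Theta Theta* + K K* = I leaves |u|^2 = 0.\<close>
  have "cinner u (\<Theta> (\<Theta>s u)) + cinner v (\<Delta> (\<Theta>s u)) = 0" using w \<Theta>s_mem by (auto simp: uv \<H>_iff)
  then have "cinner (\<Theta> (\<Theta>s u)) u + cinner (\<Delta> (\<Theta>s u)) v = 0"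
    unfolding cinner_commute[of "\<Theta> (\<Theta>s u)" u] cinner_commute[of "\<Delta> (\<Theta>s u)" v]
    by (simp flip: complex_cnj_add)
  moreover have "cinner (K (Ks u)) u - cinner (\<Delta> (\<Theta>s u)) v = 0"
    using orth[OF u] by (simp add: uv p_def cinner_prod_def cinner_minus_left)
  ultimately have "cinner (\<Theta> (\<Theta>s u)) u + cinner (K (Ks u)) u = 0" by algebra
  then have "u = 0" by (simp add: \<Theta>_adj[OF u] cinner_diff_left cinner_self)
  then show "w = 0" using fst_zero[of v] w by (simp add: uv zero_prod_def)
qed

lemma dense_Ks: "closure (Ks ` L) = H"
proof (rule dense_rangeI[OF H L bounded_op_Ks])
  fix h assume h: "h \<in> H" and orth: "\<And>z. z \<in> L \<Longrightarrow> cinner (Ks z) h = 0"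
  have "cinner (K h) (K h) = 0"
    using orth[OF bounded_op_mem[OF K h]] cinner_adj_left[OF H K h] by simp
  then show "h = 0" using K_inj[OF h] by (simp add: cinner_self)
qed

lemma unitary_model: "\<exists>W. unitary_op H \<H> W \<and> (\<forall>h\<in>H. fst (W h) = K h)"
proof -
  obtain W where W: "unitary_op H \<H> W" "\<And>x. x \<in> L \<Longrightarrow> W (Ks x) = p x"
    using exists_unitary[OF L H hilbert_\<H> bounded_op_Ks bounded_op_p dense_Ks dense_p norm_p]
      by blast
  have bW: "bounded_op H \<H> W" using W(1) by (simp add: unitary_op_def)
  have bfst: "bounded_op \<H> UNIV fst"
    by (rule bounded_opI[where C = 1]) (auto simp: scaleC_prod_def norm_fst_le)
  \<comment> \<open>Both sides are bounded in h and agree on the dense range of K*, where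
    \<open>W (Ks x) = p x\<close>.\<close>
  have "fst (W h) = K h" if "h \<in> H" for h
    by (rule bounded_op_eq_dense[OF H bounded_op_compose[OF bW bfst] K dense_Ks _ that])
      (simp add: W(2) p_def)
  with W(1) show ?thesis by blast
qed

end

section \<open>Transport of the tuple along a unitary\<close>

context polyball_tuple
begin

context
  fixes H' :: "'b::complex_hilbert set" and W :: "'a \<Rightarrow> 'b"
  assumes H': "hilbert H'" and W: "unitary_op H H' W"
begin

abbreviation "V \<equiv> adj H W"

lemma bounded_op_W: "bounded_op H H' W"
  and VW: "\<And>h. h \<in> H \<Longrightarrow> V (W h) = h"
  and WV: "\<And>x. x \<in> H' \<Longrightarrow> W (V x) = x"
  using W by (auto simp: unitary_op_def)

lemma bounded_op_V: "bounded_op H' H V"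
  by (rule bounded_op_adj[OF H bounded_op_W])

lemma V_mem: "V x \<in> H"
  by (rule adj_mem[OF H bounded_op_W])

lemma norm_V: "x \<in> H' \<Longrightarrow> norm (V x) = norm x"
proof -
  assume x: "x \<in> H'"
  have "cinner (V x) (V x) = cinner x x" using cinner_adj[OF H bounded_op_W V_mem, of x x] WV[OF x]
    by simp
  then have "(norm (V x))\<^sup>2 = (norm x)\<^sup>2" unfolding cinner_self of_real_eq_iff .
  then show ?thesis by simp
qed

definition G :: "nat \<Rightarrow> nat \<Rightarrow> 'b \<Rightarrow> 'b" where "G i s x = W (T i s (V x))"

lemma bounded_op_G: "i \<in> {1..k} \<Longrightarrow> s \<in> {1..n i} \<Longrightarrow> bounded_op H' H' (G i s)"
  unfolding G_def[abs_def]
  by (rule bounded_op_compose[OF bounded_op_compose[OF bounded_op_V T] bounded_op_W])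

lemma adj_G:
  assumes i: "i \<in> {1..k}" "s \<in> {1..n i}" and y: "y \<in> H'"
  shows "adj H' (G i s) y = W (A i s (V y))"
proof (rule adj_eqI[OF H' bounded_op_mem[OF bounded_op_W A_mem[OF i]]])
  fix z assume z: "z \<in> H'"
  have "cinner (G i s z) y = cinner (T i s (V z)) (V y)"
    unfolding G_def
      by (rule cinner_adj[OF H bounded_op_W bounded_op_mem[OF T[OF i] V_mem], symmetric])
  also have "\<dots> = cinner (V z) (A i s (V y))"
    unfolding A_def by (rule cinner_adj[OF H T[OF i] V_mem, symmetric])
  also have "\<dots> = cinner z (W (A i s (V y)))"
    by (rule cinner_adj_left[OF H bounded_op_W A_mem[OF i]])
  finally show "cinner (G i s z) y = cinner z (W (A i s (V y)))" .
qed

lemma adj_scaleR: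
  assumes "hilbert M" "bounded_op M M X" "\<And>x. x \<in> M \<Longrightarrow> X' x = r *\<^sub>R X x"
  shows "adj M X' y = r *\<^sub>R adj M X y"
  by (rule adj_eqI[OF assms(1)])
    (use assms in \<open>auto intro!: hilbert_scaleC adj_mem simp: scaleR_scaleC cinner_scaleC_left
      cinner_scaleC_right cinner_adj\<close>)

text \<open>Positivity is transported on forms: those of G at x equal those of T at V x, for the row
  forms as well as the scaled defects.\<close>

lemma G_polyball: "G \<in> polyball k n lam H'"
proof -
  have row: "pos_op H' (\<lambda>h. h - cp_map H' (n i) (G i) (\<lambda>x. x) h)" if i: "i \<in> {1..k}" for i
  proof -
    have "has_form H' (\<lambda>h. h - cp_map H' (n i) (G i) (\<lambda>x. x) h)
        (\<lambda>h. (norm h)\<^sup>2 - row_form (n i) (\<lambda>s. adj H' (G i s)) (\<lambda>h. (norm h)\<^sup>2) h)"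
      by (intro has_form_diff has_form_cp_map has_form_id H' bounded_op_G i)
    moreover have "row_form (n i) (\<lambda>s. adj H' (G i s)) (\<lambda>h. (norm h)\<^sup>2) h \<le> (norm h)\<^sup>2"
      if h: "h \<in> H'" for h
    proof -
      have iso: "norm (W u) = norm u" if "u \<in> H" for u
        using norm_V[OF bounded_op_mem[OF bounded_op_W that]] by (simp add: VW[OF that])
      show ?thesis
        using row_contraction[OF i V_mem, of h]
          by (simp add: row_form_def adj_G[OF i] h norm_V iso A_mem[OF i])
    qed
    ultimately show ?thesis using pos_op_iff_form by fastforce
  qed
  have comm: "G i s (G j t x) = lam i j s t *\<^sub>C G j t (G i s x)"
    if "i \<in> {1..k}" "j \<in> {1..k}" "i \<noteq> j" "s \<in> {1..n i}" "t \<in> {1..n j}" "x \<in> H'" for i j s t x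
  proof -
    have "T i s (T j t (V x)) = lam i j s t *\<^sub>C T j t (T i s (V x))"
      using polyball that V_mem unfolding polyball_def mem_Collect_eq by blast
    then show ?thesis
      using that by (simp add: G_def VW bounded_op_mem[OF T] V_mem
          bounded_op_scaleC[OF bounded_op_W])
  qed
  have def: "pos_op H' (defect k n H' (\<lambda>i s h. r *\<^sub>R G i s h))" if r: "0 \<le> r" "r < 1" for r
  proof -
    have b: "bounded_op H' H' (\<lambda>h. r *\<^sub>R G i s h)" if "i \<in> {1..k}" "s \<in> {1..n i}" for i s
      unfolding scaleR_scaleC by (rule bounded_op_scale[OF H' bounded_op_G[OF that]])
    have adj: "adj H' (\<lambda>h. r *\<^sub>R G i s h) y = r *\<^sub>R adj H' (G i s) y"
      if "i \<in> {1..k}" "s \<in> {1..n i}" for i s y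
      by (rule adj_scaleR[OF H' bounded_op_G[OF that]]) simp
    have eq: "defect_form n (\<lambda>i s. adj H' (\<lambda>h. r *\<^sub>R G i s h)) j x =
        defect_form n (\<lambda>i s h. r *\<^sub>R A i s h) j (V x)" if "j \<le> k" "x \<in> H'" for j x
      using that
    proof (induction j arbitrary: x)
      case (Suc j)
      have i: "Suc j \<in> {1..k}" using Suc.prems by simp
      have "defect_form n (\<lambda>i s. adj H' (\<lambda>h. r *\<^sub>R G i s h)) j (adj H' (\<lambda>h. r *\<^sub>R G (Suc j) s h) x) =
          defect_form n (\<lambda>i s h. r *\<^sub>R A i s h) j (r *\<^sub>R A (Suc j) s (V x))" if s: "s \<in> {1..n (Suc j)}" for s
      proof -
        have "adj H' (\<lambda>h. r *\<^sub>R G (Suc j) s h) x = r *\<^sub>R W (A (Suc j) s (V x))"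
          using adj[OF i s] adj_G[OF i s Suc.prems(2)] by simp
        moreover have "V (r *\<^sub>R W (A (Suc j) s (V x))) = r *\<^sub>R A (Suc j) s (V x)"
          using bounded_op_scaleR[OF bounded_op_V bounded_op_mem[OF bounded_op_W A_mem[OF i s]]]
              VW[OF A_mem[OF i s]]
          by simp
        moreover have "r *\<^sub>R W (A (Suc j) s (V x)) \<in> H'"
          by (intro hilbert_scaleR H' bounded_op_mem[OF bounded_op_W A_mem[OF i s]])
        ultimately show ?thesis using Suc by simp
      qed
      then show ?case using Suc by (simp add: row_form_def)
    qed (simp add: norm_V)
    show ?thesis
      using pos_op_iff_form[OF has_form_defect[OF H' b]] eq[OF order_refl]
        defect_form_scaled_nonneg[OF r order_refl V_mem] by simp
  qed
  show ?thesis
    unfolding polyball_def mem_Collect_eq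
    by (intro conjI ballI allI impI H' bounded_op_G row comm def) simp_all
qed

lemma G_unitarily_equivalent: "unitarily_equivalent k n H T H' G"
  unfolding unitarily_equivalent_def
  by (rule exI[of _ W]) (simp add: W G_def VW bounded_op_mem[OF T])

end

end

section \<open>The functional model of T\<close>

context char_fun_tuple
begin

lemma functional_model:
  assumes cnc: "completely_non_coisometric k n H T"
  shows "functional_model H L N (berezin k n H T) \<Theta>"
  by standard
    (use H L N berezin_bounded berezin_injective[OF cnc] bounded_op_\<Theta> norm_\<Theta> \<Theta>_adj_\<Theta> in auto)

lemma functional_model_equivalent:
  assumes cnc: "completely_non_coisometric k n H T"
  shows "inj_on fst (model_H k n lam H T) \<and>
    (\<exists>G. (\<forall>i\<in>{1..k}. \<forall>s\<in>{1..n i}.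
            model_relation k n lam H T i s (G i s) \<and>
            (\<forall>B. model_relation k n lam H T i s B \<longrightarrow>
               (\<forall>f\<in>model_H k n lam H T. B f = G i s f))) \<and>
         G \<in> polyball k n lam (model_H k n lam H T) \<and>
         unitarily_equivalent k n H T (model_H k n lam H T) G)"
proof -
  interpret fm: functional_model H L N "berezin k n H T" \<Theta>
    by (rule functional_model[OF cnc])
  let ?M = "model_H k n lam H T"
  \<comment> \<open>The spaces of the abstract locale unfold to the concrete ones, so its
    conclusions apply to \<open>model_H\<close> directly.\<close>
  have "fm.\<Delta> = char_fun_defect k n lam H T"
    by (simp add: fm.\<Delta>_def fm.C_def[abs_def] char_fun_defect_def Let_def)
  then have M: "fm.\<H> = ?M"
    by (simp add: fm.\<H>_def fm.\<K>_def model_H_def model_K_def)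
  note hM = fm.hilbert_\<H>[unfolded M] and inj = fm.inj_on_fst[unfolded M]
  obtain W where W: "unitary_op H ?M W" and fst_W: "\<And>h. h \<in> H \<Longrightarrow> fst (W h) = berezin k n H T h"
    using fm.unitary_model unfolding M by blast
  let ?G = "\<lambda>i s. G W i s"
  have rel: "model_relation k n lam H T i s (?G i s) \<and>
      (\<forall>B. model_relation k n lam H T i s B \<longrightarrow> (\<forall>f\<in>?M. B f = ?G i s f))"
    if i: "i \<in> {1..k}" "s \<in> {1..n i}" for i s
  proof -
    note bG = bounded_op_G[OF hM W i]
    have G_rel: "fst (adj ?M (?G i s) f) = model_adj_tensor_id k n lam i s (fst f)"
      if f: "f \<in> ?M" for f
    proof -
      have Vf: "adj H W f \<in> H" by (rule V_mem[OF hM W])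
      \<comment> \<open>The adjoint of G is W A V, the first component of W is the kernel, and the
        kernel turns A into the backward shift.\<close>
      have "fst (adj ?M (?G i s) f) = berezin k n H T (A i s (adj H W f))"
        by (simp add: adj_G[OF hM W i f] fst_W A_mem[OF i])
      also have "\<dots> = bshift i s (fst (W (adj H W f)))"
        by (simp add: berezin_intertwines[OF i Vf] fst_W Vf)
      finally show ?thesis by (simp add: WV[OF hM W f] model_adj_tensor_id[OF i])
    qed
    have "B f = ?G i s f" if B: "model_relation k n lam H T i s B" and f: "f \<in> ?M" for B f
    proof -
      have bB: "bounded_op ?M ?M B" using B by (simp add: model_relation_def)
      \<comment> \<open>The relation fixes only first components of adjoints; injectivity of
        \<open>fst\<close> on the model space upgrades this to equality, and then B agrees with
        G.\<close>
      have "adj ?M B z = adj ?M (?G i s) z" if "z \<in> ?M" for z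
        by (rule inj_onD[OF inj]) (use B that G_rel adj_mem[OF hM bB] adj_mem[OF hM bG] in \<open>auto
            simp: model_relation_def\<close>)
      then show ?thesis
        by (intro hilbert_ext[OF hM] bounded_op_mem[OF bB f] bounded_op_mem[OF bG f])
          (simp add: cinner_adj_left[OF hM bB f, symmetric] cinner_adj_left[OF hM bG f, symmetric])
    qed
    then show ?thesis using bG G_rel by (simp add: model_relation_def)
  qed
  show ?thesis
  proof (intro conjI exI[of _ ?G])
    show "?G \<in> polyball k n lam ?M" by (rule G_polyball[OF hM W])
    show "unitarily_equivalent k n H T ?M ?G" by (rule G_unitarily_equivalent[OF hM W])
  qed (use inj rel in auto)
qed

end

theorem theorem5p6:
  fixes k :: nat and n :: "nat \<Rightarrow> nat"
    and lam :: "nat \<Rightarrow> nat \<Rightarrow> nat \<Rightarrow> nat \<Rightarrow> complex"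
    and H :: "'h::complex_hilbert set"
    and T :: "nat \<Rightarrow> nat \<Rightarrow> 'h \<Rightarrow> 'h"
  assumes "k \<ge> 1" and "\<And>i. i \<in> {1..k} \<Longrightarrow> n i \<ge> 1"
    and "\<And>i j s t. i \<in> {1..k} \<Longrightarrow> j \<in> {1..k} \<Longrightarrow> i \<noteq> j \<Longrightarrow> s \<in> {1..n i} \<Longrightarrow> t \<in> {1..n j} \<Longrightarrow>
           cmod (lam i j s t) = 1 \<and> lam j i t s = cnj (lam i j s t)"
    and "T \<in> polyball k n lam H"
    and "completely_non_coisometric k n H T"
    and "admits_characteristic_function TYPE('e::complex_hilbert) k n lam H T"
  shows "inj_on fst (model_H k n lam H T) \<and>
    (\<exists>G. (\<forall>i\<in>{1..k}. \<forall>s\<in>{1..n i}.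
            model_relation k n lam H T i s (G i s) \<and>
            (\<forall>B. model_relation k n lam H T i s B \<longrightarrow>
               (\<forall>f\<in>model_H k n lam H T. B f = G i s f))) \<and>
         G \<in> polyball k n lam (model_H k n lam H T) \<and>
         unitarily_equivalent k n H T (model_H k n lam H T) G)"
proof -
  have H: "hilbert H" and T: "\<And>i s. i \<in> {1..k} \<Longrightarrow> s \<in> {1..n i} \<Longrightarrow> bounded_op H H (T i s)"
    using assms(4) by (auto simp: polyball_def)
  have lam: "\<And>i j s t. i \<in> {1..k} \<Longrightarrow> j \<in> {1..k} \<Longrightarrow> i \<noteq> j \<Longrightarrow> s \<in> {1..n i} \<Longrightarrow>
      t \<in> {1..n j} \<Longrightarrow> cmod (lam i j s t) = 1"
    using assms(3) by blast
  \<comment> \<open>The factor Psi is an auxiliary witness: \<open>char_fun\<close> and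
    \<open>model_H\<close> are defined from T alone, so its choice does not affect the
    conclusion.\<close>
  obtain E :: "'e set" and \<Psi> where \<Psi>: "hilbert E" "multi_analytic k n lam E (defect_space k n H T) \<Psi>"
    "\<forall>f\<in>ell2_tensor (multiwords k n) (defect_space k n H T).
       berezin k n H T (adj H (berezin k n H T) f) + \<Psi> (adj (ell2_tensor (multiwords k n) E) \<Psi> f) = f"
    using assms(6) unfolding admits_characteristic_function_def by (elim exE conjE)
  interpret char_fun_tuple k n lam H T E \<Psi>
    by standard (fact lam H T assms(4) \<Psi>(1,2) \<Psi>(3)[rule_format])+
  show ?thesis by (rule functional_model_equivalent[OF assms(5)])
qed

end
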